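(* Let $I_b$ and $I_r$ be independent sets of a tree $T$ with $n$ vertices. If $I_b\rightsquigarrow_T I_r$, then there exists a reconfiguration sequence of length $O(n^2)$ between $I_b$ and $I_r$, and such a sequence can be output in $O(n^2)$ time.
   Context: For a graph $G$ and independent sets $I,J$ of $G$, $I\leftrightarrow J$ means there is an edge $\{a,b\}\in E(G)$ with $I\setminus J=\{a\}$ and $J\setminus I=\{b\}$ (one token slides along an edge). A reconfiguration sequence between $I_1$ and $I_\ell$ is a sequence $\langle I_1,\dots,I_\ell\rangle$ of independent sets with $I_{i-1}\leftrightarrow I_i$ for $i=2,\dots,\ell$; its length is the number $\ell$ of independent sets in it. $I\rightsquigarrow_G J$ means a reconfiguration sequence between $I$ and $J$ exists with all sets being subsets of $V(G)$. *)

theory Defs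
  imports Complex_Main "HOL-Library.Landau_Symbols"
begin

section \<open>Finite simple graphs and trees\<close>

text \<open>A graph is given by its vertex set \<open>V\<close> and its set \<open>E\<close> of two-element edges.\<close>

definition simple_graph :: "'a set \<Rightarrow> 'a set set \<Rightarrow> bool" where
  "simple_graph V E \<longleftrightarrow> finite V \<and> (\<forall>e\<in>E. e \<subseteq> V \<and> card e = 2)"

definition connected_graph :: "'a set \<Rightarrow> 'a set set \<Rightarrow> bool" where
  "connected_graph V E \<longleftrightarrow> V \<noteq> {} \<and> (\<forall>u\<in>V. \<forall>v\<in>V. (u, v) \<in> {(x, y). {x, y} \<in> E}\<^sup>*)"

definition cycle :: "'a set set \<Rightarrow> 'a list \<Rightarrow> bool" where
  "cycle E c \<longleftrightarrow> 3 \<le> length c \<and> distinct c \<and>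
     successively (\<lambda>x y. {x, y} \<in> E) c \<and> {last c, hd c} \<in> E"

definition tree :: "'a set \<Rightarrow> 'a set set \<Rightarrow> bool" where
  "tree V E \<longleftrightarrow> simple_graph V E \<and> connected_graph V E \<and> (\<nexists>c. cycle E c)"


section \<open>Token sliding\<close>

definition indep_set :: "'a set \<Rightarrow> 'a set set \<Rightarrow> 'a set \<Rightarrow> bool" where
  "indep_set V E I \<longleftrightarrow> I \<subseteq> V \<and> (\<forall>u\<in>I. \<forall>v\<in>I. {u, v} \<notin> E)"

definition slide :: "'a set set \<Rightarrow> 'a set \<Rightarrow> 'a set \<Rightarrow> bool" where
  "slide E I J \<longleftrightarrow> (\<exists>a b. {a, b} \<in> E \<and> I - J = {a} \<and> J - I = {b})"

definition reconf_seq :: "'a set \<Rightarrow> 'a set set \<Rightarrow> 'a set \<Rightarrow> 'a set \<Rightarrow> 'a set list \<Rightarrow> bool" where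
  "reconf_seq V E I J S \<longleftrightarrow> S \<noteq> [] \<and> hd S = I \<and> last S = J \<and>
     (\<forall>X\<in>set S. indep_set V E X) \<and> successively (slide E) S"

definition reconfigurable :: "'a set \<Rightarrow> 'a set set \<Rightarrow> 'a set \<Rightarrow> 'a set \<Rightarrow> bool" where
  "reconfigurable V E I J \<longleftrightarrow> (\<exists>S. reconf_seq V E I J S)"


section \<open>Random access machine programs and their running time\<close>

text \<open>
  Structured programs over registers and arrays of natural numbers. Registers and arrays are
  named by constants of the program text, so a program uses a fixed finite number of them, and
  arrays are accessed by computed indices.

  Every elementary command and every evaluation of a test costs one time unit. An expression has
  a size that is fixed by the program text, hence this counts elementary operations up to a
  constant factor. The only arithmetic is successor and (truncated) predecessor, so a program
  that runs for \<open>t\<close> steps exceeds the largest number in its input by at most \<open>O(t + 1)\<close>. In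
  particular, on inputs of size \<open>n\<close> with polynomial running time all numbers fit into words of
  \<open>O(log n)\<close> bits, and unit cost cannot be exploited by computing with huge numbers.
\<close>

datatype exp =
    Const nat
  | Reg nat
  | Cell nat exp
  | Succ exp
  | Pred exp

datatype test =
    Equal exp exp
  | Less exp exp
  | Neg test
  | Conj test test

datatype com =
    Skip
  | Assign nat exp
  | Store nat exp exp
  | Write exp
  | Seq com com
  | Cond test com com
  | While test com

record state =
  regs :: "nat \<Rightarrow> nat"
  arrs :: "nat \<Rightarrow> nat \<Rightarrow> nat"
  outp :: "nat list"

primrec eval_exp :: "exp \<Rightarrow> state \<Rightarrow> nat" where
  "eval_exp (Const k) s = k"
| "eval_exp (Reg r) s = regs s r"
| "eval_exp (Cell a e) s = arrs s a (eval_exp e s)"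
| "eval_exp (Succ e) s = eval_exp e s + 1"
| "eval_exp (Pred e) s = eval_exp e s - 1"

primrec eval_test :: "test \<Rightarrow> state \<Rightarrow> bool" where
  "eval_test (Equal e f) s \<longleftrightarrow> eval_exp e s = eval_exp f s"
| "eval_test (Less e f) s \<longleftrightarrow> eval_exp e s < eval_exp f s"
| "eval_test (Neg b) s \<longleftrightarrow> \<not> eval_test b s"
| "eval_test (Conj b c) s \<longleftrightarrow> eval_test b s \<and> eval_test c s"

text \<open>\<open>runs c s t s'\<close>: started in \<open>s\<close>, the program \<open>c\<close> halts after exactly \<open>t\<close> steps in \<open>s'\<close>.\<close>

inductive runs :: "com \<Rightarrow> state \<Rightarrow> nat \<Rightarrow> state \<Rightarrow> bool" where
  runs_Skip: "runs Skip s 1 s"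
| runs_Assign: "runs (Assign r e) s 1 (s\<lparr>regs := (regs s)(r := eval_exp e s)\<rparr>)"
| runs_Store: "runs (Store a e f) s 1
    (s\<lparr>arrs := (arrs s)(a := (arrs s a)(eval_exp e s := eval_exp f s))\<rparr>)"
| runs_Write: "runs (Write e) s 1 (s\<lparr>outp := outp s @ [eval_exp e s]\<rparr>)"
| runs_Seq: "runs c s t s' \<Longrightarrow> runs d s' u s'' \<Longrightarrow> runs (Seq c d) s (t + u) s''"
| runs_CondTrue: "eval_test b s \<Longrightarrow> runs c s t s' \<Longrightarrow> runs (Cond b c d) s (1 + t) s'"
| runs_CondFalse: "\<not> eval_test b s \<Longrightarrow> runs d s t s' \<Longrightarrow> runs (Cond b c d) s (1 + t) s'"
| runs_WhileFalse: "\<not> eval_test b s \<Longrightarrow> runs (While b c) s 1 s"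
| runs_WhileTrue: "eval_test b s \<Longrightarrow> runs c s t s' \<Longrightarrow> runs (While b c) s' u s'' \<Longrightarrow>
    runs (While b c) s (1 + t + u) s''"

inductive_cases runs_SkipE: "runs Skip s t s'"
inductive_cases runs_AssignE: "runs (Assign r e) s t s'"
inductive_cases runs_StoreE: "runs (Store a e f) s t s'"
inductive_cases runs_WriteE: "runs (Write e) s t s'"
inductive_cases runs_SeqE: "runs (Seq c d) s t s'"
inductive_cases runs_CondE: "runs (Cond b c d) s t s'"
inductive_cases runs_WhileE: "runs (While b c) s t s'"

lemma runs_deterministic:
  assumes "runs c s t s'" and "runs c s u s''"
  shows "u = t \<and> s'' = s'"
  using assms
proof (induction arbitrary: u s'' rule: runs.induct)
  case (runs_Skip s)
  then show ?case by (elim runs_SkipE) simp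
next
  case (runs_Assign s r e)
  then show ?case by (elim runs_AssignE) simp
next
  case (runs_Store s a e f)
  then show ?case by (elim runs_StoreE) simp
next
  case (runs_Write s e)
  then show ?case by (elim runs_WriteE) simp
next
  case (runs_Seq c s t s' d v r)
  from runs_Seq.prems show ?case
    by (rule runs_SeqE) (metis runs_Seq.IH)
next
  case (runs_CondTrue b s c t s' d)
  from runs_CondTrue.prems show ?case
    by (rule runs_CondE) (auto simp: runs_CondTrue.hyps(1) dest!: runs_CondTrue.IH)
next
  case (runs_CondFalse b s d t s' c)
  from runs_CondFalse.prems show ?case
    by (rule runs_CondE) (auto simp: runs_CondFalse.hyps(1) dest!: runs_CondFalse.IH)
next
  case (runs_WhileFalse b s c)
  from runs_WhileFalse.prems show ?case
    by (rule runs_WhileE) (use runs_WhileFalse.hyps in simp_all)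
next
  case (runs_WhileTrue b s c t s' v r)
  from runs_WhileTrue.prems show ?case
    by (rule runs_WhileE) (auto simp: runs_WhileTrue.hyps(1) dest!: runs_WhileTrue.IH)
qed


section \<open>Input and output of the token sliding problem\<close>

text \<open>
  The vertices are numbered by their positions in \<open>vs\<close>; \<open>es\<close> lists every edge exactly once, in
  any order and orientation, as a pair of vertex numbers.
\<close>

definition graph_encoding :: "'a set \<Rightarrow> 'a set set \<Rightarrow> 'a list \<Rightarrow> (nat \<times> nat) list \<Rightarrow> bool" where
  "graph_encoding V E vs es \<longleftrightarrow>
     distinct vs \<and> set vs = V \<and>
     (\<forall>(i, j)\<in>set es. i < length vs \<and> j < length vs) \<and>
     distinct (map (\<lambda>(i, j). {vs ! i, vs ! j}) es) \<and>
     set (map (\<lambda>(i, j). {vs ! i, vs ! j}) es) = E"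

text \<open>
  Registers 0 and 1 hold the numbers of vertices and edges, arrays 0 and 1 the two ends of the
  edges, and arrays 2 and 3 the characteristic vectors of \<open>I\<close> and \<open>J\<close>. All other memory is zero.
\<close>

definition input_state ::
    "'a list \<Rightarrow> (nat \<times> nat) list \<Rightarrow> 'a set \<Rightarrow> 'a set \<Rightarrow> state" where
  "input_state vs es I J =
     \<lparr> regs = (\<lambda>_. 0)(0 := length vs, 1 := length es),
       arrs = (\<lambda>_ _. 0)(
         0 := (\<lambda>k. if k < length es then fst (es ! k) else 0),
         1 := (\<lambda>k. if k < length es then snd (es ! k) else 0),
         2 := (\<lambda>i. if i < length vs \<and> vs ! i \<in> I then 1 else 0),
         3 := (\<lambda>i. if i < length vs \<and> vs ! i \<in> J then 1 else 0)),
       outp = [] \<rparr>"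

text \<open>
  A reconfiguration sequence is output as the list of its slides: two numbers per slide, first the
  vertex that the token leaves and then the vertex that it enters. As the first set of the
  sequence is part of the input, this determines the sequence. (Writing out the sets themselves
  takes cubic time in the worst case, since a sequence may need quadratically many sets of linear
  size.)
\<close>

definition output_of :: "'a list \<Rightarrow> 'a set list \<Rightarrow> nat list \<Rightarrow> bool" where
  "output_of vs S out \<longleftrightarrow>
     length out = 2 * (length S - 1) \<and>
     (\<forall>i\<in>set out. i < length vs) \<and>
     (\<forall>k < length S - 1.
        S ! k - S ! (k + 1) = {vs ! (out ! (2 * k))} \<and>
        S ! (k + 1) - S ! k = {vs ! (out ! (2 * k + 1))})"

end

theory Submission
  imports Defs
begin

text \<open>
  Call a leaf \<open>v\<close> of a forest safe if its neighbour \<open>u\<close> has at most one neighbour that is not a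
  leaf; the last vertex of a breadth-first search is safe. If a token can be brought to \<open>v\<close> at
  all, bring one there from both independent sets and delete \<open>u\<close> and \<open>v\<close>; if not, no token ever
  enters \<open>u\<close> or \<open>v\<close>, and they can be deleted as well. What remains of the two sets is still
  reachable from each other in the smaller forest, so that iterating this makes them equal, and
  the slides of the second set are played backwards. That deletion preserves
  reachability follows from an exchange property of forests: if \<open>X\<close> and \<open>Y\<close> both contain \<open>p\<close> and
  are reachable from each other, then so are \<open>X - {p}\<close> and \<open>Y - {p}\<close>.

  To bring a token to \<open>v\<close>, root the tree at \<open>v\<close> and compute bottom-up which tokens can be moved one
  step away from \<open>v\<close>. If a vertex has two children with immovable tokens, these tokens are stuck
  and nothing passes this vertex. Otherwise the token nearest to \<open>v\<close> among those not behind such a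
  vertex can be brought to \<open>v\<close> after its siblings have made room. This takes \<open>O(n)\<close> steps for each
  of the \<open>O(n)\<close> deleted leaves. Since every written number costs a step, the bound on the running
  time also bounds the length of the sequence.
\<close>


section \<open>Token sliding inside a vertex set\<close>

text \<open>Deleting a leaf is delicate because tokens are indistinguishable: during a sequence the
  token on \<open>v\<close> may wander off through \<open>u\<close>, and another one may later take
  its place. Restricting the sequence to the smaller forest then gives no token sliding sequence,
  since tokens appear and vanish at the neighbour \<open>p\<close> of \<open>u\<close>. The exchange
  property repairs exactly this, and safety makes \<open>p\<close> the only exit.

  Breadth-first order is used twice: it makes the last vertex safe, and it ensures that the way from
  the nearest suitable token up to the root has no neighbouring tokens except that token and its
  siblings. These uses concern different roots, so each round searches twice, from any remaining
  vertex to find \<open>v\<close> and then from \<open>v\<close>.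

  Tokens on deleted vertices stay in the recorded sets. The invariant \<open>linked\<close> demands
  that the two sets agree outside the remaining vertices, so they are equal once no vertex remains.
  A round is linear in vertices and edges; that a tree has at most as many edges as vertices turns
  this into a bound in \<open>n\<close> alone.\<close>

definition indep :: "'a set set \<Rightarrow> 'a set \<Rightarrow> bool" where
  "indep E X \<longleftrightarrow> (\<forall>u\<in>X. \<forall>v\<in>X. {u, v} \<notin> E)"

definition step :: "'a set set \<Rightarrow> 'a \<Rightarrow> 'a \<Rightarrow> 'a set \<Rightarrow> 'a set \<Rightarrow> bool" where
  "step E a b X Y \<longleftrightarrow>
     a \<in> X \<and> b \<notin> X \<and> {a, b} \<in> E \<and> Y = insert b (X - {a}) \<and> indep E X \<and> indep E Y"

text \<open>Only the two ends of the slide have to lie in \<open>C\<close>. Tokens outside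
  \<open>C\<close> may be present; they stay put but can still block through independence.\<close>

definition step_in :: "'a set set \<Rightarrow> 'a set \<Rightarrow> 'a set \<Rightarrow> 'a set \<Rightarrow> bool" where
  "step_in E C X Y \<longleftrightarrow> (\<exists>a\<in>C. \<exists>b\<in>C. step E a b X Y)"

abbreviation reach :: "'a set set \<Rightarrow> 'a set \<Rightarrow> 'a set \<Rightarrow> 'a set \<Rightarrow> bool" where
  "reach E C \<equiv> (step_in E C)\<^sup>*\<^sup>*"

definition conn :: "'a set set \<Rightarrow> 'a set \<Rightarrow> ('a \<times> 'a) set" where
  "conn E D = {(x, y). x \<in> D \<and> y \<in> D \<and> {x, y} \<in> E}\<^sup>*"

text \<open>Acyclicity in the form used below: without \<open>p\<close>, its neighbours lie in
  different components. By \<open>conn_mono\<close> this applies inside every vertex set that avoids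
  \<open>p\<close>, so \<open>E\<close> stays the same while vertices are deleted.\<close>

definition forest :: "'a set set \<Rightarrow> bool" where
  "forest E \<longleftrightarrow> (\<forall>x. {x} \<notin> E) \<and>
     (\<forall>p q q'. {p, q} \<in> E \<longrightarrow> {p, q'} \<in> E \<longrightarrow> q \<noteq> q' \<longrightarrow> (q, q') \<notin> conn E (- {p}))"

lemma indep_subset: "indep E X \<Longrightarrow> Y \<subseteq> X \<Longrightarrow> indep E Y"
  unfolding indep_def by blast

lemma indepD: "indep E X \<Longrightarrow> u \<in> X \<Longrightarrow> {u, v} \<in> E \<Longrightarrow> v \<notin> X"
  unfolding indep_def by blast

lemma step_swap: "step E a b X Y \<Longrightarrow> step E b a Y X"
  unfolding step_def by (auto simp: insert_commute)

lemma step_in_sym: "step_in E C X Y \<Longrightarrow> step_in E C Y X"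
  unfolding step_in_def by (meson step_swap)

lemma reach_sym: "reach E C X Y \<Longrightarrow> reach E C Y X"
  by (induction rule: rtranclp_induct) (auto intro: step_in_sym converse_rtranclp_into_rtranclp)

lemma reach_mono: "reach E C X Y \<Longrightarrow> C \<subseteq> D \<Longrightarrow> reach E D X Y"
  by (erule rtranclp_mono[THEN predicate2D, rotated]) (unfold step_in_def, blast)

lemma reach_indep: "reach E C X Y \<Longrightarrow> indep E X \<Longrightarrow> indep E Y"
  by (induction rule: rtranclp_induct) (auto simp: step_in_def step_def)

lemma reach_outside: "reach E C X Y \<Longrightarrow> Y - C = X - C"
  by (induction rule: rtranclp_induct) (auto simp: step_in_def step_def)

lemma reach_within: "reach E C X Y \<Longrightarrow> X \<subseteq> C \<Longrightarrow> Y \<subseteq> C"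
  using reach_outside by blast

lemma step_Int:
  assumes "step E a b X Y" and "a \<in> K" and "b \<in> K"
  shows "step E a b (X \<inter> K) (Y \<inter> K)"
  using assms unfolding step_def by (auto intro: indep_subset)

text \<open>No edge leads from \<open>K\<close> to \<open>C - K\<close>, so each slide has both ends
  in \<open>K\<close> or neither; slides of the second kind do not change the part in
  \<open>K\<close> and are dropped.\<close>

lemma reach_restrict:
  assumes "reach E C X Y" and "\<And>x y. x \<in> K \<Longrightarrow> y \<in> C - K \<Longrightarrow> {x, y} \<notin> E"
  shows "reach E K (X \<inter> K) (Y \<inter> K)"
  using assms(1)
proof (induction rule: rtranclp_induct)
  case (step Y Z)
  then obtain a b where ab: "a \<in> C" "b \<in> C" "step E a b Y Z" unfolding step_in_def by blast
  then have e: "{a, b} \<in> E" "{b, a} \<in> E" by (auto simp: step_def insert_commute)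
  show ?case
  proof (cases "a \<in> K")
    case True
    then have "b \<in> K" using assms(2)[of a b] ab e by blast
    then have "step_in E K (Y \<inter> K) (Z \<inter> K)"
      using step_Int[OF ab(3) True] True unfolding step_in_def by blast
    then show ?thesis using step.IH by simp
  next
    case False
    then have "b \<notin> K" using assms(2)[of b a] ab e by blast
    then have "Z \<inter> K = Y \<inter> K" using False ab(3) unfolding step_def by blast
    then show ?thesis using step.IH by simp
  qed
qed auto

text \<open>Tokens that neither meet nor neighbour \<open>K\<close> cannot interfere with slides
  inside \<open>K\<close>. With \<open>reach_restrict\<close> this lets slides in different
  components be reordered.\<close>

lemma reach_frame:
  assumes "reach E K X Y" and "X \<subseteq> K" and "indep E F" and "F \<inter> K = {}"
    and "\<And>x y. x \<in> K \<Longrightarrow> y \<in> F \<Longrightarrow> {x, y} \<notin> E"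
  shows "reach E K (X \<union> F) (Y \<union> F)"
  using assms(1)
proof (induction rule: rtranclp_induct)
  case (step Y Z)
  then obtain a b where ab: "a \<in> K" "b \<in> K" "step E a b Y Z" unfolding step_in_def by blast
  have YK: "Y \<subseteq> K" using reach_within[OF step.hyps(1) assms(2)] .
  then have ZK: "Z \<subseteq> K" using ab unfolding step_def by auto
  have "indep E (A \<union> F)" if "indep E A" "A \<subseteq> K" for A
  proof -
    have "{x, y} \<notin> E" if "x \<in> F" "y \<in> A" for x y
      using assms(5)[of y x] that \<open>A \<subseteq> K\<close> by (auto simp: insert_commute)
    then show ?thesis
      using that assms(3,5) unfolding indep_def by blast
  qed
  moreover have "indep E Y" "indep E Z" using ab(3) unfolding step_def by auto
  ultimately have "indep E (Y \<union> F)" "indep E (Z \<union> F)" using YK ZK by blast+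
  then have "step E a b (Y \<union> F) (Z \<union> F)"
    using ab assms(4) unfolding step_def by blast
  then have "step_in E K (Y \<union> F) (Z \<union> F)" using ab unfolding step_in_def by blast
  then show ?case using step.IH by simp
qed auto

section \<open>Connectivity inside a vertex set\<close>

lemma conn_refl: "(x, x) \<in> conn E D"
  unfolding conn_def by simp

lemma conn_trans: "(x, y) \<in> conn E D \<Longrightarrow> (y, z) \<in> conn E D \<Longrightarrow> (x, z) \<in> conn E D"
  unfolding conn_def by simp

lemma conn_edge: "{x, y} \<in> E \<Longrightarrow> x \<in> D \<Longrightarrow> y \<in> D \<Longrightarrow> (x, y) \<in> conn E D"
  unfolding conn_def by auto

lemma conn_sym: "(x, y) \<in> conn E D \<Longrightarrow> (y, x) \<in> conn E D"
  unfolding conn_def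
  by (rule symD[OF sym_rtrancl]) (auto simp: sym_def insert_commute)

lemma conn_mono: "(x, y) \<in> conn E D \<Longrightarrow> D \<subseteq> D' \<Longrightarrow> (x, y) \<in> conn E D'"
  unfolding conn_def by (erule rtrancl_mono[THEN subsetD, rotated]) auto

lemma conn_within: "(x, y) \<in> conn E D \<Longrightarrow> x \<in> D \<Longrightarrow> y \<in> D"
  unfolding conn_def by (induction rule: rtrancl_induct) auto

text \<open>The slides that take place between two consecutive visits of a token to \<open>p\<close> act
  independently on the components of \<open>C - {p}\<close>. If the token that returns comes from another
  component than the one into which the token left, it takes over the place of the latter;
  otherwise both visits pass through the same neighbour and the induction hypothesis applies to
  the component of this neighbour.\<close>

lemma reach_remove_token:
  assumes "finite C" and "forest E" and "p \<in> C" and "X \<subseteq> C" and "reach E C X Y"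
    and "indep E X" and "p \<in> X" and "p \<in> Y"
  shows "reach E C (X - {p}) (Y - {p})"
  using assms(1,3-8)
proof (induction "card C" arbitrary: C p X Y rule: less_induct)
  case less
  define C' where "C' = C - {p}"
  \<comment> \<open>Invariant along the sequence. While \<open>p\<close> is occupied, the
    configuration without this token has been reached. Once the token has left \<open>p\<close> for
    \<open>q\<close>, \<open>W\<close> is the configuration just before it left, and all slides
    since then avoid \<open>p\<close>.\<close>
  define Q where "Q Z \<longleftrightarrow> (if p \<in> Z then reach E C (X - {p}) (Z - {p})
    else \<exists>W q. indep E W \<and> W \<subseteq> C \<and> p \<in> W \<and> q \<in> C \<and> q \<notin> W \<and> {p, q} \<in> E
      \<and> indep E (insert q (W - {p})) \<and>
      reach E C (X - {p}) (W - {p}) \<and> reach E C' (insert q (W - {p})) Z)" for Z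
  have "Q Y \<and> indep E Y \<and> Y \<subseteq> C" using \<open>reach E C X Y\<close>
  proof (induction rule: rtranclp_induct)
    case base
    then show ?case using less.prems by (simp add: Q_def)
  next
    case (step Z Z')
    then have QZ: "Q Z" and iZ: "indep E Z" and ZC: "Z \<subseteq> C" by auto
    obtain a b where ab: "a \<in> C" "b \<in> C" "step E a b Z Z'"
      using step.hyps unfolding step_in_def by blast
    then have Z': "Z' = insert b (Z - {a})" and az: "a \<in> Z" "b \<notin> Z" and e: "{a, b} \<in> E"
      and iZ': "indep E Z'" unfolding step_def by auto
    have "Q Z'"
    proof (cases "p \<in> Z"; cases "p \<in> Z'")
      assume "p \<in> Z" "p \<in> Z'"
      then have "a \<noteq> p" "b \<noteq> p" using Z' az by auto
      then have "step E a b (Z - {p}) (Z' - {p})"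
        using ab(3) unfolding step_def by (auto intro: indep_subset)
      then have "step_in E C (Z - {p}) (Z' - {p})" using ab unfolding step_in_def by blast
      then show "Q Z'" using QZ \<open>p \<in> Z\<close> \<open>p \<in> Z'\<close> by (simp add: Q_def)
    next
      assume p: "p \<in> Z" "p \<notin> Z'"
      then have "a = p" using Z' by auto
      then show "Q Z'" using QZ p iZ ZC ab az e iZ' Z' unfolding Q_def by auto
    next
      assume p: "p \<notin> Z" "p \<notin> Z'"
      then have "a \<in> C'" "b \<in> C'" using ab az Z' by (auto simp: C'_def)
      then have "step_in E C' Z Z'" using ab(3) unfolding step_in_def by blast
      then show "Q Z'" using QZ p unfolding Q_def by (auto intro: rtranclp.rtrancl_into_rtrancl)
    next
      assume p: "p \<notin> Z" "p \<in> Z'"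
      then have bp: "b = p" using Z' by auto
      have ac: "a \<in> C'" using ab az p by (auto simp: C'_def)
      obtain W q where W: "indep E W" "W \<subseteq> C" "p \<in> W" "q \<in> C" "q \<notin> W" "{p, q} \<in> E"
        and iW': "indep E (insert q (W - {p}))"
        and r1: "reach E C (X - {p}) (W - {p})"
        and r2: "reach E C' (insert q (W - {p})) Z"
        using QZ p unfolding Q_def by auto
      define W' where "W' = insert q (W - {p})"
      have qC': "q \<in> C'" using W by (auto simp: C'_def)
      define K where "K = {y. (a, y) \<in> conn E C'}"
      have KC: "K \<subseteq> C'" using ac conn_within unfolding K_def by fastforce
      have aK: "a \<in> K" by (simp add: K_def conn_refl)
      have closed: "{x, y} \<notin> E" if "x \<in> K" "y \<in> C' - K" for x y
        using that KC conn_edge[of x y E C'] conn_trans[of a x E C' y] unfolding K_def by blast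
      have closed': "{x, y} \<notin> E" if "x \<in> C' - K" "y \<in> K" for x y
        using closed[OF that(2,1)] by (simp add: insert_commute)
      have W'C: "W' \<subseteq> C'" using W qC' by (auto simp: W'_def C'_def)
      have ZC': "Z \<subseteq> C'" using ZC p by (auto simp: C'_def)
      have iW'': "indep E W'" using iW' by (simp add: W'_def)
      have CC: "C' \<subseteq> C" by (auto simp: C'_def)
      have rK: "reach E K (W' \<inter> K) (Z \<inter> K)"
        by (rule reach_restrict[OF r2[folded W'_def]]) (use closed in auto)
      have rN: "reach E (C' - K) (W' \<inter> (C' - K)) (Z \<inter> (C' - K))"
        by (rule reach_restrict[OF r2[folded W'_def]]) (use closed' in auto)
      have fin: "reach E C (W - {p}) (Z - {a})"
      proof (cases "q = a")
        \<comment> \<open>The token returns through the neighbour by which one left, so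
          \<open>a\<close> is occupied at both ends of the stretch inside its component
          \<open>K\<close>. The induction hypothesis, with \<open>a\<close> in the role of
          \<open>p\<close>, removes it there; the slides outside \<open>K\<close> are played
          afterwards.\<close>
        case True
        have "reach E K (W' \<inter> K - {a}) (Z \<inter> K - {a})"
        proof (rule less.hyps)
          show "card K < card C"
            using KC less.prems(1,2) unfolding C'_def by (intro psubset_card_mono) auto
          show "finite K" using KC less.prems(1) unfolding C'_def by (auto intro: finite_subset)
          show "indep E (W' \<inter> K)" using iW'' by (rule indep_subset) simp
        qed (use rK aK True az in \<open>auto simp: W'_def\<close>)
        then have "reach E K ((W' \<inter> K - {a}) \<union> (W' - K)) ((Z \<inter> K - {a}) \<union> (W' - K))"
          by (rule reach_frame) (use iW'' closed W'C in \<open>auto intro: indep_subset\<close>)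
        then have s1: "reach E C ((W' \<inter> K - {a}) \<union> (W' - K)) ((Z \<inter> K - {a}) \<union> (W' - K))"
          by (rule reach_mono) (use KC CC in auto)
        have "reach E (C' - K) ((W' \<inter> (C' - K)) \<union> (Z \<inter> K - {a}))
            ((Z \<inter> (C' - K)) \<union> (Z \<inter> K - {a}))"
          by (rule reach_frame[OF rN]) (use iZ closed' in \<open>auto intro: indep_subset\<close>)
        then have s2: "reach E C ((W' \<inter> (C' - K)) \<union> (Z \<inter> K - {a}))
            ((Z \<inter> (C' - K)) \<union> (Z \<inter> K - {a}))"
          by (rule reach_mono) (use CC in auto)
        have "(W' \<inter> K - {a}) \<union> (W' - K) = W - {p}" using True aK W by (auto simp: W'_def)
        moreover have "(Z \<inter> K - {a}) \<union> (W' - K) = (W' \<inter> (C' - K)) \<union> (Z \<inter> K - {a})"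
          using W'C by auto
        moreover have "(Z \<inter> (C' - K)) \<union> (Z \<inter> K - {a}) = Z - {a}" using ZC' aK by auto
        ultimately show ?thesis using s1 s2 by simp
      next
        \<comment> \<open>Acyclicity puts \<open>q\<close> outside \<open>K\<close>. The stretch is
          reordered: first all slides inside \<open>K\<close>, with the other tokens still as in
          \<open>W\<close>; then one token passes from \<open>a\<close> over \<open>p\<close> to
          \<open>q\<close>; then all slides outside \<open>K\<close>.\<close>
        case False
        have "(a, q) \<notin> conn E (- {p})"
          using \<open>forest E\<close> e W(6) False bp unfolding forest_def by (metis insert_commute)
        then have qK: "q \<notin> K"
          using conn_mono[of a q E C' "- {p}"] by (auto simp: K_def C'_def)
        have WK: "W - {p} = (W' \<inter> K) \<union> (W - {p} - K)"
          using qK by (auto simp: W'_def)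
        have "reach E K ((W' \<inter> K) \<union> (W - {p} - K)) ((Z \<inter> K) \<union> (W - {p} - K))"
          by (rule reach_frame[OF rK])
            (use W(1,2) closed in \<open>auto intro: indep_subset simp: C'_def\<close>)
        then have s1: "reach E C (W - {p}) ((Z \<inter> K) \<union> (W - {p} - K))" (is "reach E C _ ?A")
          unfolding WK[symmetric] by (rule reach_mono) (use KC CC in auto)
        have iA: "indep E ?A"
          using reach_indep[OF s1] W(1) by (auto intro: indep_subset)
        let ?B = "insert p (?A - {a})" and ?D = "insert q (?A - {a})"
        have pe: "{x, p} \<notin> E" if "x \<in> ?A - {a}" for x
        proof -
          have "x \<in> Z' \<or> x \<in> W" using that Z' by auto
          moreover have "p \<in> Z'" "p \<in> W" using p W by auto
          ultimately show ?thesis using iZ' W(1) unfolding indep_def by blast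
        qed
        have "{p, p} \<notin> E" using W(1,3) unfolding indep_def by blast
        then have iB: "indep E ?B"
          using pe iA unfolding indep_def by (auto simp: insert_commute)
        have paA: "p \<notin> ?A" "a \<in> ?A" "q \<notin> ?A"
          using KC az aK W(5) qK by (auto simp: C'_def)
        have s2: "step_in E C ?A ?B"
          unfolding step_in_def
          by (rule bexI[of _ a], rule bexI[of _ p])
            (use paA e bp iA iB ab less.prems(2) in \<open>auto simp: step_def\<close>)
        have qe: "{x, q} \<notin> E" if "x \<in> ?A - {a}" for x
        proof (cases "x \<in> K")
          case True
          then show ?thesis using closed[of x q] qC' qK by blast
        next
          case False
          then show ?thesis using that iW'' unfolding indep_def W'_def by auto
        qed
        have "{q, q} \<notin> E" using iW'' unfolding indep_def W'_def by blast
        then have iD: "indep E ?D"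
          using qe iA unfolding indep_def by (auto simp: insert_commute)
        have s3: "step_in E C ?B ?D"
          unfolding step_in_def
          by (rule bexI[of _ p], rule bexI[of _ q])
            (use paA iB iD W less.prems(2) qC' in \<open>auto simp: step_def C'_def\<close>)
        have "reach E (C' - K) ((W' \<inter> (C' - K)) \<union> (Z \<inter> K - {a}))
            ((Z \<inter> (C' - K)) \<union> (Z \<inter> K - {a}))"
          by (rule reach_frame[OF rN]) (use iZ closed' in \<open>auto intro: indep_subset\<close>)
        then have s4: "reach E C ((W' \<inter> (C' - K)) \<union> (Z \<inter> K - {a}))
            ((Z \<inter> (C' - K)) \<union> (Z \<inter> K - {a}))"
          by (rule reach_mono) (use CC in auto)
        have "?D = (W' \<inter> (C' - K)) \<union> (Z \<inter> K - {a})"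
          using W'C qK aK qC' by (auto simp: W'_def C'_def)
        moreover have "(Z \<inter> (C' - K)) \<union> (Z \<inter> K - {a}) = Z - {a}" using ZC' aK by auto
        ultimately have "reach E C ?D (Z - {a})" using s4 by simp
        then show ?thesis using s1 s2 s3
          by (meson converse_rtranclp_into_rtranclp rtranclp_trans)
      qed
      have "Z' - {p} = Z - {a}" using Z' bp p by auto
      then show "Q Z'" using p r1 fin unfolding Q_def by auto
    qed
    moreover have "Z' \<subseteq> C" using Z' ab ZC by auto
    ultimately show ?case using iZ' by simp
  qed
  then show ?case using less.prems by (simp add: Q_def)
qed


section \<open>Removing a leaf\<close>

lemma step_cases:
  assumes "step_in E C X Y"
  obtains a b where "a \<in> C" "b \<in> C" "a \<in> X" "b \<notin> X" "{a, b} \<in> E" "{b, a} \<in> E"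
    "Y = insert b (X - {a})" "indep E X" "indep E Y" "step E a b X Y"
  using assms unfolding step_in_def step_def by (metis insert_commute)

lemma step_Diff:
  assumes "step E a b X Y" and "a \<notin> K" and "b \<notin> K"
  shows "step E a b (X - K) (Y - K)"
  using step_Int[of E a b X Y "- K"] assms by (simp add: Diff_eq)

text \<open>The star of \<open>u\<close> and its leaves \<open>L\<close> is connected to the rest of
  \<open>C\<close> only through \<open>p\<close>. If it holds two tokens on leaves, it is frozen and
  can be ignored. Otherwise it holds at most one token at any time, and whatever happens between an
  exit through \<open>p\<close> and the next entry is replayed without the token on
  \<open>p\<close>.\<close>

lemma reach_peel_leaf:
  assumes "finite C" and "forest E" and "u \<in> C" and "v \<in> C" and "{u, v} \<in> E" and "v \<noteq> p"
    and leaf: "\<And>y. y \<in> C \<Longrightarrow> {v, y} \<in> E \<Longrightarrow> y = u"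
    and leaves: "\<And>y y'. y \<in> C \<Longrightarrow> {u, y} \<in> E \<Longrightarrow> y \<noteq> p \<Longrightarrow> y' \<in> C \<Longrightarrow> {y, y'} \<in> E \<Longrightarrow> y' = u"
    and "X \<subseteq> C" and "indep E X" and "v \<in> X" and "reach E C X Y" and "v \<in> Y"
  shows "reach E (C - {u, v}) (X - {v}) (Y - {v})"
proof -
  define L where "L = {y \<in> C. {u, y} \<in> E \<and> y \<noteq> p}"
  have vL: "v \<in> L" using assms by (simp add: L_def)
  have uL: "u \<notin> L" using \<open>forest E\<close> by (auto simp: L_def forest_def)
  have L_nbr: "b = u" if "a \<in> L" "b \<in> C" "{a, b} \<in> E" for a b
    using leaves that by (auto simp: L_def)
  have u_nbr: "b = p" if "b \<in> C" "b \<notin> L" "{u, b} \<in> E" for b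
    using that by (auto simp: L_def)
  have L_adj: "{y, u} \<in> E" if "y \<in> L" for y
    using that by (auto simp: L_def insert_commute)
  have uX: "u \<notin> X" using assms(5,10,11) unfolding indep_def by blast
  show ?thesis
  proof (cases "\<exists>v'\<in>L \<inter> X. v' \<noteq> v")
    \<comment> \<open>Whichever leaf a token would leave for \<open>u\<close>, a token on another
      leaf still blocks \<open>u\<close>.\<close>
    case True
    then obtain v' where v': "v' \<in> L" "v' \<in> X" "v' \<noteq> v" by blast
    have "u \<notin> Y \<and> L \<inter> Y = L \<inter> X \<and> reach E (C - {u, v}) (X - {v}) (Y - {v})"
      using \<open>reach E C X Y\<close>
    proof (induction rule: rtranclp_induct)
      case (step Z Z')
      then obtain a b where ab: "a \<in> C" "b \<in> C" "a \<in> Z" "b \<notin> Z" "{a, b} \<in> E" "{b, a} \<in> E"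
        "Z' = insert b (Z - {a})" "indep E Z" "indep E Z'" "step E a b Z Z'"
        by (meson step_cases)
      have "v \<in> Z" "v' \<in> Z" using step.IH v' vL assms(11) by auto
      then have "v \<in> Z' \<or> v' \<in> Z'" using v' ab by auto
      then have "u \<notin> Z'" using ab(9) L_adj vL v' unfolding indep_def by blast
      then have bu: "b \<noteq> u" using ab by auto
      have au: "a \<noteq> u" using ab step.IH by auto
      have aL: "a \<notin> L" using L_nbr ab bu by blast
      have bL: "b \<notin> L" using L_nbr ab au by blast
      have "step_in E (C - {u, v}) (Z - {v}) (Z' - {v})"
        unfolding step_in_def
        by (rule bexI[of _ a], rule bexI[of _ b], rule step_Diff[OF ab(10)])
          (use ab au bu aL bL vL in auto)
      moreover have "L \<inter> Z' = L \<inter> Z" using ab(7) aL bL by blast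
      ultimately show ?case using step.IH \<open>u \<notin> Z'\<close>
        by (metis rtranclp.rtrancl_into_rtrancl)
    qed (use uX in auto)
    then show ?thesis by simp
  next
    case False
    define D where "D = C - insert u L"
    have DC: "D \<subseteq> C - {u, v}" using vL by (auto simp: D_def)
    \<comment> \<open>Either the star holds exactly one token, which is left out of account, or it
      is empty and \<open>W\<close> is the configuration right after the last exit, with the escaped
      token on \<open>p\<close>.\<close>
    define Q where "Q Z \<longleftrightarrow>
      (\<exists>x. Z \<inter> insert u L = {x} \<and> reach E (C - {u, v}) (X - {v}) (Z - insert u L)) \<or>
      (Z \<inter> insert u L = {} \<and> (\<exists>W. indep E W \<and> W \<subseteq> D \<and> p \<in> W \<and>
         reach E (C - {u, v}) (X - {v}) (W - {p}) \<and> reach E D W Z))" for Z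
    have "Q Y \<and> Y \<subseteq> C" using \<open>reach E C X Y\<close>
    proof (induction rule: rtranclp_induct)
      case base
      have "X \<inter> insert u L = {v}" using False uX vL assms(11) by blast
      moreover from this have "X - insert u L = X - {v}" by auto
      ultimately have "Q X" unfolding Q_def by simp
      then show ?case using assms(9) by simp
    next
      case (step Z Z')
      then obtain a b where ab: "a \<in> C" "b \<in> C" "a \<in> Z" "b \<notin> Z" "{a, b} \<in> E" "{b, a} \<in> E"
        "Z' = insert b (Z - {a})" "indep E Z" "indep E Z'" "step E a b Z Z'"
        by (meson step_cases)
      have QZ: "Q Z" and ZC: "Z \<subseteq> C" using step.IH by auto
      have Z'C: "Z' \<subseteq> C" using ZC ab by auto
      have "Q Z'"
      proof (cases "a \<in> insert u L"; cases "b \<in> insert u L")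
        assume 1: "a \<in> insert u L" "b \<in> insert u L"
        then obtain x where x: "Z \<inter> insert u L = {x}"
          "reach E (C - {u, v}) (X - {v}) (Z - insert u L)"
          using QZ ab(3) unfolding Q_def by blast
        have "a \<in> {x}" using 1(1) ab(3) unfolding x(1)[symmetric] by (rule IntI[rotated])
        then have "x = a" by simp
        moreover have "Z' \<inter> insert u L = insert b (Z \<inter> insert u L - {a})"
          unfolding ab(7) using 1 by blast
        ultimately have "Z' \<inter> insert u L = {b}" using x(1) by simp
        moreover have "Z' - insert u L = Z - insert u L" using 1 ab(3,4,7) by blast
        ultimately show "Q Z'" using x(2) unfolding Q_def by metis
      next
        assume 1: "a \<in> insert u L" "b \<notin> insert u L"
        then have au: "a = u" using L_nbr ab by blast
        then have bp: "b = p" using u_nbr ab 1 by blast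
        obtain x where x: "Z \<inter> insert u L = {x}"
          "reach E (C - {u, v}) (X - {v}) (Z - insert u L)"
          using QZ ab(3) 1 unfolding Q_def by blast
        have "u \<in> Z \<inter> insert u L" using ab(3) au by simp
        then have xu: "x = u" unfolding x(1) by simp
        have "Z' \<inter> insert u L = Z \<inter> insert u L - {u}" unfolding ab(7) au using 1 by blast
        then have Z'e: "Z' \<inter> insert u L = {}" using x(1) xu by simp
        have "Z' - {p} = Z - {u}" unfolding ab(7) au bp using ab(4) bp au 1 by blast
        moreover have "Z - {u} = Z - Z \<inter> insert u L" using x(1) xu by simp
        ultimately have "Z' - {p} = Z - insert u L" by blast
        moreover have "Z' \<subseteq> D" using Z'C Z'e by (auto simp: D_def)
        moreover have "p \<in> Z'" using bp ab(7) by blast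
        ultimately show "Q Z'" using x(2) Z'e ab(9) unfolding Q_def by (metis rtranclp.rtrancl_refl)
      next
        assume 1: "a \<notin> insert u L" "b \<in> insert u L"
        then have bu: "b = u" using L_nbr ab by blast
        then have ap: "a = p" using u_nbr ab 1 by blast
        have "Z \<inter> insert u L = {}"
        proof (rule ccontr)
          assume "Z \<inter> insert u L \<noteq> {}"
          then obtain x where "x \<in> Z" "x \<in> L" using bu ab(4) by blast
          then have "x \<in> Z'" "u \<in> Z'" "{x, u} \<in> E" using L_adj 1 bu ab(3,4,7) by blast+
          then show False using ab(9) unfolding indep_def by blast
        qed
        then obtain W where W: "indep E W" "W \<subseteq> D" "p \<in> W"
          "reach E (C - {u, v}) (X - {v}) (W - {p})" "reach E D W Z"
          using QZ unfolding Q_def by auto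
        \<comment> \<open>From exit to re-entry all slides lie in \<open>D\<close>, and
          \<open>p\<close> is occupied at both ends of this stretch, so the exchange property drops
          that token.\<close>
        have "reach E D (W - {p}) (Z - {p})"
          by (rule reach_remove_token[OF _ assms(2)]) (use W assms(1) ap ab in \<open>auto simp: D_def\<close>)
        then have "reach E (C - {u, v}) (X - {v}) (Z - {p})"
          using W(4) reach_mono[OF _ DC] by (meson rtranclp_trans)
        moreover have "Z' - insert u L = Z - {p}"
          using \<open>Z \<inter> insert u L = {}\<close> ab(7) ap bu 1 by blast
        moreover have "Z' \<inter> insert u L = {u}"
          using \<open>Z \<inter> insert u L = {}\<close> ab(7) ap bu 1 by blast
        ultimately show "Q Z'" unfolding Q_def by metis
      next
        assume 1: "a \<notin> insert u L" "b \<notin> insert u L"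
        have aD: "a \<in> D" "b \<in> D" using 1 ab(1,2) by (auto simp: D_def)
        have *: "Z' \<inter> insert u L = Z \<inter> insert u L" using 1 ab(3,4,7) by blast
        have s1: "step_in E D Z Z'" using aD ab(10) unfolding step_in_def by blast
        have "step_in E (C - {u, v}) (Z - insert u L) (Z' - insert u L)"
          using step_Diff[OF ab(10) 1] aD DC unfolding step_in_def by blast
        then show "Q Z'" using QZ s1 unfolding Q_def *
          by (meson rtranclp.rtrancl_into_rtrancl)
      qed
      then show ?case using Z'C by simp
    qed
    moreover have v: "v \<in> Y \<inter> insert u L" using vL assms(13) by simp
    ultimately obtain x where x: "Y \<inter> insert u L = {x}"
      "reach E (C - {u, v}) (X - {v}) (Y - insert u L)"
      unfolding Q_def by (metis empty_iff)
    have "x = v" using v unfolding x(1) by simp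
    have "Y - insert u L = Y - Y \<inter> insert u L" by blast
    then have "Y - insert u L = Y - {v}" unfolding x(1) \<open>x = v\<close> .
    then show ?thesis using x(2) by simp
  qed
qed

text \<open>Leaves \<open>v\<close> with a neighbour \<open>u\<close> that has at most one neighbour of higher degree; the
  case \<open>u = v\<close> stands for an isolated vertex.\<close>

definition safe_leaf :: "'a set set \<Rightarrow> 'a set \<Rightarrow> 'a \<Rightarrow> 'a \<Rightarrow> bool" where
  "safe_leaf E C u v \<longleftrightarrow> u \<in> C \<and> v \<in> C \<and> (\<forall>y\<in>C. {v, y} \<in> E \<longrightarrow> y = u) \<and>
     (u \<noteq> v \<longrightarrow> {u, v} \<in> E \<and> (\<exists>p. p \<noteq> v \<and>
        (\<forall>y\<in>C. {u, y} \<in> E \<longrightarrow> y \<noteq> p \<longrightarrow> (\<forall>y'\<in>C. {y, y'} \<in> E \<longrightarrow> y' = u))))"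

lemma reach_peel:
  assumes "finite C" and "forest E" and "safe_leaf E C u v" and "X \<subseteq> C" and "indep E X"
    and "v \<in> X" and "reach E C X Y" and "v \<in> Y"
  shows "reach E (C - {u, v}) (X - {v}) (Y - {v})"
proof (cases "u = v")
  case True
  have "reach E (C - {v}) (X \<inter> (C - {v})) (Y \<inter> (C - {v}))"
  proof (rule reach_restrict[OF assms(7)])
    fix x y assume "x \<in> C - {v}" "y \<in> C - (C - {v})"
    then show "{x, y} \<notin> E"
      using assms(3) True unfolding safe_leaf_def by (auto simp: insert_commute)
  qed
  moreover have "X \<inter> (C - {v}) = X - {v}" "Y \<inter> (C - {v}) = Y - {v}"
    using assms(4) reach_within[OF assms(7,4)] by auto
  ultimately show ?thesis using True by simp
next
  case False
  then obtain p where p: "u \<in> C" "v \<in> C" "{u, v} \<in> E" "v \<noteq> p"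
    "\<forall>y\<in>C. {u, y} \<in> E \<longrightarrow> y \<noteq> p \<longrightarrow> (\<forall>y'\<in>C. {y, y'} \<in> E \<longrightarrow> y' = u)"
    "\<forall>y\<in>C. {v, y} \<in> E \<longrightarrow> y = u"
    using assms(3) unfolding safe_leaf_def by metis
  show ?thesis
    by (rule reach_peel_leaf[OF assms(1,2) p(1-4) _ _ assms(4-8)]) (use p(5,6) in blast)+
qed

text \<open>\<open>X'\<close> and \<open>Y'\<close> are reachable from each other, so both occupy
  \<open>v\<close> or \<open>v\<close> is out of reach of both. In the first case
  \<open>reach_peel\<close> applies. In the second, a token on \<open>u\<close> could always slide
  on to \<open>v\<close>, so \<open>u\<close> is never occupied either and the given slides already
  avoid both vertices.\<close>

lemma reach_remove_safe_leaf:
  assumes "finite C" and "forest E" and sl: "safe_leaf E C u v"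
    and XY: "X \<subseteq> C" "Y \<subseteq> C" "indep E X" "indep E Y" "reach E C X Y"
    and "reach E C X X'" and "reach E C Y Y'"
    and X': "v \<in> X' \<or> (\<forall>Z. reach E C X Z \<longrightarrow> v \<notin> Z)"
    and Y': "v \<in> Y' \<or> (\<forall>Z. reach E C Y Z \<longrightarrow> v \<notin> Z)"
  shows "X' \<inter> {u, v} = Y' \<inter> {u, v}" and "u \<in> X' \<Longrightarrow> u = v"
    and "reach E (C - {u, v}) (X' - {u, v}) (Y' - {u, v})"
proof -
  have r: "reach E C X' Y'" using assms(8-10) reach_sym by (meson rtranclp_trans)
  have rX: "reach E C X Y'" using r assms(9) by (meson rtranclp_trans)
  have rY: "reach E C Y X'" using r assms(10) reach_sym by (meson rtranclp_trans)
  have vv: "v \<in> X' \<longleftrightarrow> v \<in> Y'" using X' Y' rX rY by blast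
  have iX': "indep E X'" and iY': "indep E Y'"
    using reach_indep assms(9,10) XY by blast+
  have X'C: "X' \<subseteq> C" and Y'C: "Y' \<subseteq> C"
    using reach_within assms(9,10) XY by blast+
  have "X' \<inter> {u, v} = Y' \<inter> {u, v} \<and> (u \<in> X' \<longrightarrow> u = v) \<and>
    reach E (C - {u, v}) (X' - {u, v}) (Y' - {u, v})"
  proof (cases "v \<in> X'")
    case True
    then have "u \<in> X' \<Longrightarrow> u = v" "u \<in> Y' \<Longrightarrow> u = v"
      using iX' iY' vv sl unfolding safe_leaf_def indep_def by blast+
    moreover have "reach E (C - {u, v}) (X' - {v}) (Y' - {v})"
      using reach_peel[OF assms(1,2) sl X'C iX' _ r] True vv by blast
    moreover have "X' - {u, v} = X' - {v}" "Y' - {u, v} = Y' - {v}"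
      using calculation by auto
    ultimately show ?thesis using True vv by auto
  next
    case False
    have nv: "v \<notin> Z" if "reach E C X Z" for Z using X' False that by blast
    have nu: "u \<notin> Z" if "reach E C X Z" for Z
    proof
      assume uZ: "u \<in> Z"
      have "u \<noteq> v" using nv that uZ by blast
      then have e: "{u, v} \<in> E" using sl unfolding safe_leaf_def by blast
      have iZ: "indep E Z" using reach_indep that XY by blast
      have "{v, y} \<notin> E" if "y \<in> insert v (Z - {u})" for y
      proof
        assume "{v, y} \<in> E"
        moreover have "y \<in> C"
          using that sl reach_within[OF \<open>reach E C X Z\<close> XY(1)] unfolding safe_leaf_def by auto
        ultimately have "y = u" using sl unfolding safe_leaf_def by blast
        then show False using that \<open>u \<noteq> v\<close> by blast
      qed
      then have "indep E (insert v (Z - {u}))"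
        using iZ unfolding indep_def by (simp add: insert_commute)
      then have "step_in E C Z (insert v (Z - {u}))"
        unfolding step_in_def step_def using sl uZ e iZ nv that unfolding safe_leaf_def
        by blast
      then have "reach E C X (insert v (Z - {u}))" using that by simp
      then show False using nv by blast
    qed
    have "Z \<inter> {u, v} = {} \<and> reach E (C - {u, v}) X' Z" if "reach E C X' Z" for Z
      using that
    proof (induction rule: rtranclp_induct)
      case base
      show ?case using nu nv assms(9) by auto
    next
      case (step Z Z')
      then have "reach E C X Z'" using assms(9) by (meson rtranclp.simps rtranclp_trans)
      then have n: "Z' \<inter> {u, v} = {}" using nu nv by blast
      have "step_in E (C - {u, v}) Z Z'"
        using step.hyps(2) step.IH n unfolding step_in_def step_def by blast
      then show ?case using n step.IH by (meson rtranclp.simps)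
    qed
    from this[OF r] show ?thesis
      using nu nv assms(9) False by (metis Diff_triv Int_insert_right inf_bot_right)
  qed
  then show "X' \<inter> {u, v} = Y' \<inter> {u, v}" "u \<in> X' \<Longrightarrow> u = v"
    "reach E (C - {u, v}) (X' - {u, v}) (Y' - {u, v})" by auto
qed


section \<open>Bringing a token to the root of a tree\<close>

text \<open>Both \<open>a\<close> and \<open>par b\<close> climb along parents to \<open>r\<close>
  without meeting \<open>b\<close>, because ranks only fall on the way. If they were different, two
  neighbours of \<open>b\<close> would be connected without \<open>b\<close>. Equal ranks are
  allowed, so the distance from a root serves as \<open>rk\<close> too.\<close>

lemma edge_parent:
  fixes rk :: "'a \<Rightarrow> nat"
  assumes "forest E" and "r \<in> K"
    and par: "\<And>x. x \<in> K \<Longrightarrow> x \<noteq> r \<Longrightarrow> par x \<in> K \<and> {par x, x} \<in> E \<and> rk (par x) < rk x"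
    and "a \<in> K" and "b \<in> K" and "{a, b} \<in> E" and "rk a \<le> rk b"
  shows "b \<noteq> r \<and> par b = a"
proof -
  have up: "(x, r) \<in> conn E (- {b})" if "x \<in> K" "rk x \<le> rk b" "x \<noteq> b" for x
    using that
  proof (induction "rk x" arbitrary: x rule: less_induct)
    case less
    show ?case
    proof (cases "x = r")
      case False
      then have p: "par x \<in> K" "{par x, x} \<in> E" "rk (par x) < rk x" using par less.prems by auto
      then have "(par x, r) \<in> conn E (- {b})" using less by fastforce
      moreover have "(x, par x) \<in> conn E (- {b})"
        by (rule conn_edge) (use p less.prems in \<open>auto simp: insert_commute\<close>)
      ultimately show ?thesis by (meson conn_trans)
    qed (simp add: conn_refl)
  qed
  have nab: "a \<noteq> b" using assms(1,6) unfolding forest_def by auto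
  have low: "rk r < rk x" if "x \<in> K" "x \<noteq> r" for x
    using that
  proof (induction "rk x" arbitrary: x rule: less_induct)
    case less
    then show ?case using par[of x] by (metis order.strict_trans)
  qed
  have br: "b \<noteq> r" using low[of a] nab assms(4,7) by force
  then have p: "par b \<in> K" "{par b, b} \<in> E" "rk (par b) < rk b" using par assms(5) by auto
  have "(par b, a) \<in> conn E (- {b})"
    using up[of a] up[of "par b"] p nab assms(4,7) conn_sym conn_trans
    by (metis less_irrefl less_imp_le)
  moreover have "{b, par b} \<in> E" "{b, a} \<in> E" using p assms(6) by (simp_all add: insert_commute)
  ultimately have "par b = a" using assms(1) unfolding forest_def by blast
  then show ?thesis using br by simp
qed

text \<open>A spanning tree of the component \<open>K\<close> of \<open>r\<close> in \<open>C\<close>, as found by breadth-first search: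
  \<open>rk\<close> is the order in which the vertices are visited.\<close>

locale rooted =
  fixes E :: "'a set set" and C K :: "'a set" and r :: 'a and par :: "'a \<Rightarrow> 'a"
    and rk :: "'a \<Rightarrow> nat"
  assumes acyc: "forest E" and KC: "K \<subseteq> C" and rK: "r \<in> K" and par_r: "par r = r"
    and par: "\<And>x. x \<in> K \<Longrightarrow> x \<noteq> r \<Longrightarrow> par x \<in> K \<and> {par x, x} \<in> E \<and> rk (par x) < rk x"
    and mono: "\<And>x y. x \<in> K \<Longrightarrow> y \<in> K \<Longrightarrow> x \<noteq> r \<Longrightarrow> y \<noteq> r \<Longrightarrow> rk x \<le> rk y \<Longrightarrow>
      rk (par x) \<le> rk (par y)"
    and inj: "inj_on rk K"
    and closed: "\<And>x y. x \<in> K \<Longrightarrow> y \<in> C \<Longrightarrow> {x, y} \<in> E \<Longrightarrow> y \<in> K"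
begin

text \<open>Excluding \<open>r\<close> matters because \<open>par r = r\<close> would make the root
  its own child.\<close>

definition child :: "'a \<Rightarrow> 'a \<Rightarrow> bool" where
  "child x y \<longleftrightarrow> x \<in> K \<and> x \<noteq> r \<and> par x = y"

lemma edge_cases: "x \<in> K \<Longrightarrow> y \<in> K \<Longrightarrow> {x, y} \<in> E \<Longrightarrow> child x y \<or> child y x"
proof -
  assume xy: "x \<in> K" "y \<in> K" "{x, y} \<in> E"
  show ?thesis
  proof (cases "rk x \<le> rk y")
    case True
    then show ?thesis using edge_parent[OF acyc rK par xy] xy(2) unfolding child_def by blast
  next
    case False
    have "{y, x} \<in> E" using xy(3) by (simp add: insert_commute)
    then show ?thesis
      using edge_parent[OF acyc rK par xy(2,1)] False xy(1) unfolding child_def by simp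
  qed
qed

lemma childD:
  assumes "child x y"
  shows "x \<in> K" "x \<noteq> r" "par x = y" "y \<in> K" "{x, y} \<in> E" "{y, x} \<in> E" "rk y < rk x" "x \<noteq> y"
proof -
  have x: "x \<in> K" "x \<noteq> r" "par x = y" using assms unfolding child_def by auto
  then show "x \<in> K" "x \<noteq> r" "par x = y" "y \<in> K" "{y, x} \<in> E" "rk y < rk x" "x \<noteq> y" "{x, y} \<in> E"
    using par[of x] by (auto simp: insert_commute)
qed

lemma child_par: "x \<in> K \<Longrightarrow> x \<noteq> r \<Longrightarrow> child x (par x)"
  unfolding child_def by simp

text \<open>The exceptional neighbour of \<open>par v\<close> is its own parent. Any other neighbour
  \<open>y\<close> is a child of \<open>par v\<close>; a child of \<open>y\<close> would be visited
  no later than \<open>v\<close>, so by \<open>mono\<close> its parent \<open>y\<close> would come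
  no later than \<open>par v\<close>, which is absurd. For \<open>v = r\<close> this is the isolated
  case, as \<open>par r = r\<close>.\<close>

lemma safe_leaf_last:
  assumes v: "v \<in> K" and last: "\<And>x. x \<in> K \<Longrightarrow> rk x \<le> rk v"
  shows "safe_leaf E C (par v) v"
proof -
  have leaf: "\<not> child y v" for y
    using last childD[of y v] by (metis not_less)
  have "y = par v" if "y \<in> C" "{v, y} \<in> E" for y
    using edge_cases[OF v closed[OF v that] that(2)] leaf childD(3) by blast
  moreover have "par v \<in> C" "v \<in> C" using par[OF v] par_r v KC by (cases "v = r"; auto)+
  moreover have "{par v, v} \<in> E \<and> (\<exists>p. p \<noteq> v \<and> (\<forall>y\<in>C. {par v, y} \<in> E \<longrightarrow> y \<noteq> p \<longrightarrow>
      (\<forall>y'\<in>C. {y, y'} \<in> E \<longrightarrow> y' = par v)))" if "par v \<noteq> v"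
  proof -
    have vr: "v \<noteq> r" using that par_r by auto
    have c: "child v (par v)" using child_par v vr by blast
    have pK: "par v \<in> K" using childD[OF c] by simp
    have "rk (par (par v)) < rk v"
      using childD[OF c] par[OF pK] par_r by (metis order.strict_trans)
    then have "par (par v) \<noteq> v" by auto
    moreover have "y' = par v"
      if y: "y \<in> C" "{par v, y} \<in> E" "y \<noteq> par (par v)" "y' \<in> C" "{y, y'} \<in> E" for y y'
    proof -
      have yK: "y \<in> K" using closed pK y by blast
      then have cy: "child y (par v)" using edge_cases[OF pK yK y(2)] y(3) childD(3) by blast
      have y'K: "y' \<in> K" using closed yK y by blast
      have "\<not> child y' y"
      proof
        assume cy': "child y' y"
        have "rk (par y') \<le> rk (par v)"
          using mono[of y' v] childD[OF cy'] v vr last by blast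
        then show False using childD[OF cy'] childD[OF cy] by auto
      qed
      then have "child y y'" using edge_cases[OF yK y'K y(5)] by blast
      then show ?thesis using childD(3) cy by blast
    qed
    ultimately show ?thesis using childD[OF c] by blast
  qed
  ultimately show ?thesis unfolding safe_leaf_def using v by blast
qed

end

text \<open>\<open>ch w = Some y\<close>: the token on \<open>w\<close> can slide to its child \<open>y\<close> after the tokens below \<open>y\<close>
  have moved down in the same way. A token without such a child is bad, \<open>two y\<close> says that \<open>y\<close> has
  two bad children, which therefore can never move, and \<open>blk\<close> is inherited from \<open>two\<close> by all
  descendants.\<close>

locale fetch = rooted +
  fixes I :: "'a set" and ch :: "'a \<Rightarrow> 'a option" and two blk :: "'a \<Rightarrow> bool"
  assumes indep_I: "indep E I"
    and bound: "\<And>x y. x \<in> K \<Longrightarrow> y \<in> I \<Longrightarrow> {x, y} \<in> E \<Longrightarrow> y \<in> K"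
    and ch_Some: "\<And>w y. w \<in> K \<Longrightarrow> ch w = Some y \<Longrightarrow>
      child y w \<and> (\<forall>x. child x y \<longrightarrow> x \<in> I \<longrightarrow> ch x \<noteq> None)"
    and ch_None: "\<And>w y. ch w = None \<Longrightarrow> child y w \<Longrightarrow> \<exists>x. child x y \<and> x \<in> I \<and> ch x = None"
    and two_iff: "\<And>y. y \<in> K \<Longrightarrow> two y \<longleftrightarrow> (\<exists>x x'. x \<noteq> x' \<and> child x y \<and> child x' y \<and>
      x \<in> I \<and> x' \<in> I \<and> ch x = None \<and> ch x' = None)"
    and blk_r: "blk r \<longleftrightarrow> two r"
    and blk_child: "\<And>x y. child x y \<Longrightarrow> blk x \<longleftrightarrow> two x \<or> blk y"
begin

text \<open>A set of tokens that block each other. The second rule adds, below every child of a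
  stuck token, the bad tokens that prevent it from moving down.\<close>

inductive_set stuck :: "'a set" where
  stuck_two: "y \<in> K \<Longrightarrow> two y \<Longrightarrow> child x y \<Longrightarrow> x \<in> I \<Longrightarrow> ch x = None \<Longrightarrow> x \<in> stuck"
| stuck_down: "w \<in> stuck \<Longrightarrow> child y w \<Longrightarrow> child x y \<Longrightarrow> x \<in> I \<Longrightarrow> ch x = None \<Longrightarrow> x \<in> stuck"

lemma stuckD: "x \<in> stuck \<Longrightarrow> x \<in> K \<and> x \<noteq> r \<and> x \<in> I \<and> ch x = None"
  by (induction rule: stuck.induct) (auto simp: child_def)

lemma two_stuck:
  assumes "y \<in> K" and "two y"
  obtains x x' where "x \<noteq> x'" "child x y" "child x' y" "x \<in> stuck" "x' \<in> stuck"
  using assms two_iff stuck_two by blast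

text \<open>Upwards the way is barred by a stuck sibling or by the stuck grandparent, depending on
  the rule that made the token stuck; downwards by the stuck token below the chosen child, which
  exists by \<open>ch_None\<close>.\<close>

lemma stuck_fixed:
  assumes "stuck \<subseteq> Z" and st: "step E a b Z Z'" and "a \<in> C" and "b \<in> C"
  shows "a \<notin> stuck"
proof
  assume a: "a \<in> stuck"
  have e: "{a, b} \<in> E" and Z': "Z' = insert b (Z - {a})" and iZ': "indep E Z'"
    using st unfolding step_def by auto
  have no: False if "x \<in> stuck" "x \<noteq> a" "{x, b} \<in> E" for x
  proof -
    have "x \<in> Z'" "b \<in> Z'" using that assms(1) Z' by auto
    then show False using iZ' that(3) unfolding indep_def by blast
  qed
  have aK: "a \<in> K" using stuckD[OF a] by simp
  have bK: "b \<in> K" using closed aK assms(4) e by blast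
  from edge_cases[OF aK bK e] show False
  proof
    assume ab: "child a b"
    from a show False
    proof cases
      case (stuck_two y)
      then have "y = b" using ab childD(3) by blast
      obtain x x' where "x \<noteq> x'" "child x b" "child x' b" "x \<in> stuck" "x' \<in> stuck"
        using two_stuck stuck_two \<open>y = b\<close> by metis
      then show False using no[of x] no[of x'] childD(5) by metis
    next
      case (stuck_down w y)
      then have "y = b" using ab childD(3) by blast
      then have "child b w" using stuck_down by simp
      then show False
        using no[OF stuck_down(1)] childD[OF ab] childD[OF \<open>child b w\<close>] by force
    qed
  next
    assume ba: "child b a"
    obtain x where "child x b" "x \<in> I" "ch x = None"
      using ch_None[of a b] ba stuckD[OF a] by metis
    then show False
      using no[of x] stuck_down[OF a ba] childD[of x b] childD[OF ba] by force
  qed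
qed

text \<open>Tokens never leave the blocked region: a slide upwards out of it would start at a vertex
  satisfying \<open>two\<close>, and such a vertex has stuck children and therefore cannot be
  occupied. The root itself, if blocked, satisfies \<open>two\<close> and is excluded for the same
  reason.\<close>

lemma root_unreachable:
  assumes blocked: "\<And>w. w \<in> K \<Longrightarrow> w \<in> I \<Longrightarrow> blk w" and "reach E C (I \<inter> C) Z"
  shows "r \<notin> Z"
proof -
  have "stuck \<subseteq> Z \<and> (\<forall>x\<in>Z \<inter> K. blk x) \<and> indep E Z"
    using assms(2)
  proof (induction rule: rtranclp_induct)
    case base
    show ?case
      using blocked stuckD KC indep_I by (auto intro: indep_subset)
  next
    case (step Z Z')
    then obtain a b where ab: "a \<in> C" "b \<in> C" "a \<in> Z" "b \<notin> Z" "{a, b} \<in> E" "{b, a} \<in> E"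
        "Z' = insert b (Z - {a})" "indep E Z" "indep E Z'" "step E a b Z Z'"
      by (meson step_cases)
    have sZ: "stuck \<subseteq> Z" using step.IH by simp
    have "stuck \<subseteq> Z'" using stuck_fixed[OF sZ ab(10,1,2)] sZ ab(7) by blast
    moreover have "blk b" if bK: "b \<in> K"
    proof -
      have aK: "a \<in> K" using closed bK ab by blast
      have ba: "blk a" using step.IH aK ab(3) by blast
      from edge_cases[OF aK bK ab(5)] show ?thesis
      proof
        assume "child b a"
        then show ?thesis using blk_child ba by blast
      next
        assume "child a b"
        moreover have "\<not> two a"
        proof
          assume "two a"
          then obtain x where "child x a" "x \<in> stuck" using two_stuck[OF aK] by metis
          then show False using childD(5) sZ ab(3,8) unfolding indep_def by blast
        qed
        ultimately show ?thesis using blk_child ba by blast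
      qed
    qed
    ultimately show ?case using step.IH ab(7,9) by blast
  qed
  moreover have "r \<notin> Z" if "stuck \<subseteq> Z" "\<forall>x\<in>Z \<inter> K. blk x" "indep E Z"
  proof
    assume "r \<in> Z"
    then have "two r" using that(2) rK blk_r by blast
    then obtain x where "child x r" "x \<in> stuck" using two_stuck[OF rK] by metis
    then show False using childD(5) that \<open>r \<in> Z\<close> unfolding indep_def by blast
  qed
  ultimately show ?thesis by blast
qed

end

text \<open>\<open>w\<close> only determines the place \<open>z\<close>; the token that climbs from
  there is \<open>k\<close>. It is the bad token below \<open>z\<close> if there is one, and as
  \<open>z\<close> is not blocked there is at most one. \<open>N\<close> collects the tokens that
  have to move down: the siblings of \<open>k\<close>, and the tokens below the places to which
  members of \<open>N\<close> move.\<close>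

locale fetch_token = fetch +
  fixes w z k :: 'a and N :: "'a set"
  assumes wK: "w \<in> K" and wr: "w \<noteq> r" and w_blk: "\<not> blk w"
    and w_first: "\<And>x. x \<in> K \<Longrightarrow> x \<in> I \<Longrightarrow> \<not> blk x \<Longrightarrow> rk w \<le> rk x"
    and z_def: "z = par w"
    and k_child: "child k z" and kI: "k \<in> I"
    and k_bad: "\<And>x. child x z \<Longrightarrow> x \<in> I \<Longrightarrow> ch x = None \<Longrightarrow> ch k = None"
    and N_iff: "\<And>x. x \<in> N \<longleftrightarrow> x \<in> K \<and> x \<noteq> r \<and> x \<in> I \<and> (par x = z \<and> x \<noteq> k \<or>
      par (par x) \<in> N \<and> ch (par (par x)) = Some (par x))"
begin

inductive_set path :: "'a set" where
  path_z: "z \<in> path"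
| path_up: "a \<in> path \<Longrightarrow> a \<noteq> r \<Longrightarrow> par a \<in> path"

lemma wz: "child w z"
  using wK wr z_def child_par by simp

lemma pathD: "a \<in> path \<Longrightarrow> a \<in> K \<and> \<not> blk a \<and> rk a \<le> rk z"
proof (induction rule: path.induct)
  case path_z
  show ?case using wz w_blk blk_child childD[OF wz] by blast
next
  case (path_up a)
  then have c: "child a (par a)" using child_par by blast
  then show ?case using path_up blk_child childD[OF c] by fastforce
qed

lemma path_I: "a \<in> path \<Longrightarrow> a \<notin> I"
  using pathD w_first childD(7)[OF wz] by (metis leD order.strict_trans1)

text \<open>A token has no token among its children, so \<open>c\<close> is not blocked and
  \<open>w\<close> is visited no later than \<open>c\<close>. By \<open>mono\<close> the same holds
  for their parents \<open>z\<close> and \<open>a\<close>, while \<open>z\<close> has the largest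
  rank on the path. Hence only tokens below \<open>z\<close> have to make room.\<close>

lemma path_child_I:
  assumes a: "a \<in> path" and c: "child c a" and "c \<in> I"
  shows "a = z"
proof -
  have "\<not> two c"
    using two_iff[OF childD(1)[OF c]] indepD[OF indep_I] assms(3) childD(6) by meson
  then have "\<not> blk c" using blk_child[OF c] pathD[OF a] by blast
  then have "rk w \<le> rk c" using w_first childD[OF c] assms(3) by blast
  then have "rk z \<le> rk a"
    using mono[of w c] wK wr childD[OF c] z_def by simp
  then show ?thesis
    using pathD[OF a] inj childD[OF wz] unfolding inj_on_def by (meson le_antisym)
qed

lemma N_D: "x \<in> N \<Longrightarrow> x \<in> K \<and> x \<noteq> r \<and> x \<in> I"
  using N_iff by blast

lemma N_rk: "x \<in> N \<Longrightarrow> rk z < rk x"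
proof (induction "rk x" arbitrary: x rule: less_induct)
  case less
  have x: "child x (par x)" using N_D[OF less.prems] child_par by blast
  show ?case
  proof (cases "par x = z")
    case True
    then show ?thesis using childD[OF x] by simp
  next
    case False
    then have p: "par (par x) \<in> N" using N_iff less.prems by blast
    then have "par x \<noteq> r" using N_D par_r by metis
    then have "child (par x) (par (par x))" using child_par childD[OF x] by blast
    then have "rk (par (par x)) < rk x"
      using childD(7) childD(7)[OF x] by (metis order.strict_trans)
    then show ?thesis using less.hyps p by fastforce
  qed
qed

text \<open>Were a sibling of \<open>k\<close> bad, then \<open>k\<close> would be bad by
  \<open>k_bad\<close>, and \<open>z\<close> would satisfy \<open>two\<close> although it is not
  blocked. Deeper tokens in \<open>N\<close> are movable by \<open>ch_Some\<close>.\<close>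

lemma N_ch:
  assumes "x \<in> N"
  obtains c where "ch x = Some c" "child c x" "\<And>x'. child x' c \<Longrightarrow> x' \<in> I \<Longrightarrow> x' \<in> N"
proof -
  have x: "child x (par x)" using N_D[OF assms] child_par by blast
  have "ch x \<noteq> None"
  proof (cases "par x = z \<and> x \<noteq> k")
    case True
    show ?thesis
    proof
      assume n: "ch x = None"
      then have "ch k = None" using k_bad x True N_D[OF assms] by blast
      then have "two z"
        using two_iff[of z] n True x k_child kI N_D[OF assms] childD(4)[OF k_child] by blast
      moreover have "\<not> blk z" using pathD path_z by blast
      ultimately show False
        using blk_r blk_child child_par childD(4)[OF wz] by blast
    qed
  next
    case False
    then have "par (par x) \<in> N" "ch (par (par x)) = Some (par x)" using N_iff assms by blast+
    then show ?thesis using ch_Some[of "par (par x)" "par x"] N_D x assms by blast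
  qed
  then obtain c where c: "ch x = Some c" by blast
  have cx: "child c x" using ch_Some[OF _ c] N_D[OF assms] by blast
  have "x' \<in> N" if "child x' c" "x' \<in> I" for x'
  proof -
    have "par x' = c" "par (par x') = x" using childD(3) that(1) cx by auto
    then show ?thesis using N_iff[of x'] c assms that childD[OF that(1)] by simp
  qed
  then show ?thesis using that c cx by blast
qed

text \<open>The stage of the clearing at which exactly the tokens in \<open>B\<close> have made
  room.\<close>

definition J :: "'a set \<Rightarrow> 'a set" where
  "J B = (I - B) \<union> {c. \<exists>x\<in>B. ch x = Some c}"

text \<open>A token may move only after the tokens below its target have moved; the sets closed in
  this sense are the legal stages.\<close>

definition descends :: "'a set \<Rightarrow> bool" where
  "descends B \<longleftrightarrow> B \<subseteq> N \<and> (\<forall>x\<in>B. \<forall>c x'. ch x = Some c \<longrightarrow> child x' c \<longrightarrow> x' \<in> I \<longrightarrow> x' \<in> B)"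

text \<open>Tokens below a target come later in the order than the token aiming at it, so clearing
  in reverse visiting order passes through legal stages only.\<close>

lemma descends_above: "descends {x \<in> N. n < rk x}"
  unfolding descends_def
proof (intro conjI ballI allI impI)
  fix x c x' assume x: "x \<in> {x \<in> N. n < rk x}" and c: "ch x = Some c" and x': "child x' c" "x' \<in> I"
  have xN: "x \<in> N" using x by simp
  obtain c' where c': "ch x = Some c'" "child c' x" "\<And>x'. child x' c' \<Longrightarrow> x' \<in> I \<Longrightarrow> x' \<in> N"
    using N_ch[OF xN] by blast
  have [simp]: "c' = c" using c c'(1) by simp
  have "rk x < rk x'" using childD(7)[OF c'(2)] childD(7)[OF x'(1)] by simp
  then show "x' \<in> {x \<in> N. n < rk x}" using x c'(3)[of x'] x' by simp
qed blast

lemma descends_child: "descends B \<Longrightarrow> x \<in> B \<Longrightarrow> ch x = Some c \<Longrightarrow> child c x"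
  unfolding descends_def using N_ch by (metis option.sel subsetD)

lemma J_K: "y \<in> J B \<Longrightarrow> descends B \<Longrightarrow> x \<in> K \<Longrightarrow> {x, y} \<in> E \<Longrightarrow> y \<in> K"
  unfolding J_def using bound descends_child childD(1) by blast

text \<open>If \<open>x\<close> carries an unmoved token, then \<open>y\<close> must be a target,
  and all tokens below a target have moved. If \<open>x\<close> is a target, then the token on
  \<open>y\<close> moved there, so \<open>y\<close> could only be refilled from its own parent,
  which would be a token of \<open>I\<close> adjacent to one on \<open>y\<close>.\<close>

lemma J_no_edge:
  assumes B: "descends B" and x: "x \<in> J B" and y: "y \<in> J B" and c: "child x y"
  shows False
proof -
  have chB: "child c' x'" if "x' \<in> B" "ch x' = Some c'" for x' c'
    using descends_child B that by blast
  have BI: "x' \<in> I" if "x' \<in> B" for x' using that B N_D unfolding descends_def by blast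
  show False
  proof (cases "x \<in> I - B")
    case True
    then have "y \<notin> I" using indepD[OF indep_I] childD(5)[OF c] by blast
    then obtain x' where "x' \<in> B" "ch x' = Some y" using y unfolding J_def by blast
    then show False using B c True unfolding descends_def by blast
  next
    case False
    then obtain x' where x': "x' \<in> B" "ch x' = Some x" using x unfolding J_def by blast
    then have "x' = y" using chB c childD(3) by blast
    then have "y \<in> B" using x' by simp
    then obtain x'' where x'': "x'' \<in> B" "ch x'' = Some y" using y unfolding J_def by blast
    then have "child y x''" using chB by blast
    then show False
      using indepD[OF indep_I, of y x''] BI \<open>y \<in> B\<close> x''(1) childD(5) by blast
  qed
qed

lemma indep_J:
  assumes B: "descends B"
  shows "indep E (J B)"
  unfolding indep_def
proof (intro ballI notI)
  fix x y assume x: "x \<in> J B" and y: "y \<in> J B" and e: "{x, y} \<in> E"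
  have e': "{y, x} \<in> E" using e by (simp add: insert_commute)
  show False
  proof (cases "x \<in> K \<or> y \<in> K")
    case True
    then have "x \<in> K" "y \<in> K" using J_K[OF y B _ e] J_K[OF x B _ e'] by blast+
    from edge_cases[OF this e] show False using J_no_edge[OF B] x y by blast
  next
    case False
    have "c \<in> K" if "x' \<in> B" "ch x' = Some c" for x' c
      using descends_child[OF B] that childD(1) by blast
    then have "x \<in> I" "y \<in> I" using False x y unfolding J_def by blast+
    then show False using indep_I e unfolding indep_def by blast
  qed
qed

lemma clear_step:
  assumes B: "descends B" and B': "descends (insert x B)" and x: "x \<in> N" "x \<notin> B"
    and c: "ch x = Some c"
  shows "step E x c (J B) (J (insert x B))" and "c \<in> K"
proof -
  obtain c' where c': "ch x = Some c'" "child c' x" using N_ch[OF x(1)] by metis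
  then have cx: "child c x" using c by simp
  then show "c \<in> K" using childD by blast
  have xI: "x \<in> I" using N_D x by blast
  have chB: "child c' x'" if "x' \<in> B" "ch x' = Some c'" for x' c'
    using descends_child B that by blast
  have cI: "c \<notin> I" using indepD[OF indep_I xI] childD(6)[OF cx] by blast
  have xn: "ch x' \<noteq> Some x" if "x' \<in> B" for x'
  proof
    assume "ch x' = Some x"
    then have "{x, x'} \<in> E" using chB that childD(5) by blast
    then show False using indepD[OF indep_I xI] that B N_D unfolding descends_def by blast
  qed
  have cn: "ch x' \<noteq> Some c" if "x' \<in> B" for x'
    using chB[OF that] childD(3) cx x(2) that by blast
  have "J (insert x B) = insert c (J B - {x})"
    using c xn unfolding J_def by auto
  moreover have "x \<in> J B" "c \<notin> J B" using xI x cI cn unfolding J_def by auto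
  ultimately show "step E x c (J B) (J (insert x B))"
    using indep_J[OF B] indep_J[OF B'] childD(6)[OF cx] unfolding step_def by metis
qed

lemma descends_N: "descends N"
  unfolding descends_def using N_ch by (metis option.sel subsetI)

lemma k_not_N: "k \<notin> N"
proof
  assume "k \<in> N"
  then have p: "par z \<in> N" using N_iff childD(3)[OF k_child] by blast
  then have "z \<noteq> r" using N_D par_r by metis
  then have "par z \<in> path" using path.intros by blast
  then show False using path_I p N_D by blast
qed

lemma path_J: "a \<in> path \<Longrightarrow> a \<notin> J N"
proof
  assume a: "a \<in> path" and "a \<in> J N"
  then obtain x where x: "x \<in> N" "ch x = Some a" using path_I unfolding J_def by blast
  then have "child a x" using N_ch[of x] by (metis option.sel)
  then show False using childD(7) N_rk[OF x(1)] pathD[OF a] by fastforce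
qed

text \<open>A token next to \<open>a\<close> would sit on a child of \<open>a\<close>, as the parent
  of \<open>a\<close> is on the empty path. An unmoved one forces \<open>a = z\<close> and then
  belongs to \<open>N\<close> unless it is \<open>k\<close>; a moved one came from \<open>a\<close>,
  where \<open>I\<close> has no token.\<close>

lemma indep_path:
  assumes a: "a \<in> path"
  shows "indep E (insert a (J N - {k}))"
proof -
  have no: "{a, y} \<notin> E" if y: "y \<in> J N" "y \<noteq> k" for y
  proof
    assume e: "{a, y} \<in> E"
    have aK: "a \<in> K" using pathD a by blast
    have yK: "y \<in> K" using J_K[OF y(1) descends_N aK e] .
    from edge_cases[OF aK yK e] show False
    proof
      assume "child a y"
      then have "y \<in> path" using path_up[OF a] childD by blast
      then show False using path_J y by blast
    next
      assume c: "child y a"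
      show False
      proof (cases "y \<in> I - N")
        case True
        then have "a = z" using path_child_I[OF a c] by blast
        then have "y \<in> N" using N_iff[of y] True y(2) childD[OF c] by simp
        then show False using True by blast
      next
        case False
        then obtain x where x: "x \<in> N" "ch x = Some y" using y unfolding J_def by blast
        then have "child y x" using N_ch[of x] by (metis option.sel)
        then have "x = a" using c childD(3) by blast
        then show False using x(1) N_D path_I[OF a] by blast
      qed
    qed
  qed
  have "{a} \<notin> E" using acyc unfolding forest_def by blast
  then show ?thesis
    using no indep_J[OF descends_N] unfolding indep_def by (auto simp: insert_commute)
qed

lemma k_J: "k \<in> J N"
  using kI k_not_N unfolding J_def by blast

lemma up_step:
  assumes a: "a = k \<or> a \<in> path" and "a \<noteq> r"
  shows "step E a (par a) (insert a (J N - {k})) (insert (par a) (J N - {k}))"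
    and "a \<in> K" and "par a \<in> path"
proof -
  show aK: "a \<in> K" using a pathD childD(1)[OF k_child] by blast
  have c: "child a (par a)" using child_par aK assms(2) by blast
  show pp: "par a \<in> path" using a path.intros assms(2) childD(3)[OF k_child] by metis
  have "indep E (insert a (J N - {k}))"
    using a indep_path indep_J[OF descends_N] k_J by (metis insert_Diff)
  moreover have "par a \<notin> insert a (J N - {k})"
    using path_J[OF pp] childD(8)[OF c] by simp
  moreover have "insert (par a) (J N - {k}) = insert (par a) (insert a (J N - {k}) - {a})"
  proof -
    have "a \<notin> J N - {k}" using a path_J by blast
    then show ?thesis by simp
  qed
  ultimately show "step E a (par a) (insert a (J N - {k})) (insert (par a) (J N - {k}))"
    using indep_path[OF pp] childD(5)[OF c] unfolding step_def by blast
qed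

end


section \<open>Total correctness of programs\<close>

text \<open>\<open>wpt c s T Q\<close>: started in \<open>s\<close>, the program \<open>c\<close> halts within \<open>T\<close> steps in a state
  satisfying \<open>Q\<close>.\<close>

definition wpt :: "com \<Rightarrow> state \<Rightarrow> nat \<Rightarrow> (state \<Rightarrow> bool) \<Rightarrow> bool" where
  "wpt c s T Q \<longleftrightarrow> (\<exists>t s'. runs c s t s' \<and> t \<le> T \<and> Q s')"

primrec straight :: "com \<Rightarrow> bool" where
  "straight Skip \<longleftrightarrow> True"
| "straight (Assign r e) \<longleftrightarrow> True"
| "straight (Store a e f) \<longleftrightarrow> True"
| "straight (Write e) \<longleftrightarrow> True"
| "straight (Seq c d) \<longleftrightarrow> straight c \<and> straight d"
| "straight (Cond b c d) \<longleftrightarrow> straight c \<and> straight d"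
| "straight (While b c) \<longleftrightarrow> False"

primrec exec :: "com \<Rightarrow> state \<Rightarrow> state" where
  "exec Skip s = s"
| "exec (Assign r e) s = s\<lparr>regs := (regs s)(r := eval_exp e s)\<rparr>"
| "exec (Store a e f) s = s\<lparr>arrs := (arrs s)(a := (arrs s a)(eval_exp e s := eval_exp f s))\<rparr>"
| "exec (Write e) s = s\<lparr>outp := outp s @ [eval_exp e s]\<rparr>"
| "exec (Seq c d) s = exec d (exec c s)"
| "exec (Cond b c d) s = (if eval_test b s then exec c s else exec d s)"
| "exec (While b c) s = s"

text \<open>An upper bound in which a conditional is charged for both branches. The values for
  \<open>While\<close> here and in \<open>exec\<close> are dummies, since both functions serve
  \<open>straight\<close> commands.\<close>

primrec cost :: "com \<Rightarrow> nat" where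
  "cost Skip = 1"
| "cost (Assign r e) = 1"
| "cost (Store a e f) = 1"
| "cost (Write e) = 1"
| "cost (Seq c d) = cost c + cost d"
| "cost (Cond b c d) = 1 + cost c + cost d"
| "cost (While b c) = 1"

primrec wregs :: "com \<Rightarrow> nat set" where
  "wregs Skip = {}"
| "wregs (Assign r e) = {r}"
| "wregs (Store a e f) = {}"
| "wregs (Write e) = {}"
| "wregs (Seq c d) = wregs c \<union> wregs d"
| "wregs (Cond b c d) = wregs c \<union> wregs d"
| "wregs (While b c) = wregs c"

primrec warrs :: "com \<Rightarrow> nat set" where
  "warrs Skip = {}"
| "warrs (Assign r e) = {}"
| "warrs (Store a e f) = {a}"
| "warrs (Write e) = {}"
| "warrs (Seq c d) = warrs c \<union> warrs d"
| "warrs (Cond b c d) = warrs c \<union> warrs d"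
| "warrs (While b c) = warrs c"

primrec writes :: "com \<Rightarrow> bool" where
  "writes Skip = False"
| "writes (Assign r e) = False"
| "writes (Store a e f) = False"
| "writes (Write e) = True"
| "writes (Seq c d) = (writes c \<or> writes d)"
| "writes (Cond b c d) = (writes c \<or> writes d)"
| "writes (While b c) = writes c"

text \<open>A frame condition read off the program text; it spares the loop invariants all registers
  and arrays that a loop leaves alone.\<close>

definition agree :: "com \<Rightarrow> state \<Rightarrow> state \<Rightarrow> bool" where
  "agree c s s' \<longleftrightarrow> (\<forall>r. r \<notin> wregs c \<longrightarrow> regs s' r = regs s r) \<and>
     (\<forall>a. a \<notin> warrs c \<longrightarrow> arrs s' a = arrs s a) \<and> (\<not> writes c \<longrightarrow> outp s' = outp s)"

lemma runs_agree: "runs c s t s' \<Longrightarrow> agree c s s'"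
  by (induction rule: runs.induct) (auto simp: agree_def)

lemma agree_refl: "agree c s s"
  by (simp add: agree_def)

lemma agree_trans: "agree c s s' \<Longrightarrow> agree c s' s'' \<Longrightarrow> agree c s s''"
  by (simp add: agree_def)

lemma runs_exec: "straight c \<Longrightarrow> \<exists>t\<le>cost c. runs c s t (exec c s)"
proof (induction c arbitrary: s)
  case (Seq c d)
  then obtain t u where "t \<le> cost c" "runs c s t (exec c s)" "u \<le> cost d"
    "runs d (exec c s) u (exec d (exec c s))" by (metis straight.simps(5))
  then show ?case using runs_Seq by (metis add_mono cost.simps(5) exec.simps(5))
next
  case (Cond b c d)
  then obtain t u where "t \<le> cost c" "runs c s t (exec c s)" "u \<le> cost d" "runs d s u (exec d s)"
    by (metis straight.simps(6))
  then show ?case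
    using runs_CondTrue[of b s c t "exec c s" d] runs_CondFalse[of b s d u "exec d s" c]
    by (cases "eval_test b s") (fastforce intro: exI[of _ "1 + t"] exI[of _ "1 + u"])+
qed (auto intro!: exI[of _ 1] intro: runs.intros simp del: One_nat_def)

lemma wpt_straight: "Q (exec c s) \<Longrightarrow> straight c \<Longrightarrow> cost c \<le> T \<Longrightarrow> wpt c s T Q"
  unfolding wpt_def using runs_exec by (meson le_trans)

lemma wpt_mono: "wpt c s T Q \<Longrightarrow> T \<le> T' \<Longrightarrow> (\<And>s'. Q s' \<Longrightarrow> agree c s s' \<Longrightarrow> Q' s') \<Longrightarrow> wpt c s T' Q'"
  unfolding wpt_def using runs_agree by (meson le_trans)

lemma wpt_Seq: "wpt c s T (\<lambda>s'. wpt d s' U Q) \<Longrightarrow> wpt (Seq c d) s (T + U) Q"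
  unfolding wpt_def using runs_Seq by (meson add_mono)

lemma wpt_Seq_agree:
  assumes "wpt c s T P" and "\<And>s'. P s' \<Longrightarrow> agree c s s' \<Longrightarrow> wpt d s' U Q" and "T + U \<le> T'"
  shows "wpt (Seq c d) s T' Q"
proof -
  have "wpt (Seq c d) s (T + U) Q"
    by (rule wpt_Seq, rule wpt_mono[OF assms(1)]) (use assms(2) in auto)
  then show ?thesis by (rule wpt_mono) (use assms(3) in auto)
qed

lemma wpt_Seq_straight:
  assumes "straight c" and "cost c \<le> T" and "wpt d (exec c s) (T - cost c) Q"
  shows "wpt (Seq c d) s T Q"
proof -
  have "wpt (Seq c d) s (cost c + (T - cost c)) Q"
    by (rule wpt_Seq, rule wpt_straight) (use assms in auto)
  then show ?thesis using assms(2) by simp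
qed

lemma wpt_Cond:
  assumes "eval_test b s \<Longrightarrow> wpt c s T Q" and "\<not> eval_test b s \<Longrightarrow> wpt d s T Q"
  shows "wpt (Cond b c d) s (1 + T) Q"
proof (cases "eval_test b s")
  case True
  then show ?thesis using assms(1) runs_CondTrue unfolding wpt_def by (meson add_le_cancel_left)
next
  case False
  then show ?thesis using assms(2) runs_CondFalse unfolding wpt_def by (meson add_le_cancel_left)
qed

text \<open>The first argument of the invariant \<open>P\<close> bounds the number of remaining iterations.\<close>

lemma wpt_While:
  assumes "P k s"
    and body: "\<And>k s'. agree c s s' \<Longrightarrow> P k s' \<Longrightarrow> eval_test b s' \<Longrightarrow>
      wpt c s' B (\<lambda>s''. \<exists>k'<k. P k' s'')"
    and fin: "\<And>k s'. agree c s s' \<Longrightarrow> P k s' \<Longrightarrow> \<not> eval_test b s' \<Longrightarrow> Q s'"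
    and "1 + k * (1 + B) \<le> T"
  shows "wpt (While b c) s T Q"
proof -
  have "wpt (While b c) s' (1 + k * (1 + B)) Q" if "P k s'" "agree c s s'" for k s'
    using that
  proof (induction k arbitrary: s' rule: less_induct)
    case (less k)
    show ?case
    proof (cases "eval_test b s'")
      case False
      then show ?thesis
        using runs_WhileFalse[OF False] fin less.prems unfolding wpt_def by (metis le_add1)
    next
      case True
      then obtain t s1 k' where 1: "runs c s' t s1" "t \<le> B" "k' < k" "P k' s1"
        using body[OF less.prems(2,1)] unfolding wpt_def by blast
      then obtain u s2 where 2: "runs (While b c) s1 u s2" "u \<le> 1 + k' * (1 + B)" "Q s2"
        using less.IH[of k' s1] agree_trans[OF less.prems(2) runs_agree] unfolding wpt_def by blast
      have "Suc k' * (1 + B) \<le> k * (1 + B)" using 1 by (intro mult_le_mono1) simp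
      then have "1 + t + u \<le> 1 + k * (1 + B)" using 1 2 by simp
      then show ?thesis using runs_WhileTrue[OF True 1(1) 2(1)] 2(3) unfolding wpt_def by blast
    qed
  qed
  from this[OF assms(1) agree_refl] show ?thesis
    by (rule wpt_mono) (use assms(4) in auto)
qed

text \<open>The index of the invariant is the value of the loop counter. The body is
  \<open>straight\<close>, so its obligation becomes an equation about \<open>exec\<close> that
  simplification can evaluate.\<close>

lemma wpt_for:
  assumes c: "straight c" "r' \<notin> wregs c" and "P (regs s r) s" and "regs s r \<le> regs s r'"
    and body: "\<And>s' i. agree c s s' \<Longrightarrow> regs s' r = i \<Longrightarrow> i < regs s r' \<Longrightarrow> P i s' \<Longrightarrow>
      regs (exec c s') r = Suc i \<and> P (Suc i) (exec c s')"
    and T: "1 + (regs s r' - regs s r) * (1 + cost c) \<le> T"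
  shows "wpt (While (Less (Reg r) (Reg r')) c) s T (P (regs s r'))"
proof (rule wpt_While[where P = "\<lambda>k s'. k + regs s' r = regs s r' \<and> P (regs s' r) s'", OF _ _ _ T])
  fix k s' assume *: "agree c s s'" "k + regs s' r = regs s r' \<and> P (regs s' r) s'"
  then have r': "regs s' r' = regs s r'" using c by (simp add: agree_def)
  show "wpt c s' (cost c) (\<lambda>s''. \<exists>k'<k. k' + regs s'' r = regs s r' \<and> P (regs s'' r) s'')"
    if "eval_test (Less (Reg r) (Reg r')) s'"
    using that * r' body[of s'] by (intro wpt_straight exI[of _ "k - 1"]) (simp_all add: c)
  show "P (regs s r') s'" if "\<not> eval_test (Less (Reg r) (Reg r')) s'"
  proof -
    have "regs s' r = regs s r'" using that * r' by simp
    then show ?thesis using * by metis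
  qed
qed (use assms in simp)

lemma wpt_countdown:
  assumes c: "straight c" and "P (regs s r) s" and "l \<le> regs s r"
    and body: "\<And>s' i. agree c s s' \<Longrightarrow> regs s' r = Suc i \<Longrightarrow> l \<le> i \<Longrightarrow> i < regs s r \<Longrightarrow> P (Suc i) s' \<Longrightarrow>
      regs (exec c s') r = i \<and> P i (exec c s')"
    and T: "1 + regs s r * (1 + cost c) \<le> T"
  shows "wpt (While (Less (Const l) (Reg r)) c) s T (P l)"
proof (rule wpt_While[where P = "\<lambda>k s'. k = regs s' r \<and> l \<le> k \<and> k \<le> regs s r \<and> P k s'", OF _ _ _ T])
  fix k s' assume *: "agree c s s'" "k = regs s' r \<and> l \<le> k \<and> k \<le> regs s r \<and> P k s'"
  show "wpt c s' (cost c) (\<lambda>s''. \<exists>k'<k. k' = regs s'' r \<and> l \<le> k' \<and> k' \<le> regs s r \<and> P k' s'')"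
    if b: "eval_test (Less (Const l) (Reg r)) s'"
  proof -
    have "0 < k" using b * by auto
    then obtain i where i: "k = Suc i" using gr0_implies_Suc by blast
    then have "l \<le> i" "i < regs s r" "regs s' r = Suc i" using b * by auto
    then have "regs (exec c s') r = i \<and> P i (exec c s')" using * i by (intro body) auto
    then show ?thesis
      using i \<open>l \<le> i\<close> \<open>i < regs s r\<close> by (intro wpt_straight exI[of _ i]) (simp_all add: c)
  qed
  show "P l s'" if "\<not> eval_test (Less (Const l) (Reg r)) s'"
    using that * by (metis eval_exp.simps(1,2) eval_test.simps(2) le_neq_implies_less)
qed (use assms in simp)

lemma runs_outp_length: "runs c s t s' \<Longrightarrow> length (outp s') \<le> length (outp s) + t"
  by (induction rule: runs.induct) auto

text \<open>Such a register grows by at most one per step. This bounds the lengths of the two logs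
  by the running time of the main loop, so that slides never have to be counted.\<close>

primrec counts :: "nat \<Rightarrow> com \<Rightarrow> bool" where
  "counts r Skip \<longleftrightarrow> True"
| "counts r (Assign r' e) \<longleftrightarrow> r' = r \<longrightarrow> e = Succ (Reg r)"
| "counts r (Store a e f) \<longleftrightarrow> True"
| "counts r (Write e) \<longleftrightarrow> True"
| "counts r (Seq c d) \<longleftrightarrow> counts r c \<and> counts r d"
| "counts r (Cond b c d) \<longleftrightarrow> counts r c \<and> counts r d"
| "counts r (While b c) \<longleftrightarrow> counts r c"

lemma runs_counts: "runs c s t s' \<Longrightarrow> counts r c \<Longrightarrow> regs s' r \<le> regs s r + t"
  by (induction rule: runs.induct) auto

lemma wpt_counts:
  "wpt c s T Q \<Longrightarrow> counts r c \<Longrightarrow> wpt c s T (\<lambda>s'. Q s' \<and> regs s' r \<le> regs s r + T)"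
  unfolding wpt_def using runs_counts by (meson add_left_mono le_trans)


section \<open>Adjacency lists\<close>

text \<open>The entries of \<open>aFst\<close>, \<open>aNxt\<close>, \<open>aCh\<close>, \<open>aBad\<close> and the register \<open>rF\<close> use 0 for none: list
  nodes are numbered from 1, and a vertex \<open>y\<close> is stored as \<open>Suc y\<close>.\<close>

abbreviation (input) "rN \<equiv> 0 :: nat"
abbreviation (input) "rM \<equiv> 1 :: nat"
abbreviation (input) "rX \<equiv> 2 :: nat"
abbreviation (input) "rH \<equiv> 3 :: nat"
abbreviation (input) "rT \<equiv> 4 :: nat"
abbreviation (input) "rE \<equiv> 5 :: nat"
abbreviation (input) "rC \<equiv> 6 :: nat"
abbreviation (input) "rY \<equiv> 7 :: nat"
abbreviation (input) "rW \<equiv> 8 :: nat"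
abbreviation (input) "rI \<equiv> 9 :: nat"
abbreviation (input) "rV \<equiv> 10 :: nat"
abbreviation (input) "rU \<equiv> 11 :: nat"
abbreviation (input) "rF \<equiv> 12 :: nat"
abbreviation (input) "rZ \<equiv> 13 :: nat"
abbreviation (input) "rK \<equiv> 14 :: nat"
abbreviation (input) "rP \<equiv> 17 :: nat"
abbreviation (input) "rS \<equiv> 18 :: nat"
abbreviation (input) "aFst \<equiv> 4 :: nat"
abbreviation (input) "aNxt \<equiv> 5 :: nat"
abbreviation (input) "aTo \<equiv> 6 :: nat"
abbreviation (input) "aRem \<equiv> 7 :: nat"
abbreviation (input) "aVis \<equiv> 8 :: nat"
abbreviation (input) "aQ \<equiv> 9 :: nat"
abbreviation (input) "aPar \<equiv> 10 :: nat"
abbreviation (input) "aCh \<equiv> 11 :: nat"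
abbreviation (input) "aBad \<equiv> 12 :: nat"
abbreviation (input) "aTwo \<equiv> 13 :: nat"
abbreviation (input) "aBlk \<equiv> 14 :: nat"
abbreviation (input) "aNeed \<equiv> 15 :: nat"

abbreviation inc :: "nat \<Rightarrow> com" where "inc r \<equiv> Assign r (Succ (Reg r))"
abbreviation dec :: "nat \<Rightarrow> com" where "dec r \<equiv> Assign r (Pred (Reg r))"
notation Seq (infixr ";;" 60)

definition add_arc :: "nat \<Rightarrow> nat \<Rightarrow> com" where
  "add_arc r r' = Store aTo (Reg rP) (Reg r') ;; Store aNxt (Reg rP) (Cell aFst (Reg r)) ;;
     Store aFst (Reg r) (Reg rP) ;; inc rP"

definition build_body :: com where
  "build_body = Assign rY (Cell 0 (Reg rI)) ;; Assign rW (Cell 1 (Reg rI)) ;;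
     add_arc rY rW ;; add_arc rW rY ;; inc rI"

definition build :: com where
  "build = Assign rP (Const 1) ;; Assign rI (Const 0) ;;
     While (Less (Reg rI) (Reg rM)) build_body"

fun chain :: "(nat \<Rightarrow> nat) \<Rightarrow> nat \<Rightarrow> nat list \<Rightarrow> bool" where
  "chain nxt e [] \<longleftrightarrow> e = 0"
| "chain nxt e (c # l) \<longleftrightarrow> e = c \<and> c \<noteq> 0 \<and> chain nxt (nxt c) l"

lemma chain_cong: "(\<And>c. c \<in> set l \<Longrightarrow> nxt' c = nxt c) \<Longrightarrow> chain nxt' e l \<longleftrightarrow> chain nxt e l"
  by (induction l arbitrary: e) auto

lemma chain_0 [simp]: "chain nxt 0 l \<longleftrightarrow> l = []"
  by (cases l) auto

text \<open>\<open>arcs f nxt to p A n k\<close>: the lists with heads \<open>f x\<close> for \<open>x < n\<close>, whose nodes are below \<open>p\<close>,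
  hold the arcs \<open>A\<close>, and their total length is at most \<open>k\<close>.\<close>

definition arcs :: "(nat \<Rightarrow> nat) \<Rightarrow> (nat \<Rightarrow> nat) \<Rightarrow> (nat \<Rightarrow> nat) \<Rightarrow> nat \<Rightarrow> (nat \<times> nat) set \<Rightarrow> nat
    \<Rightarrow> nat \<Rightarrow> bool" where
  "arcs f nxt to p A n k \<longleftrightarrow> (\<exists>adj. (\<forall>x<n. chain nxt (f x) (adj x) \<and> set (adj x) \<subseteq> {..<p} \<and>
     (\<forall>y. y \<in> to ` set (adj x) \<longleftrightarrow> (x, y) \<in> A)) \<and> (\<Sum>x<n. length (adj x)) \<le> k)"

text \<open>The existing lists use only nodes below \<open>p\<close>, so filling node
  \<open>p\<close> and putting it in front of the list of \<open>x\<close> leaves them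
  intact.\<close>

lemma arcs_add:
  assumes "arcs f nxt to p A n k" and "0 < p" and "x < n"
  shows "arcs (f(x := p)) (nxt(p := f x)) (to(p := y)) (Suc p) (insert (x, y) A) n (Suc k)"
proof -
  obtain adj where adj: "\<And>x. x < n \<Longrightarrow> chain nxt (f x) (adj x)"
    "\<And>x. x < n \<Longrightarrow> set (adj x) \<subseteq> {..<p}"
    "\<And>x y. x < n \<Longrightarrow> y \<in> to ` set (adj x) \<longleftrightarrow> (x, y) \<in> A"
    "(\<Sum>x<n. length (adj x)) \<le> k" using assms(1) unfolding arcs_def by metis
  let ?adj = "adj(x := p # adj x)"
  have c: "chain (nxt(p := f x)) e (adj x') \<longleftrightarrow> chain nxt e (adj x')" if "x' < n" for x' e
    using adj(2)[OF that] by (intro chain_cong) auto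
  have t: "(to(p := y)) ` set (adj x') = to ` set (adj x')" if "x' < n" for x'
    using adj(2)[OF that] by (intro image_cong) auto
  have "(\<Sum>x'<n. length (?adj x')) = (\<Sum>x'<n. length (adj x') + (if x' = x then 1 else 0))"
    by (intro sum.cong) auto
  also have "\<dots> = Suc (\<Sum>x<n. length (adj x))" using assms(3) by (simp add: sum.distrib)
  finally have "(\<Sum>x'<n. length (?adj x')) \<le> Suc k" using adj(4) by simp
  moreover have "chain (nxt(p := f x)) ((f(x := p)) x') (?adj x') \<and> set (?adj x') \<subseteq> {..<Suc p} \<and>
     (\<forall>z. z \<in> (to(p := y)) ` set (?adj x') \<longleftrightarrow> (x', z) \<in> insert (x, y) A)" if x': "x' < n" for x'
  proof (cases "x' = x")
    case True
    have "set (adj x) \<subseteq> {..<Suc p}" using adj(2)[OF assms(3)] by auto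
    then show ?thesis using True adj(1,3)[OF assms(3)] c[OF assms(3)] t[OF assms(3)] assms(2)
      by (simp add: image_insert del: fun_upd_apply) auto
  next
    case False
    have "set (adj x') \<subseteq> {..<Suc p}" using adj(2)[OF x'] by auto
    then show ?thesis using False adj(1,3)[OF x'] c[OF x'] t[OF x'] by simp
  qed
  ultimately show ?thesis unfolding arcs_def by blast
qed

lemma arcs_empty: "arcs (\<lambda>_. 0) nxt to p {} n 0"
  unfolding arcs_def by (rule exI[of _ "\<lambda>_. []"]) simp

definition both_arcs :: "(nat \<times> nat) list \<Rightarrow> (nat \<times> nat) set" where
  "both_arcs es = set es \<union> {(y, x). (x, y) \<in> set es}"

lemma wpt_build:
  assumes n: "regs s rM = length es" "arrs s aFst = (\<lambda>_. 0)"
    and es: "\<And>x y. (x, y) \<in> set es \<Longrightarrow> x < n \<and> y < n"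
    and arr: "\<And>i. i < length es \<Longrightarrow> es ! i = (arrs s 0 i, arrs s 1 i)"
  shows "wpt build s (20 + 20 * length es) (\<lambda>s'. \<exists>p.
    arcs (arrs s' aFst) (arrs s' aNxt) (arrs s' aTo) p (both_arcs es) n (2 * length es))"
proof -
  define P where "P i s' \<longleftrightarrow> 0 < regs s' rP \<and>
    arcs (arrs s' aFst) (arrs s' aNxt) (arrs s' aTo) (regs s' rP)
      (both_arcs (take i es)) n (2 * i)" for i :: nat and s' :: state
  let ?s = "exec (Assign rI (Const 0)) (exec (Assign rP (Const 1)) s)"
  have "wpt (While (Less (Reg rI) (Reg rM)) build_body) ?s (18 + 20 * length es) (P (regs ?s rM))"
  proof (rule wpt_for)
    show "P (regs ?s rI) ?s" using arcs_empty n by (simp add: P_def both_arcs_def)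
    fix s' i assume ag: "agree build_body ?s s'" and r: "regs s' rI = i" and "i < regs ?s rM"
      and P: "P i s'"
    then have i: "i < length es" using n by simp
    define x y p where "x = arrs s 0 i" and "y = arrs s 1 i" and "p = regs s' rP"
    have A: "arrs s' 0 i = x" "arrs s' (Suc 0) i = y" "regs s' rI = i" "regs s' rP = p"
      using ag r by (simp_all add: agree_def build_body_def add_arc_def x_def y_def p_def)
    have e: "es ! i = (x, y)" using arr i by (simp add: x_def y_def)
    then have xy: "x < n" "y < n" using es i nth_mem by metis+
    have take: "both_arcs (take (Suc i) es) = insert (y, x) (insert (x, y) (both_arcs (take i es)))"
      using e by (auto simp: take_Suc_conv_app_nth[OF i] both_arcs_def)
    have a0: "arcs (arrs s' aFst) (arrs s' aNxt) (arrs s' aTo) p (both_arcs (take i es)) n (2 * i)"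
      and p: "0 < p" using P unfolding P_def p_def by auto
    note a2 = arcs_add[OF arcs_add[OF a0 p xy(1), of y] _ xy(2), of x]
    show "regs (exec build_body s') rI = Suc i \<and> P (Suc i) (exec build_body s')"
      using a2 take A by (simp add: P_def build_body_def add_arc_def)
  qed (use n in \<open>simp_all add: build_body_def add_arc_def\<close>)
  then have "wpt (While (Less (Reg rI) (Reg rM)) build_body) ?s (18 + 20 * length es)
      (\<lambda>s'. \<exists>p. arcs (arrs s' aFst) (arrs s' aNxt) (arrs s' aTo) p (both_arcs es) n (2 * length es))"
    by (rule wpt_mono) (use n in \<open>auto simp: P_def\<close>)
  then show ?thesis
    unfolding build_def
    by - (rule wpt_Seq_straight, simp, simp, rule wpt_Seq_straight, simp, simp, simp)
qed


section \<open>Breadth-first search\<close>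

text \<open>Popping a vertex and scanning a single arc are alternatives in one flat loop: the body
  stays \<open>straight\<close>, and one potential over vertices and arcs bounds the running
  time.\<close>

definition bfs_body :: com where
  "bfs_body = Cond (Equal (Reg rE) (Const 0))
     (Assign rC (Cell aQ (Reg rH)) ;; inc rH ;; Assign rE (Cell aFst (Reg rC)))
     (Assign rY (Cell aTo (Reg rE)) ;;
      Cond (Conj (Equal (Cell aRem (Reg rY)) (Const 0)) (Equal (Cell aVis (Reg rY)) (Const 0)))
        (Store aVis (Reg rY) (Const 1) ;; Store aPar (Reg rY) (Reg rC) ;;
         Store aQ (Reg rT) (Reg rY) ;; inc rT)
        Skip ;;
      Assign rE (Cell aNxt (Reg rE)))"

abbreviation (input) bfs_test :: test where
  "bfs_test \<equiv> Neg (Conj (Equal (Reg rE) (Const 0)) (Equal (Reg rH) (Reg rT)))"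

abbreviation (input) clear_vis_body :: com where
  "clear_vis_body \<equiv> Store aVis (Reg rI) (Const 0) ;; inc rI"

definition clear_vis :: com where
  "clear_vis = While (Less (Reg rI) (Reg rN)) clear_vis_body"

definition bfs_start :: com where
  "bfs_start = Store aVis (Reg rS) (Const 1) ;; Store aPar (Reg rS) (Reg rS) ;;
     Store aQ (Const 0) (Reg rS) ;; Assign rH (Const 0) ;; Assign rT (Const 1) ;;
     Assign rE (Const 0)"

definition bfs :: com where
  "bfs = Assign rI (Const 0) ;; clear_vis ;; bfs_start ;;
     While bfs_test bfs_body"

definition listed :: "nat set \<Rightarrow> (nat \<Rightarrow> nat) \<Rightarrow> (nat \<Rightarrow> nat) \<Rightarrow> nat \<Rightarrow> bool" where
  "listed K rk q t \<longleftrightarrow> 0 < t \<and> (\<forall>i<t. q i \<in> K \<and> rk (q i) = i) \<and> (\<forall>x\<in>K. rk x < t \<and> q (rk x) = x)"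

locale search =
  fixes E :: "nat set set" and n :: nat and C :: "nat set" and v :: nat
    and f nxt to :: "nat \<Rightarrow> nat" and adj :: "nat \<Rightarrow> nat list"
  assumes acyc: "forest E" and C_n: "C \<subseteq> {..<n}" and vC: "v \<in> C"
    and chain_adj: "\<And>x. x < n \<Longrightarrow> chain nxt (f x) (adj x)"
    and adj_iff: "\<And>x y. x < n \<Longrightarrow> y \<in> to ` set (adj x) \<longleftrightarrow> {x, y} \<in> E"
begin

text \<open>\<open>k\<close> is the potential: one plus the list length for every vertex not yet
  popped, and the unread rest \<open>l\<close> of the current list. \<open>P\<close> sends a queue
  position to that of the parent; its monotonicity is the breadth-first property that becomes
  \<open>mono\<close>. The last clause says what is still missing from the queue: only vertices that
  \<open>l\<close> will deliver.\<close>

definition inv :: "nat \<Rightarrow> nat \<Rightarrow> nat \<Rightarrow> nat \<Rightarrow> nat \<Rightarrow> (nat \<Rightarrow> nat) \<Rightarrow> (nat \<Rightarrow> nat) \<Rightarrow> (nat \<Rightarrow> nat) \<Rightarrow>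
    nat list \<Rightarrow> (nat \<Rightarrow> nat) \<Rightarrow> bool" where
  "inv k h t e cu q par vis l P \<longleftrightarrow>
     chain nxt e l \<and> k = (\<Sum>x\<in>{..<n} - q ` {..<h}. Suc (length (adj x))) + length l \<and>
     h \<le> t \<and> 0 < t \<and> (h = 0 \<longrightarrow> l = []) \<and> (0 < h \<longrightarrow> cu = q (h - 1)) \<and>
     (\<forall>c\<in>set l. {cu, to c} \<in> E) \<and> q 0 = v \<and> par v = v \<and>
     q ` {..<t} \<subseteq> C \<and> inj_on q {..<t} \<and> (\<forall>y<n. vis y \<noteq> 0 \<longleftrightarrow> y \<in> q ` {..<t}) \<and>
     (\<forall>i. 0 < i \<longrightarrow> i < t \<longrightarrow> P i < i \<and> P i < h \<and> par (q i) = q (P i) \<and> {q (P i), q i} \<in> E \<and>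
        (\<forall>j. 0 < j \<longrightarrow> j \<le> i \<longrightarrow> P j \<le> P i)) \<and>
     (\<forall>i<h. \<forall>y\<in>C. {q i, y} \<in> E \<longrightarrow> y \<in> q ` {..<t} \<or> i = h - 1 \<and> y \<in> to ` set l)"

lemma inv_close:
  assumes "inv k h t e cu q par vis l P" and "i < h" and "y \<in> C" and "{q i, y} \<in> E"
    and "i \<noteq> h - 1 \<or> y \<notin> to ` set l"
  shows "y \<in> q ` {..<t}"
proof -
  have "\<forall>i<h. \<forall>y\<in>C. {q i, y} \<in> E \<longrightarrow> y \<in> q ` {..<t} \<or> i = h - 1 \<and> y \<in> to ` set l"
    using assms(1) unfolding inv_def by (elim conjE)
  then show ?thesis using assms(2-5) by blast
qed

lemma inv_init:
  assumes "q 0 = v" and "par v = v" and "\<And>y. y < n \<Longrightarrow> vis y \<noteq> 0 \<longleftrightarrow> y = v"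
  shows "inv (\<Sum>x<n. Suc (length (adj x))) 0 1 0 cu q par vis [] P"
  using assms vC unfolding inv_def by (auto simp: lessThan_Suc)

text \<open>The popped vertex leaves the sum with one more than the length of its list, and this
  list becomes \<open>l\<close>; the potential drops by exactly one.\<close>

lemma inv_pop:
  assumes "inv k h t 0 cu q par vis l P" and "h \<noteq> t"
  shows "\<exists>k'<k. inv k' (Suc h) t (f (q h)) (q h) q par vis (adj (q h)) P"
proof -
  have l: "l = []" and h: "h < t" and qC: "q ` {..<t} \<subseteq> C" and injq: "inj_on q {..<t}"
    and k: "k = (\<Sum>x\<in>{..<n} - q ` {..<h}. Suc (length (adj x)))"
    using assms unfolding inv_def by auto
  have qn: "q h < n" using qC h C_n by auto
  have "q h \<notin> q ` {..<h}"
    using inj_onD[OF injq, of h] h by fastforce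
  then have "(\<Sum>x\<in>{..<n} - q ` {..<h}. Suc (length (adj x))) =
      Suc (length (adj (q h))) + (\<Sum>x\<in>{..<n} - q ` {..<h} - {q h}. Suc (length (adj x)))"
    using qn by (intro sum.remove) auto
  moreover have "{..<n} - q ` {..<h} - {q h} = {..<n} - q ` {..<Suc h}"
    by (auto simp: lessThan_Suc)
  ultimately have *: "k = Suc ((\<Sum>x\<in>{..<n} - q ` {..<Suc h}. Suc (length (adj x))) +
      length (adj (q h)))" (is "_ = Suc ?k")
    using k by simp
  have nb: "{q h, to c} \<in> E" if "c \<in> set (adj (q h))" for c
    using adj_iff[OF qn, of "to c"] that by blast
  have close: "y \<in> q ` {..<t} \<or> i = Suc h - 1 \<and> y \<in> to ` set (adj (q h))"
    if "i < Suc h" "y \<in> C" "{q i, y} \<in> E" for i y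
  proof (cases "i = h")
    case True
    then show ?thesis using that adj_iff[OF qn] by simp
  next
    case False
    then show ?thesis using inv_close[OF assms(1) _ that(2,3)] that(1) l by simp
  qed
  have "inv ?k (Suc h) t (f (q h)) (q h) q par vis (adj (q h)) P"
    using assms(1) h chain_adj[OF qn] nb close unfolding inv_def
    by (simp del: lessThan_iff) (meson less_Suc_eq)
  then show ?thesis using * by blast
qed

lemma inv_scan:
  assumes "inv k h t e cu q par vis l P" and "e \<noteq> 0"
  obtains k' l' where "k' < k" "l = e # l'" "0 < h" "{cu, to e} \<in> E"
    "to e \<notin> C \<or> to e \<in> q ` {..<t} \<Longrightarrow> inv k' h t (nxt e) cu q par vis l' P"
proof -
  obtain l' where l: "l = e # l'" using assms unfolding inv_def by (cases l) auto
  show ?thesis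
  proof
    show "k - 1 < k" using assms(1) l unfolding inv_def by simp
    show "0 < h" "{cu, to e} \<in> E" using assms(1) l unfolding inv_def by auto
    assume "to e \<notin> C \<or> to e \<in> q ` {..<t}"
    then have "\<forall>i<h. \<forall>y\<in>C. {q i, y} \<in> E \<longrightarrow> y \<in> q ` {..<t} \<or> i = h - 1 \<and> y \<in> to ` set l'"
      using inv_close[OF assms(1)] l by (metis image_insert insertE list.simps(15))
    then show "inv (k - 1) h t (nxt e) cu q par vis l' P"
      using assms(1) unfolding inv_def l by (simp, metis)
  qed (rule l)
qed

lemma inv_new:
  assumes inv: "inv k h t e cu q par vis l P" and "e \<noteq> 0" and y: "to e \<in> C"
    and new: "to e \<notin> q ` {..<t}"
  shows "\<exists>k'<k. \<exists>l' P'. inv k' h (Suc t) (nxt e) cu (q(t := to e)) (par(to e := cu))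
    (vis(to e := 1)) l' P'"
proof -
  define q' where "q' = q(t := to e)"
  have q': "q' i = q i" if "i < t" for i using that by (simp add: q'_def)
  have q't: "q' t = to e" by (simp add: q'_def)
  have im: "q' ` {..<i} = q ` {..<i}" if "i \<le> t" for i
    using that q' by (intro image_cong) auto
  have imS: "q' ` {..<Suc t} = insert (to e) (q ` {..<t})"
    using im[of t] q't by (simp add: lessThan_Suc)
  obtain l' where l: "l = e # l'" using assms unfolding inv_def by (cases l) auto
  have h: "0 < h" "h \<le> t" "0 < t" using inv l unfolding inv_def by auto
  have cu: "cu = q (h - 1)" using inv h unfolding inv_def by auto
  have cu': "cu = q' (h - 1)" using q' h cu by simp
  have e: "{cu, to e} \<in> E" using inv l unfolding inv_def by auto
  \<comment> \<open>The parent of the new vertex is the one popped last. All earlier parent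
    positions are below \<open>h\<close>, so monotonicity is preserved.\<close>
  define P' where "P' = P(t := h - 1)"
  have injq: "inj_on q' {..<Suc t}"
  proof -
    have "inj_on q {..<t}" using inv unfolding inv_def by blast
    then have "inj_on q' {..<t}" using q' unfolding inj_on_def by simp
    then show ?thesis using new im[of t] q't unfolding lessThan_Suc by simp
  qed
  have par': "P' i < i \<and> P' i < h \<and> (par(to e := cu)) (q' i) = q' (P' i) \<and> {q' (P' i), q' i} \<in> E \<and>
        (\<forall>j. 0 < j \<longrightarrow> j \<le> i \<longrightarrow> P' j \<le> P' i)" if i: "0 < i" "i < Suc t" for i
  proof (cases "i = t")
    case True
    have Ph: "P j < h" if "0 < j" "j < t" for j
      using inv that unfolding inv_def by simp
    have "P' j \<le> h - 1" if j: "0 < j" "j \<le> t" for j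
    proof (cases "j = t")
      case False
      then show ?thesis using Ph[of j] j by (simp add: P'_def)
    qed (simp add: P'_def)
    then show ?thesis using True h cu' q't e by (simp add: P'_def)
  next
    case False
    then have it: "i < t" using i by simp
    then have p: "P i < i" "P i < h" "par (q i) = q (P i)" "{q (P i), q i} \<in> E"
      "\<And>j. 0 < j \<Longrightarrow> j \<le> i \<Longrightarrow> P j \<le> P i"
      using inv i unfolding inv_def by auto
    have "q i \<noteq> to e" using new it by (metis imageI lessThan_iff)
    then show ?thesis using p it q'[OF it] q'[of "P i"] by (simp add: P'_def)
  qed
  have v: "to e \<noteq> v" using new inv h unfolding inv_def by force
  have vis: "\<forall>y<n. (vis(to e := 1)) y \<noteq> 0 \<longleftrightarrow> y \<in> q' ` {..<Suc t}"
    using inv imS unfolding inv_def by auto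
  have close: "y \<in> q' ` {..<Suc t} \<or> i = h - 1 \<and> y \<in> to ` set l'"
    if "i < h" "y \<in> C" "{q' i, y} \<in> E" for i y
  proof (cases "y = to e")
    case False
    have "y \<in> q ` {..<t}" if "i \<noteq> h - 1 \<or> y \<notin> to ` set l'"
      using inv_close[OF inv, of i y] \<open>i < h\<close> \<open>y \<in> C\<close> \<open>{q' i, y} \<in> E\<close> q'[of i] h l False that
      by simp
    then show ?thesis unfolding imS by blast
  qed (simp add: imS)
  have "inv (k - 1) h (Suc t) (nxt e) cu q' (par(to e := cu)) (vis(to e := 1)) l' P'"
    unfolding inv_def
  proof (intro conjI)
    show "chain nxt (nxt e) l'" using inv unfolding inv_def l by simp
    show "k - 1 = (\<Sum>x\<in>{..<n} - q' ` {..<h}. Suc (length (adj x))) + length l'"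
      using inv h unfolding inv_def l by (simp add: im)
    show "\<forall>c\<in>set l'. {cu, to c} \<in> E" using inv unfolding inv_def l by (simp, metis)
    show "q' 0 = v" using inv h q' unfolding inv_def by simp
    show "(par(to e := cu)) v = v" using inv v unfolding inv_def by simp
    show "q' ` {..<Suc t} \<subseteq> C" using inv y unfolding imS inv_def by simp
    show "\<forall>i. 0 < i \<longrightarrow> i < Suc t \<longrightarrow> P' i < i \<and> P' i < h \<and>
        (par(to e := cu)) (q' i) = q' (P' i) \<and> {q' (P' i), q' i} \<in> E \<and>
        (\<forall>j. 0 < j \<longrightarrow> j \<le> i \<longrightarrow> P' j \<le> P' i)"
      by (intro allI impI par')
    show "\<forall>i<h. \<forall>y\<in>C. {q' i, y} \<in> E \<longrightarrow>
        y \<in> q' ` {..<Suc t} \<or> i = h - 1 \<and> y \<in> to ` set l'"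
      by (intro allI impI ballI close)
    show "h \<le> Suc t" "0 < Suc t" "h = 0 \<longrightarrow> l' = []" "0 < h \<longrightarrow> cu = q' (h - 1)"
      using h cu' by simp_all
  qed (rule injq, rule vis)
  moreover have "k - 1 < k" using inv unfolding inv_def l by simp
  ultimately show ?thesis unfolding q'_def by blast
qed

lemma inv_rooted:
  assumes inv: "inv k t t 0 cu q par vis l P"
  shows "rooted E C (q ` {..<t}) v par (inv_into {..<t} q)"
    and "listed (q ` {..<t}) (inv_into {..<t} q) q t"
proof -
  let ?rk = "inv_into {..<t} q"
  have inj: "inj_on q {..<t}" and t: "0 < t" and q0: "q 0 = v" and l: "l = []"
    using inv unfolding inv_def by auto
  have rk: "?rk (q i) = i" if "i < t" for i using inj that by simp
  have P: "P i < i" "par (q i) = q (P i)" "{q (P i), q i} \<in> E"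
      "\<And>j. 0 < j \<Longrightarrow> j \<le> i \<Longrightarrow> P j \<le> P i" if "0 < i" "i < t" for i
    using inv that unfolding inv_def by auto
  have pos: "0 < i" if "q i \<noteq> v" for i using that q0 by (cases i) auto
  show "rooted E C (q ` {..<t}) v par ?rk"
  proof
    show "v \<in> q ` {..<t}" using t q0 by (metis imageI lessThan_iff)
    show "par v = v" "q ` {..<t} \<subseteq> C" using inv unfolding inv_def by auto
    show "inj_on ?rk (q ` {..<t})" by (rule inj_on_inv_into) simp
    show "y \<in> q ` {..<t}" if "x \<in> q ` {..<t}" "y \<in> C" "{x, y} \<in> E" for x y
      using inv that l unfolding inv_def by auto
    show "par x \<in> q ` {..<t} \<and> {par x, x} \<in> E \<and> ?rk (par x) < ?rk x"
      if x: "x \<in> q ` {..<t}" "x \<noteq> v" for x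
    proof -
      obtain i where i: "i < t" "x = q i" using x by blast
      then have "0 < i" using pos x by blast
      note p = P[OF this i(1)]
      have "P i < t" using p i by simp
      then show ?thesis using p i rk by auto
    qed
    show "?rk (par x) \<le> ?rk (par y)" if xy: "x \<in> q ` {..<t}" "y \<in> q ` {..<t}" "x \<noteq> v" "y \<noteq> v"
      "?rk x \<le> ?rk y" for x y
    proof -
      obtain i j where i: "i < t" "x = q i" and j: "j < t" "y = q j" using xy(1,2) by blast
      have 0: "0 < i" "0 < j" using pos xy(3,4) i j by blast+
      have "i \<le> j" using xy(5) rk i j by simp
      then have "P i \<le> P j" using P(4)[OF 0(2) j(1) 0(1)] by blast
      moreover have "P i < t" "P j < t" using P(1)[OF 0(1) i(1)] P(1)[OF 0(2) j(1)] i j by auto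
      ultimately show ?thesis
        using P(2)[OF 0(1) i(1)] P(2)[OF 0(2) j(1)] rk i j by simp
    qed
  qed (rule acyc)
  show "listed (q ` {..<t}) ?rk q t"
    using t rk unfolding listed_def by auto
qed

end

definition bfs_post :: "nat set set \<Rightarrow> nat set \<Rightarrow> nat \<Rightarrow> state \<Rightarrow> bool" where
  "bfs_post E C v s \<longleftrightarrow>
     (\<exists>K rk. rooted E C K v (arrs s aPar) rk \<and> listed K rk (arrs s aQ) (regs s rT))"

lemma wpt_bfs:
  assumes "forest E" and E_n: "\<And>x y. {x, y} \<in> E \<Longrightarrow> y < n"
    and arcs: "arcs (arrs s aFst) (arrs s aNxt) (arrs s aTo) p {(x, y). {x, y} \<in> E} n m"
    and n: "regs s rN = n" and C: "C = {i. i < n \<and> arrs s aRem i = 0}"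
    and v: "regs s rS = v" "v \<in> C"
  shows "wpt bfs s (30 + 30 * (n + m)) (bfs_post E C v)"
proof -
  obtain adj where adj: "\<And>x. x < n \<Longrightarrow> chain (arrs s aNxt) (arrs s aFst x) (adj x)"
    "\<And>x y. x < n \<Longrightarrow> y \<in> arrs s aTo ` set (adj x) \<longleftrightarrow> {x, y} \<in> E"
    "(\<Sum>x<n. length (adj x)) \<le> m"
    using arcs unfolding arcs_def by (metis case_prodI case_prodD mem_Collect_eq)
  interpret search E n C v "arrs s aFst" "arrs s aNxt" "arrs s aTo" adj
    by unfold_locales (use assms adj in auto)
  define k0 where "k0 = (\<Sum>x<n. Suc (length (adj x)))"
  have k0: "k0 \<le> n + m" using adj(3) by (simp add: k0_def sum_Suc)
  define P where "P k s' \<longleftrightarrow> (\<exists>l Pa. inv k (regs s' rH) (regs s' rT) (regs s' rE) (regs s' rC)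
    (arrs s' aQ) (arrs s' aPar) (arrs s' aVis) l Pa)" for k and s' :: state
  show ?thesis
    unfolding bfs_def
  proof (rule wpt_Seq_straight, simp, simp)
    let ?s = "exec (Assign rI (Const 0)) s"
    define P0 where "P0 i s' \<longleftrightarrow> (\<forall>j<i. arrs s' aVis j = 0)" for i :: nat and s' :: state
    have "wpt clear_vis ?s (1 + n * (1 + 2)) (P0 (regs ?s rN))"
      unfolding clear_vis_def
      by (rule wpt_for) (use n in \<open>auto simp: P0_def less_Suc_eq\<close>)
    then have 1: "wpt clear_vis ?s (1 + n * (1 + 2)) (\<lambda>s'. \<forall>i<n. arrs s' aVis i = 0)"
      by (rule wpt_mono) (use n in \<open>simp_all add: P0_def\<close>)
    show "wpt (clear_vis ;; bfs_start ;;
      While bfs_test bfs_body) ?s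
      (30 + 30 * (n + m) - cost (Assign rI (Const 0)))
      (bfs_post E C v)"
    proof (rule wpt_Seq_agree[OF 1, where U = "25 + 25 * (n + m)"])
      fix s1 assume vis: "\<forall>i < n. arrs s1 aVis i = 0" and "agree clear_vis ?s s1"
      then have ag: "regs s1 rS = v" "regs s1 rN = n" "arrs s1 aFst = arrs s aFst"
        "arrs s1 aNxt = arrs s aNxt" "arrs s1 aTo = arrs s aTo" "arrs s1 aRem = arrs s aRem"
        using n v by (simp_all add: agree_def clear_vis_def)
      show "wpt (bfs_start ;;
        While bfs_test bfs_body) s1
        (25 + 25 * (n + m))
        (bfs_post E C v)"
      proof (rule wpt_Seq_straight, simp add: bfs_start_def, simp add: bfs_start_def,
          rule wpt_While[where P = P])
        have "inv k0 0 1 0 (regs s1 rC) ((arrs s1 aQ)(0 := v)) ((arrs s1 aPar)(v := v))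
          ((arrs s1 aVis)(v := 1)) [] (\<lambda>_. 0)"
          unfolding k0_def using vis by (intro inv_init) auto
        then show "P k0 (exec bfs_start s1)"
          unfolding P_def using ag by (auto simp: bfs_start_def)
      next
        fix k s' assume "agree bfs_body (exec bfs_start s1) s'" and P: "P k s'"
          and b: "eval_test bfs_test s'"
        then have ag': "arrs s' aFst = arrs s aFst"
          "arrs s' aNxt = arrs s aNxt" "arrs s' aTo = arrs s aTo" "arrs s' aRem = arrs s aRem"
          using ag by (simp_all add: agree_def bfs_body_def bfs_start_def)
        obtain l Pa where i: "inv k (regs s' rH) (regs s' rT) (regs s' rE) (regs s' rC)
            (arrs s' aQ) (arrs s' aPar) (arrs s' aVis) l Pa" using P unfolding P_def by blast
        have "\<exists>k'<k. P k' (exec bfs_body s')"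
        proof (cases "regs s' rE = 0")
          case True
          then have "\<exists>k'<k. inv k' (Suc (regs s' rH)) (regs s' rT) (arrs s aFst (arrs s' aQ (regs s' rH)))
              (arrs s' aQ (regs s' rH)) (arrs s' aQ) (arrs s' aPar) (arrs s' aVis)
              (adj (arrs s' aQ (regs s' rH))) Pa"
            using inv_pop i b by simp
          then show ?thesis using True ag' unfolding P_def by (auto simp: bfs_body_def)
        next
          case False
          define y where "y = arrs s aTo (regs s' rE)"
          obtain k' l' where k': "k' < k" "{regs s' rC, y} \<in> E"
            "y \<notin> C \<or> y \<in> arrs s' aQ ` {..<regs s' rT} \<Longrightarrow> inv k' (regs s' rH) (regs s' rT)
              (arrs s aNxt (regs s' rE)) (regs s' rC)
              (arrs s' aQ) (arrs s' aPar) (arrs s' aVis) l' Pa"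
            using inv_scan[OF i False] unfolding y_def by metis
          have yn: "y < n" using E_n k' by blast
          have yC: "y \<in> C \<longleftrightarrow> arrs s' aRem y = 0" using yn C ag' by simp
          have yv: "y \<in> arrs s' aQ ` {..<regs s' rT} \<longleftrightarrow> arrs s' aVis y \<noteq> 0"
            using i yn unfolding inv_def by blast
          show ?thesis
          proof (cases "y \<in> C \<and> y \<notin> arrs s' aQ ` {..<regs s' rT}")
            case True
            then show ?thesis
              using inv_new[OF i False, folded y_def] False yC yv ag' unfolding P_def
              by (simp add: bfs_body_def y_def[symmetric])
          next
            case F: False
            then have "P k' (exec bfs_body s')"
              using k'(3) False yC yv ag' unfolding P_def
              by (auto simp add: bfs_body_def y_def[symmetric])
            then show ?thesis using k'(1) by blast
          qed
        qed
        then show "wpt bfs_body s' 15 (\<lambda>s''. \<exists>k'<k. P k' s'')"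
          by (rule wpt_straight) (simp_all add: bfs_body_def)
      next
        fix k s' assume "P k s'"
          and "\<not> eval_test bfs_test s'"
        then show "bfs_post E C v s'"
          unfolding P_def bfs_post_def using inv_rooted by fastforce
      qed (use k0 in \<open>simp add: bfs_start_def\<close>)
    qed simp
  qed
qed


section \<open>Fetching a token\<close>

definition opt :: "nat \<Rightarrow> nat option" where
  "opt k = (case k of 0 \<Rightarrow> None | Suc y \<Rightarrow> Some y)"

lemma opt_simps [simp]: "opt 0 = None" "opt (Suc y) = Some y" "opt k = None \<longleftrightarrow> k = 0"
  "opt k = Some y \<longleftrightarrow> k = Suc y"
  by (simp_all add: opt_def split: nat.splits)

locale fetch_input = rooted E C K r par rk
  for E :: "nat set set" and C K r par rk +
  fixes I :: "nat set" and n :: nat and q :: "nat \<Rightarrow> nat" and t :: nat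
  assumes indep_I: "indep E I"
    and bound: "\<And>x y. x \<in> K \<Longrightarrow> y \<in> I \<Longrightarrow> {x, y} \<in> E \<Longrightarrow> y \<in> K"
    and K_n: "K \<subseteq> {..<n}" and lst: "listed K rk q t"
begin

lemma q_K: "i < t \<Longrightarrow> q i \<in> K" and rk_q: "i < t \<Longrightarrow> rk (q i) = i"
  and rk_t: "x \<in> K \<Longrightarrow> rk x < t" and q_rk: "x \<in> K \<Longrightarrow> q (rk x) = x" and t_pos: "0 < t"
  using lst unfolding listed_def by auto

lemma rk_0: "x \<in> K \<Longrightarrow> rk x = 0 \<longleftrightarrow> x = r"
proof -
  assume x: "x \<in> K"
  have "q 0 = r"
    using par[OF q_K[OF t_pos]] rk_q[OF t_pos] by fastforce
  then have "rk r = 0" using rk_q[OF t_pos] by simp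
  then show ?thesis using q_rk[OF x] \<open>q 0 = r\<close> by auto
qed

lemma rk_le_iff: "x \<in> K \<Longrightarrow> i < t \<Longrightarrow> i \<le> rk x \<longleftrightarrow> Suc i \<le> rk x \<or> x = q i"
  using q_rk[of x] rk_q[of i] by (cases "rk x = i") auto

lemma rk_less_iff: "x \<in> K \<Longrightarrow> i < t \<Longrightarrow> rk x < Suc i \<longleftrightarrow> rk x < i \<or> x = q i"
  using q_rk[of x] rk_q[of i] by (cases "rk x = i") auto

lemma child_q: "0 < i \<Longrightarrow> i < t \<Longrightarrow> child (q i) (par (q i))"
  using child_par[OF q_K] rk_0[OF q_K] rk_q by fastforce

section \<open>The bottom-up pass\<close>

definition bad_child :: "nat \<Rightarrow> (nat \<Rightarrow> nat) \<Rightarrow> nat \<Rightarrow> nat \<Rightarrow> bool" where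
  "bad_child i ch x w \<longleftrightarrow> child x w \<and> i \<le> rk x \<and> x \<in> I \<and> ch x = 0"

text \<open>The tables after the queue positions from \<open>i\<close> upwards have been processed.
  \<open>bad w\<close> remembers one bad child and \<open>two w\<close> only whether there is a
  second one; nothing more is needed later.\<close>

definition down_at :: "nat \<Rightarrow> (nat \<Rightarrow> nat) \<Rightarrow> (nat \<Rightarrow> nat) \<Rightarrow> (nat \<Rightarrow> nat) \<Rightarrow> nat \<Rightarrow> bool" where
  "down_at i ch bad two w \<longleftrightarrow>
     (\<forall>y. ch w = Suc y \<longrightarrow> child y w \<and> i \<le> rk y \<and> bad y = 0) \<and>
     (ch w = 0 \<longrightarrow> (\<forall>y. child y w \<longrightarrow> i \<le> rk y \<longrightarrow> bad y \<noteq> 0)) \<and>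
     (\<forall>x. bad w = Suc x \<longrightarrow> bad_child i ch x w) \<and>
     (bad w = 0 \<longrightarrow> (\<forall>x. \<not> bad_child i ch x w)) \<and>
     (two w \<noteq> 0 \<longleftrightarrow> (\<exists>x x'. x \<noteq> x' \<and> bad_child i ch x w \<and> bad_child i ch x' w))"

definition down_inv :: "nat \<Rightarrow> (nat \<Rightarrow> nat) \<Rightarrow> (nat \<Rightarrow> nat) \<Rightarrow> (nat \<Rightarrow> nat) \<Rightarrow> bool" where
  "down_inv i ch bad two \<longleftrightarrow> (\<forall>w\<in>K. down_at i ch bad two w)"

lemma down_init:
  assumes "\<And>x. x < n \<Longrightarrow> ch x = 0 \<and> bad x = 0 \<and> two x = 0"
  shows "down_inv t ch bad two"
  unfolding down_inv_def down_at_def bad_child_def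
  using assms K_n rk_t childD(1) by (auto simp: not_le subset_iff)

lemma down_step:
  assumes inv: "down_inv (Suc i) ch bad two" and i: "0 < i" "i < t"
    and y: "y = q i" and w: "w = par y"
    and ch': "ch' = (if bad y = 0 then ch(w := Suc y) else ch)"
    and bad': "bad' = (if y \<in> I \<and> ch y = 0 \<and> bad w = 0 then bad(w := Suc y) else bad)"
    and two': "two' = (if y \<in> I \<and> ch y = 0 \<and> bad w \<noteq> 0 then two(w := 1) else two)"
  shows "down_inv i ch' bad' two'"
proof -
  have c: "child y w" using child_q i y w by simp
  have rky: "rk y = i" using rk_q i y by simp
  have rkw: "rk w < i" using childD(7)[OF c] rky by simp
  \<comment> \<open>Only entries of the parent \<open>w\<close> change, and its rank is below
    \<open>i\<close>; the entries of \<open>y\<close> and of everything processed before are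
    final.\<close>
  have old: "ch' x = ch x" "bad' x = bad x" if "i \<le> rk x" for x
    using that rkw by (auto simp: ch' bad')
  have le: "i \<le> rk x \<longleftrightarrow> Suc i \<le> rk x \<or> x = y" if "child x v" for x v
    using rk_le_iff[OF childD(1)[OF that] i(2)] y by simp
  have bc: "bad_child i ch' x v \<longleftrightarrow> bad_child (Suc i) ch x v \<or> x = y \<and> v = w \<and> y \<in> I \<and> ch y = 0"
    for x v
    using le[of x v] old(1)[of x] rky c childD(3)[of x v] w unfolding bad_child_def by auto
  have noty: "\<not> bad_child (Suc i) ch y v" for v using rky unfolding bad_child_def by simp
  show ?thesis
    unfolding down_inv_def
  proof (intro ballI)
    fix v assume v: "v \<in> K"
    have I1: "\<And>y. ch v = Suc y \<Longrightarrow> child y v \<and> Suc i \<le> rk y \<and> bad y = 0"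
      and I2: "\<And>y. ch v = 0 \<Longrightarrow> child y v \<Longrightarrow> Suc i \<le> rk y \<Longrightarrow> bad y \<noteq> 0"
      and I3: "\<And>x. bad v = Suc x \<Longrightarrow> bad_child (Suc i) ch x v"
      and I4: "\<And>x. bad v = 0 \<Longrightarrow> \<not> bad_child (Suc i) ch x v"
      and I5: "two v \<noteq> 0 \<longleftrightarrow>
        (\<exists>x x'. x \<noteq> x' \<and> bad_child (Suc i) ch x v \<and> bad_child (Suc i) ch x' v)"
      using inv v unfolding down_inv_def down_at_def by blast+
    have "child x v \<and> i \<le> rk x \<and> bad' x = 0" if "ch' v = Suc x" for x
    proof (cases "v = w \<and> bad y = 0")
      case True
      then have "x = y" using that by (simp add: ch')
      then show ?thesis using True c rky old(2)[of y] by simp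
    next
      case False
      then have "ch v = Suc x" using that by (auto simp: ch' split: if_splits)
      then show ?thesis using I1 old(2)[of x] by fastforce
    qed
    moreover have "bad' x \<noteq> 0" if "ch' v = 0" "child x v" "i \<le> rk x" for x
    proof -
      have n: "\<not> (v = w \<and> bad y = 0)" and ch0: "ch v = 0"
        using that(1) by (auto simp: ch' split: if_splits)
      show ?thesis
      proof (cases "x = y")
        case True
        then have "v = w" using that(2) c childD(3) by blast
        then show ?thesis using n True old(2)[OF that(3)] by simp
      next
        case False
        then show ?thesis using I2[OF ch0 that(2)] le[OF that(2)] that(3) old(2)[OF that(3)] by simp
      qed
    qed
    moreover have "bad_child i ch' x v" if "bad' v = Suc x" for x
      using that I3[of x] unfolding bc by (auto simp: bad' split: if_splits)
    moreover have "\<not> bad_child i ch' x v" if "bad' v = 0" for x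
      using that I4[of x] unfolding bc by (auto simp: bad' split: if_splits)
    moreover have "two' v \<noteq> 0 \<longleftrightarrow>
        (\<exists>x x'. x \<noteq> x' \<and> bad_child i ch' x v \<and> bad_child i ch' x' v)"
    proof (cases "v = w \<and> y \<in> I \<and> ch y = 0")
      case False
      then have "two' v = two v" by (auto simp: two')
      then show ?thesis using I5 False unfolding bc by auto
    next
      case True
      show ?thesis
      proof (cases "bad w")
        case 0
        then show ?thesis using True I4 I5 unfolding bc two' by auto
      next
        case (Suc x)
        then have "bad_child (Suc i) ch x v" using I3 True by blast
        moreover have "x \<noteq> y" using noty calculation by blast
        ultimately show ?thesis using Suc True unfolding bc two' by auto
      qed
    qed
    ultimately show "down_at i ch' bad' two' v"
      unfolding down_at_def by blast
  qed
qed

text \<open>\<open>F\<close> keeps the first unblocked token in visiting order, hence a nearest one.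
  Entries of vertices not yet visited are required to be 0, on which the treatment of the root
  relies.\<close>

definition blk_inv :: "nat \<Rightarrow> (nat \<Rightarrow> nat) \<Rightarrow> (nat \<Rightarrow> nat) \<Rightarrow> nat \<Rightarrow> bool" where
  "blk_inv i two blk F \<longleftrightarrow>
     (\<forall>x\<in>K. if rk x < i then blk x \<noteq> 0 \<longleftrightarrow> two x \<noteq> 0 \<or> x \<noteq> r \<and> blk (par x) \<noteq> 0 else blk x = 0) \<and>
     (F = 0 \<longrightarrow> (\<forall>x\<in>K \<inter> I. rk x < i \<longrightarrow> blk x \<noteq> 0)) \<and>
     (\<forall>w. F = Suc w \<longrightarrow> w \<in> K \<inter> I \<and> rk w < i \<and> blk w = 0 \<and>
        (\<forall>x\<in>K \<inter> I. rk x < i \<longrightarrow> blk x = 0 \<longrightarrow> rk w \<le> rk x))"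

lemma blk_init: "(\<And>x. x < n \<Longrightarrow> blk x = 0) \<Longrightarrow> blk_inv 0 two blk 0"
  using K_n unfolding blk_inv_def by auto

lemma blk_step:
  assumes inv: "blk_inv i two blk F" and i: "i < t" and y: "y = q i"
    and blk': "blk' = (if two y = 0 \<and> blk (par y) = 0 then blk else blk(y := 1))"
    and F': "F' = (if F = 0 \<and> y \<in> I \<and> blk' y = 0 then Suc y else F)"
  shows "blk_inv (Suc i) two blk' F'"
proof -
  have yK: "y \<in> K" and rky: "rk y = i" using q_K rk_q i y by auto
  have less: "rk x < Suc i \<longleftrightarrow> rk x < i \<or> x = y" if "x \<in> K" for x
    using rk_less_iff[OF that i] y by simp
  have I1: "\<And>x. x \<in> K \<Longrightarrow> rk x < i \<Longrightarrow> blk x \<noteq> 0 \<longleftrightarrow> two x \<noteq> 0 \<or> x \<noteq> r \<and> blk (par x) \<noteq> 0"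
    and I2: "\<And>x. x \<in> K \<Longrightarrow> \<not> rk x < i \<Longrightarrow> blk x = 0"
    and I3: "\<And>x. F = 0 \<Longrightarrow> x \<in> K \<inter> I \<Longrightarrow> rk x < i \<Longrightarrow> blk x \<noteq> 0"
    and I4: "\<And>w. F = Suc w \<Longrightarrow> w \<in> K \<inter> I \<and> rk w < i \<and> blk w = 0 \<and>
        (\<forall>x\<in>K \<inter> I. rk x < i \<longrightarrow> blk x = 0 \<longrightarrow> rk w \<le> rk x)"
    using inv unfolding blk_inv_def by (metis (full_types))+
  have old: "blk' x = blk x" if "x \<noteq> y" for x using that by (simp add: blk')
  have parK: "par x \<in> K \<and> par x \<noteq> y" if "x \<in> K" "rk x < Suc i" "x \<noteq> r" for x
    using par[OF that(1,3)] that(2) rky by auto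
  have by0: "blk y = 0" using I2 yK rky by simp
  \<comment> \<open>At the root the test reads the root's own entry, still 0, because
    \<open>par r = r\<close>; the program needs no special case.\<close>
  have blk_r: "blk (par r) = 0" if "r = y" using that par_r by0 by simp
  have 1: "blk' x \<noteq> 0 \<longleftrightarrow> two x \<noteq> 0 \<or> x \<noteq> r \<and> blk' (par x) \<noteq> 0" if x: "x \<in> K" "rk x < Suc i" for x
  proof (cases "x = y")
    case True
    have "blk' y \<noteq> 0 \<longleftrightarrow> two y \<noteq> 0 \<or> blk (par y) \<noteq> 0" using by0 by (simp add: blk')
    moreover have "blk' (par y) = blk (par y)" if "y \<noteq> r"
      using parK[of y] that x True old by simp
    moreover have "y = r \<Longrightarrow> blk (par y) = 0" using blk_r by simp
    ultimately show ?thesis using True by (metis (full_types))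
  next
    case False
    then have "rk x < i" using x less by blast
    then show ?thesis using I1[OF x(1)] old[OF False] parK[OF x] old by auto
  qed
  have 2: "blk' x = 0" if "x \<in> K" "\<not> rk x < Suc i" for x
    using that I2 old rky by (cases "x = y") auto
  have 3: "blk' x \<noteq> 0" if "F' = 0" "x \<in> K \<inter> I" "rk x < Suc i" for x
    using that I3[of x] old[of x] less[of x] F' by (cases "x = y") (auto split: if_splits)
  have 4: "w \<in> K \<inter> I \<and> rk w < Suc i \<and> blk' w = 0 \<and>
        (\<forall>x\<in>K \<inter> I. rk x < Suc i \<longrightarrow> blk' x = 0 \<longrightarrow> rk w \<le> rk x)" if Fw: "F' = Suc w" for w
  proof (cases "F = 0 \<and> y \<in> I \<and> blk' y = 0")
    case True
    then have "w = y" using Fw F' by simp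
    moreover have "rk y \<le> rk x" if "x \<in> K \<inter> I" "rk x < Suc i" "blk' x = 0" for x
      using that True I3[of x] old[of x] less[of x] rky by (cases "x = y") auto
    ultimately show ?thesis using True yK rky by auto
  next
    case False
    then have "F = Suc w" using Fw F' by (simp split: if_splits)
    note w = I4[OF this]
    have "w \<noteq> y" using w rky by auto
    moreover have "rk w \<le> rk x" if "x \<in> K \<inter> I" "rk x < Suc i" "blk' x = 0" for x
      using that w old[of x] less[of x] rky by (cases "x = y") auto
    ultimately show ?thesis using w old by simp
  qed
  show ?thesis
    unfolding blk_inv_def using 1 2 3 4 by simp
qed

text \<open>The recursion for \<open>N\<close> refers only to the grandparent, whose entry is
  already final, so one pass in visiting order solves it.\<close>

definition need_inv :: "nat \<Rightarrow> (nat \<Rightarrow> nat) \<Rightarrow> nat \<Rightarrow> nat \<Rightarrow> (nat \<Rightarrow> nat) \<Rightarrow> bool" where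
  "need_inv i ch z k need \<longleftrightarrow> (\<forall>x\<in>K. if rk x < i
     then need x \<noteq> 0 \<longleftrightarrow> x \<noteq> r \<and> x \<in> I \<and> (par x = z \<and> x \<noteq> k \<or>
       need (par (par x)) \<noteq> 0 \<and> ch (par (par x)) = Suc (par x))
     else need x = 0)"

lemma need_init: "(\<And>x. x < n \<Longrightarrow> need x = 0) \<Longrightarrow> need_inv 1 ch z k need"
  using K_n rk_0 unfolding need_inv_def by auto

lemma need_step:
  assumes inv: "need_inv i ch z k need" and i: "0 < i" "i < t" and y: "y = q i"
    and need': "need' = (if y \<in> I \<and> (par y = z \<and> y \<noteq> k \<or>
       need (par (par y)) \<noteq> 0 \<and> ch (par (par y)) = Suc (par y)) then need(y := 1) else need)"
  shows "need_inv (Suc i) ch z k need'"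
proof -
  have yK: "y \<in> K" and rky: "rk y = i" using q_K rk_q i y by auto
  have yr: "y \<noteq> r" using rk_0[OF yK] rky i by simp
  have less: "rk x < Suc i \<longleftrightarrow> rk x < i \<or> x = y" if "x \<in> K" for x
    using rk_less_iff[OF that i(2)] y by simp
  have by0: "need y = 0" using inv yK rky unfolding need_inv_def by simp
  have old: "need' x = need x" if "x \<noteq> y" for x using that by (simp add: need')
  have pp: "need' (par (par x)) = need (par (par x))" if "x \<in> K" "x \<noteq> r" "rk x < Suc i" for x
  proof -
    have "par x \<in> K" "rk (par x) < rk x" using par[OF that(1,2)] by auto
    then have "rk (par (par x)) < i"
      using par[of "par x"] par_r that(3) by (cases "par x = r") auto
    then have "par (par x) \<noteq> y" using rky by auto
    then show ?thesis using old by simp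
  qed
  show ?thesis
    unfolding need_inv_def
  proof
    fix x assume x: "x \<in> K"
    show "if rk x < Suc i
     then need' x \<noteq> 0 \<longleftrightarrow> x \<noteq> r \<and> x \<in> I \<and> (par x = z \<and> x \<noteq> k \<or>
       need' (par (par x)) \<noteq> 0 \<and> ch (par (par x)) = Suc (par x))
     else need' x = 0"
    proof (cases "x = y")
      case True
      then show ?thesis using pp[OF yK yr] rky yr by0 by (simp add: need')
    next
      case False
      then have xi: "rk x < Suc i \<longleftrightarrow> rk x < i" using less x by blast
      show ?thesis
      proof (cases "x = r")
        case True
        then show ?thesis using inv x old[OF False] unfolding need_inv_def xi by auto
      next
        case xr: False
        then show ?thesis
          using inv x old[OF False] pp[OF x xr] unfolding need_inv_def xi by auto
      qed
    qed
  qed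
qed

section \<open>The computed tables satisfy the specification\<close>

lemma fetch_down:
  assumes down: "down_inv 1 ch bad two" and blk: "blk_inv t two blk F"
  shows "fetch E C K r par rk I (\<lambda>x. opt (ch x)) (\<lambda>x. two x \<noteq> 0) (\<lambda>x. blk x \<noteq> 0)"
proof -
  have rk1: "1 \<le> rk x" if "child x y" for x y
    using rk_0[OF childD(1)[OF that]] childD(2)[OF that] by simp
  have bc: "bad_child 1 ch x w \<longleftrightarrow> child x w \<and> x \<in> I \<and> ch x = 0" for x w
    using rk1 unfolding bad_child_def by blast
  have bK: "blk x \<noteq> 0 \<longleftrightarrow> two x \<noteq> 0 \<or> x \<noteq> r \<and> blk (par x) \<noteq> 0" if "x \<in> K" for x
    using blk that rk_t[OF that] unfolding blk_inv_def by auto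
  have 1: "child y w \<and> bad y = 0" if "w \<in> K" "ch w = Suc y" for w y
    using down that unfolding down_inv_def down_at_def by blast
  have 2: "bad y \<noteq> 0" if "child y w" "ch w = 0" for w y
    using down that childD(4)[OF that(1)] rk1[OF that(1)] unfolding down_inv_def down_at_def by blast
  have 3: "bad w = Suc x \<Longrightarrow> child x w \<and> x \<in> I \<and> ch x = 0"
    "bad w = 0 \<Longrightarrow> \<not> (child x w \<and> x \<in> I \<and> ch x = 0)" if "w \<in> K" for w x
    using down that unfolding down_inv_def down_at_def bc by blast+
  have 4: "two w \<noteq> 0 \<longleftrightarrow> (\<exists>x x'. x \<noteq> x' \<and> (child x w \<and> x \<in> I \<and> ch x = 0) \<and>
      (child x' w \<and> x' \<in> I \<and> ch x' = 0))" if "w \<in> K" for w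
    using down that unfolding down_inv_def down_at_def bc by blast
  show ?thesis
  proof (unfold_locales)
    show "child y w \<and> (\<forall>x. child x y \<longrightarrow> x \<in> I \<longrightarrow> opt (ch x) \<noteq> None)"
      if "w \<in> K" "opt (ch w) = Some y" for w y
      using 1[of w y] 3(2)[of y] that childD(1) by auto
    show "\<exists>x. child x y \<and> x \<in> I \<and> opt (ch x) = None" if "opt (ch w) = None" "child y w" for w y
      using 2[of y w] 3(1)[of y] that childD(1)[OF that(2)] by (cases "bad y") auto
    show "two y \<noteq> 0 \<longleftrightarrow> (\<exists>x x'. x \<noteq> x' \<and> child x y \<and> child x' y \<and>
      x \<in> I \<and> x' \<in> I \<and> opt (ch x) = None \<and> opt (ch x') = None)" if "y \<in> K" for y
      using 4[OF that] by (simp del: neq0_conv) blast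
    show "blk r \<noteq> 0 \<longleftrightarrow> two r \<noteq> 0" using bK[OF rK] by simp
    show "blk x \<noteq> 0 \<longleftrightarrow> two x \<noteq> 0 \<or> blk y \<noteq> 0" if "child x y" for x y
      using bK[OF childD(1)[OF that]] childD(2,3)[OF that] by simp
  qed (use indep_I bound in auto)
qed

text \<open>A recorded bad child of \<open>z\<close> must be the token that climbs, as it cannot
  make room. If none is recorded, every token below \<open>z\<close> can make room, and
  \<open>w\<close> itself climbs.\<close>

lemma fetch_token_need:
  assumes down: "down_inv 1 ch bad two" and blk: "blk_inv t two blk (Suc w)" and wr: "w \<noteq> r"
    and z: "z = par w" and k: "k = (if bad z = 0 then w else bad z - 1)"
    and need: "need_inv t ch z k need"
  shows "fetch_token E C K r par rk I (\<lambda>x. opt (ch x)) (\<lambda>x. two x \<noteq> 0) (\<lambda>x. blk x \<noteq> 0)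
    w z k {x \<in> K. need x \<noteq> 0}"
proof -
  interpret f: fetch E C K r par rk I "\<lambda>x. opt (ch x)" "\<lambda>x. two x \<noteq> 0" "\<lambda>x. blk x \<noteq> 0"
    by (rule fetch_down[OF down blk])
  have w: "w \<in> K" "w \<in> I" "blk w = 0"
    "\<And>x. x \<in> K \<Longrightarrow> x \<in> I \<Longrightarrow> blk x = 0 \<Longrightarrow> rk w \<le> rk x"
    using blk rk_t unfolding blk_inv_def by auto
  have zK: "z \<in> K" and wz: "child w z" using par[OF w(1) wr] child_par[OF w(1) wr] z by auto
  have k': "child k z \<and> k \<in> I \<and> (bad z = 0 \<or> ch k = 0)"
  proof (cases "bad z")
    case 0
    then show ?thesis using k wz w by simp
  next
    case (Suc x)
    then have "bad_child 1 ch x z" using down zK unfolding down_inv_def down_at_def by blast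
    then show ?thesis using k Suc unfolding bad_child_def by simp
  qed
  have nb: "\<not> (child x z \<and> x \<in> I \<and> ch x = 0)" if "bad z = 0" for x
    using down zK that rk_0 childD(1,2) unfolding down_inv_def down_at_def bad_child_def
    by (metis One_nat_def Suc_leI neq0_conv)
  have N: "need x \<noteq> 0 \<longleftrightarrow> x \<noteq> r \<and> x \<in> I \<and> (par x = z \<and> x \<noteq> k \<or>
       need (par (par x)) \<noteq> 0 \<and> ch (par (par x)) = Suc (par x))" if "x \<in> K" for x
    using need that rk_t[OF that] unfolding need_inv_def by (simp del: neq0_conv)
  have parK: "par x \<in> K" if "x \<in> K" for x using par[OF that] par_r rK by (cases "x = r") auto
  show ?thesis
  proof
    show "w \<in> K" "w \<noteq> r" "\<not> blk w \<noteq> 0" "z = par w" using w wr z by auto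
    show "rk w \<le> rk x" if "x \<in> K" "x \<in> I" "\<not> blk x \<noteq> 0" for x using w(4) that by blast
    show "child k z" "k \<in> I" using k' by auto
    show "opt (ch k) = None" if "child x z" "x \<in> I" "opt (ch x) = None" for x
      using k' nb[of x] that by auto
    show "x \<in> {x \<in> K. need x \<noteq> 0} \<longleftrightarrow> x \<in> K \<and> x \<noteq> r \<and> x \<in> I \<and> (par x = z \<and> x \<noteq> k \<or>
      par (par x) \<in> {x \<in> K. need x \<noteq> 0} \<and> opt (ch (par (par x))) = Some (par x))" for x
      using N[of x] parK[of x] parK[of "par x"] by auto
  qed
qed

end

section \<open>Recorded slides and the program that fetches a token\<close>

inductive trace :: "'a set set \<Rightarrow> 'a set \<Rightarrow> 'a set \<Rightarrow> ('a \<times> 'a) list \<Rightarrow> 'a set \<Rightarrow> bool"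
  for E C X where
  trace_Nil: "trace E C X [] X"
| trace_snoc: "trace E C X M Y \<Longrightarrow> step E a b Y Z \<Longrightarrow> a \<in> C \<Longrightarrow> b \<in> C \<Longrightarrow>
    trace E C X (M @ [(a, b)]) Z"

definition tok :: "nat \<Rightarrow> (nat \<Rightarrow> nat) \<Rightarrow> nat set" where
  "tok n A = {i. i < n \<and> A i \<noteq> 0}"

definition hist :: "(nat \<Rightarrow> nat) \<Rightarrow> (nat \<Rightarrow> nat) \<Rightarrow> nat \<Rightarrow> (nat \<times> nat) list" where
  "hist G H c = map (\<lambda>j. (G j, H j)) [0..<c]"

lemma hist_Suc: "hist (G(c := a)) (H(c := b)) (Suc c) = hist G H c @ [(a, b)]"
  by (simp add: hist_def)

lemma tok_step:
  assumes "step E a b (tok n A) Y" and "b < n"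
  shows "tok n (A(a := 0, b := 1)) = Y"
  using assms unfolding step_def tok_def by auto

definition slide_com :: "nat \<Rightarrow> nat \<Rightarrow> nat \<Rightarrow> nat \<Rightarrow> com" where
  "slide_com A G H c = Store A (Reg rY) (Const 0) ;; Store A (Reg rW) (Const 1) ;;
     Store G (Reg c) (Reg rY) ;; Store H (Reg c) (Reg rW) ;; inc c"

definition reset_body :: com where
  "reset_body = Store aCh (Reg rI) (Const 0) ;; Store aBad (Reg rI) (Const 0) ;;
     Store aTwo (Reg rI) (Const 0) ;; Store aBlk (Reg rI) (Const 0) ;;
     Store aNeed (Reg rI) (Const 0) ;; inc rI"

definition down_body :: "nat \<Rightarrow> com" where
  "down_body A = dec rI ;; Assign rY (Cell aQ (Reg rI)) ;; Assign rW (Cell aPar (Reg rY)) ;;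
     Cond (Conj (Neg (Equal (Cell A (Reg rY)) (Const 0))) (Equal (Cell aCh (Reg rY)) (Const 0)))
       (Cond (Equal (Cell aBad (Reg rW)) (Const 0))
         (Store aBad (Reg rW) (Succ (Reg rY))) (Store aTwo (Reg rW) (Const 1)))
       Skip ;;
     Cond (Equal (Cell aBad (Reg rY)) (Const 0)) (Store aCh (Reg rW) (Succ (Reg rY))) Skip"

definition find_body :: "nat \<Rightarrow> com" where
  "find_body A = Assign rY (Cell aQ (Reg rI)) ;;
     Cond (Conj (Equal (Cell aTwo (Reg rY)) (Const 0))
         (Equal (Cell aBlk (Cell aPar (Reg rY))) (Const 0)))
       Skip (Store aBlk (Reg rY) (Const 1)) ;;
     Cond (Conj (Equal (Reg rF) (Const 0)) (Conj (Neg (Equal (Cell A (Reg rY)) (Const 0)))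
         (Equal (Cell aBlk (Reg rY)) (Const 0))))
       (Assign rF (Succ (Reg rY))) Skip ;;
     inc rI"

text \<open>The nested negations express a disjunction, for which tests have no constructor.\<close>

definition need_body :: "nat \<Rightarrow> com" where
  "need_body A = Assign rY (Cell aQ (Reg rI)) ;; Assign rW (Cell aPar (Reg rY)) ;;
     Cond (Conj (Neg (Equal (Cell A (Reg rY)) (Const 0)))
         (Neg (Conj (Neg (Conj (Equal (Reg rW) (Reg rZ)) (Neg (Equal (Reg rY) (Reg rK)))))
           (Neg (Conj (Neg (Equal (Cell aNeed (Cell aPar (Reg rW))) (Const 0)))
             (Equal (Cell aCh (Cell aPar (Reg rW))) (Succ (Reg rW))))))))
       (Store aNeed (Reg rY) (Const 1)) Skip ;;
     inc rI"

definition clear_body :: "nat \<Rightarrow> nat \<Rightarrow> nat \<Rightarrow> nat \<Rightarrow> com" where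
  "clear_body A G H c = dec rI ;; Assign rY (Cell aQ (Reg rI)) ;;
     Cond (Equal (Cell aNeed (Reg rY)) (Const 0)) Skip
       (Assign rW (Pred (Cell aCh (Reg rY))) ;; slide_com A G H c)"

definition up_body :: "nat \<Rightarrow> nat \<Rightarrow> nat \<Rightarrow> nat \<Rightarrow> com" where
  "up_body A G H c = Assign rW (Cell aPar (Reg rY)) ;; slide_com A G H c ;; Assign rY (Reg rW)"

definition pick :: com where
  "pick = Assign rW (Pred (Reg rF)) ;; Assign rZ (Cell aPar (Reg rW)) ;;
     Cond (Equal (Cell aBad (Reg rZ)) (Const 0)) (Assign rK (Reg rW))
       (Assign rK (Pred (Cell aBad (Reg rZ))))"

definition reset_loop :: com where
  "reset_loop = While (Less (Reg rI) (Reg rN)) reset_body"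

definition down_loop :: "nat \<Rightarrow> com" where
  "down_loop A = While (Less (Const 1) (Reg rI)) (down_body A)"

definition find_loop :: "nat \<Rightarrow> com" where
  "find_loop A = While (Less (Reg rI) (Reg rT)) (find_body A)"

definition need_loop :: "nat \<Rightarrow> com" where
  "need_loop A = While (Less (Reg rI) (Reg rT)) (need_body A)"

definition clear_loop :: "nat \<Rightarrow> nat \<Rightarrow> nat \<Rightarrow> nat \<Rightarrow> com" where
  "clear_loop A G H c = While (Less (Const 1) (Reg rI)) (clear_body A G H c)"

definition up_loop :: "nat \<Rightarrow> nat \<Rightarrow> nat \<Rightarrow> nat \<Rightarrow> com" where
  "up_loop A G H c = While (Neg (Equal (Reg rY) (Reg rS))) (up_body A G H c)"

definition move :: "nat \<Rightarrow> nat \<Rightarrow> nat \<Rightarrow> nat \<Rightarrow> com" where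
  "move A G H c = pick ;; Assign rI (Const 1) ;; need_loop A ;;
     Assign rI (Reg rT) ;; clear_loop A G H c ;;
     Assign rY (Reg rK) ;; up_loop A G H c"

definition scan :: "nat \<Rightarrow> com" where
  "scan A = Assign rI (Const 0) ;; reset_loop ;; Assign rI (Reg rT) ;; down_loop A ;;
     Assign rF (Const 0) ;; Assign rI (Const 0) ;; find_loop A"

abbreviation (input) found :: test where
  "found \<equiv> Conj (Neg (Equal (Reg rF) (Const 0))) (Neg (Equal (Reg rF) (Succ (Reg rS))))"

definition fetch_com :: "nat \<Rightarrow> nat \<Rightarrow> nat \<Rightarrow> nat \<Rightarrow> com" where
  "fetch_com A G H c = scan A ;;
     Cond found
       (move A G H c) Skip"

definition zero_at :: "state \<Rightarrow> nat \<Rightarrow> bool" where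
  "zero_at s i \<longleftrightarrow> arrs s aCh i = 0 \<and> arrs s aBad i = 0 \<and> arrs s aTwo i = 0 \<and>
     arrs s aBlk i = 0 \<and> arrs s aNeed i = 0"

lemma wpt_reset:
  assumes n: "regs s rN = n" and "regs s rI = 0" and T: "1 + n * 7 \<le> T"
  shows "wpt reset_loop s T (\<lambda>s'. \<forall>i<n. zero_at s' i)"
proof -
  have "wpt reset_loop s T (\<lambda>s'. \<forall>i<regs s rN. zero_at s' i)"
    unfolding reset_loop_def
    by (rule wpt_for[where P = "\<lambda>k s'. \<forall>i<k. zero_at s' i"])
      (use assms in \<open>auto simp: zero_at_def less_Suc_eq reset_body_def\<close>)
  then show ?thesis using n by simp
qed

text \<open>The tokens are in the array \<open>A\<close>, the slides are recorded in the arrays \<open>G\<close> and \<open>H\<close> and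
  counted by the register \<open>c\<close>.\<close>

locale side =
  fixes A G H c :: nat
  assumes A: "1 < A" "A < 4" and GH: "15 < G" "15 < H" "G \<noteq> H" and c: "c = 15 \<or> c = 16"
begin

lemma neq [simp]:
  "A \<noteq> 0" "A \<noteq> 1" "A \<noteq> Suc 0" "A \<noteq> 4" "A \<noteq> 5" "A \<noteq> 6" "A \<noteq> 7" "A \<noteq> 8" "A \<noteq> 9" "A \<noteq> 10"
  "A \<noteq> 11" "A \<noteq> 12" "A \<noteq> 13" "A \<noteq> 14" "A \<noteq> 15" "A \<noteq> G" "A \<noteq> H"
  "G \<noteq> 0" "G \<noteq> 1" "G \<noteq> Suc 0" "G \<noteq> 4" "G \<noteq> 5" "G \<noteq> 6" "G \<noteq> 7" "G \<noteq> 8" "G \<noteq> 9" "G \<noteq> 10"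
  "G \<noteq> 11" "G \<noteq> 12" "G \<noteq> 13" "G \<noteq> 14" "G \<noteq> 15" "G \<noteq> A" "G \<noteq> H"
  "H \<noteq> 0" "H \<noteq> 1" "H \<noteq> Suc 0" "H \<noteq> 4" "H \<noteq> 5" "H \<noteq> 6" "H \<noteq> 7" "H \<noteq> 8" "H \<noteq> 9" "H \<noteq> 10"
  "H \<noteq> 11" "H \<noteq> 12" "H \<noteq> 13" "H \<noteq> 14" "H \<noteq> 15" "H \<noteq> A" "H \<noteq> G"
  "c \<noteq> 0" "c \<noteq> 1" "c \<noteq> Suc 0" "c \<noteq> 2" "c \<noteq> 3" "c \<noteq> 4" "c \<noteq> 5" "c \<noteq> 6" "c \<noteq> 7" "c \<noteq> 8" "c \<noteq> 9"
  "c \<noteq> 10" "c \<noteq> 11" "c \<noteq> 12" "c \<noteq> 13" "c \<noteq> 14" "c \<noteq> 17" "c \<noteq> 18"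
  using A GH c by auto

lemmas neq' [simp] = neq[symmetric]

end

locale fetch_run = side A G H c + fetch_input E C K r par rk I n q t
  for A G H c :: nat and E :: "nat set set" and C K r par rk I n q t
begin

definition base :: "state \<Rightarrow> bool" where
  "base s \<longleftrightarrow> regs s rN = n \<and> regs s rT = t \<and> regs s rS = r \<and> arrs s aQ = q \<and> arrs s aPar = par"

lemma K_less: "x \<in> K \<Longrightarrow> x < n"
  using K_n by blast

lemma wpt_down:
  assumes s: "base s" "regs s rI = t" "tok n (arrs s A) = I"
    and init: "down_inv t (arrs s aCh) (arrs s aBad) (arrs s aTwo)"
    and T: "1 + t * 12 \<le> T"
  shows "wpt (down_loop A) s T (\<lambda>s'. down_inv 1 (arrs s' aCh) (arrs s' aBad) (arrs s' aTwo))"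
proof -
  define P where "P i s' \<longleftrightarrow> down_inv i (arrs s' aCh) (arrs s' aBad) (arrs s' aTwo)"
    for i and s' :: state
  have "wpt (down_loop A) s T (P 1)"
    unfolding down_loop_def
  proof (rule wpt_countdown)
    show "P (regs s rI) s" "1 \<le> regs s rI" using assms t_pos by (simp_all add: P_def)
    fix s' i assume ag: "agree (down_body A) s s'" and r: "regs s' rI = Suc i" and "1 \<le> i"
      and "i < regs s rI" and P: "P (Suc i) s'"
    then have i: "0 < i" "i < t" using s by auto
    define y w where "y = q i" and "w = par y"
    have s': "arrs s' aQ = q" "arrs s' aPar = par" "arrs s' A = arrs s A"
      using ag s by (simp_all add: agree_def down_body_def base_def)
    have yI: "y \<in> I \<longleftrightarrow> arrs s A y \<noteq> 0"
      using s(3) K_less[OF q_K[OF i(2)]] unfolding y_def tok_def by auto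
    have yw: "w \<noteq> y" using childD(8)[OF child_q[OF i]] by (simp add: y_def w_def)
    note step = down_step[OF P[unfolded P_def] i y_def w_def refl refl refl, unfolded yI]
    show "regs (exec (down_body A) s') rI = i \<and> P i (exec (down_body A) s')"
      using step r yw s' unfolding P_def
      by (auto simp: down_body_def y_def[symmetric] w_def[symmetric] simp del: neq0_conv
        split: if_splits)
  qed (use s T in \<open>simp_all add: down_body_def\<close>)
  then show ?thesis by (rule wpt_mono) (simp_all add: P_def)
qed

lemma wpt_find:
  assumes s: "base s" "regs s rI = 0" "regs s rF = 0" "tok n (arrs s A) = I"
    and init: "\<And>x. x < n \<Longrightarrow> arrs s aBlk x = 0"
    and T: "1 + t * 10 \<le> T"
  shows "wpt (find_loop A) s T (\<lambda>s'. blk_inv t (arrs s aTwo) (arrs s' aBlk) (regs s' rF))"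
proof -
  define P where "P i s' \<longleftrightarrow> blk_inv i (arrs s aTwo) (arrs s' aBlk) (regs s' rF)"
    for i and s' :: state
  have "wpt (find_loop A) s T (P (regs s rT))"
    unfolding find_loop_def
  proof (rule wpt_for)
    show "P (regs s rI) s" using s blk_init[of "arrs s aBlk"] init by (simp add: P_def)
    fix s' i assume ag: "agree (find_body A) s s'" and r: "regs s' rI = i"
      and "i < regs s rT" and P: "P i s'"
    then have i: "i < t" using s by (simp add: base_def)
    have s': "arrs s' aQ = q" "arrs s' aPar = par" "arrs s' A = arrs s A"
      "arrs s' aTwo = arrs s aTwo"
      using ag s by (simp_all add: agree_def find_body_def base_def)
    define y where "y = q i"
    have yI: "y \<in> I \<longleftrightarrow> arrs s A y \<noteq> 0"
      using s(4) K_less[OF q_K[OF i]] unfolding y_def tok_def by auto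
    note step = blk_step[OF P[unfolded P_def] i y_def refl refl, unfolded yI]
    show "regs (exec (find_body A) s') rI = Suc i \<and> P (Suc i) (exec (find_body A) s')"
      using step r s' unfolding P_def
      by (auto simp: find_body_def y_def[symmetric] simp del: neq0_conv)
  qed (use s T in \<open>simp_all add: find_body_def base_def\<close>)
  then show ?thesis by (rule wpt_mono) (use s in \<open>simp_all add: P_def base_def\<close>)
qed

lemma wpt_need:
  assumes s: "base s" "regs s rI = 1" "tok n (arrs s A) = I"
    and init: "\<And>x. x < n \<Longrightarrow> arrs s aNeed x = 0"
    and T: "1 + t * 10 \<le> T"
  shows "wpt (need_loop A) s T
    (\<lambda>s'. need_inv t (arrs s aCh) (regs s rZ) (regs s rK) (arrs s' aNeed))"
proof -
  define P where "P i s' \<longleftrightarrow> 0 < i \<and>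
    need_inv i (arrs s aCh) (regs s rZ) (regs s rK) (arrs s' aNeed)" for i and s' :: state
  have "wpt (need_loop A) s T (P (regs s rT))"
    unfolding need_loop_def
  proof (rule wpt_for)
    show "P (regs s rI) s" "regs s rI \<le> regs s rT"
      using s need_init[of "arrs s aNeed"] init t_pos by (simp_all add: P_def base_def)
    fix s' i assume ag: "agree (need_body A) s s'" and r: "regs s' rI = i"
      and "i < regs s rT" and P: "P i s'"
    then have i: "0 < i" "i < t" using s by (simp_all add: base_def P_def)
    have s': "arrs s' aQ = q" "arrs s' aPar = par" "arrs s' A = arrs s A"
      "arrs s' aCh = arrs s aCh" "regs s' rZ = regs s rZ" "regs s' rK = regs s rK"
      using ag s by (simp_all add: agree_def need_body_def base_def)
    define y where "y = q i"
    have yI: "y \<in> I \<longleftrightarrow> arrs s A y \<noteq> 0"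
      using s(3) K_less[OF q_K[OF i(2)]] unfolding y_def tok_def by auto
    note step = need_step[OF conjunct2[OF P[unfolded P_def]] i y_def refl, unfolded yI]
    show "regs (exec (need_body A) s') rI = Suc i \<and> P (Suc i) (exec (need_body A) s')"
      using step r s' unfolding P_def
      by (auto simp: need_body_def y_def[symmetric] simp del: neq0_conv split: if_splits)
  qed (use s T in \<open>simp_all add: need_body_def base_def diff_mult_distrib\<close>)
  then show ?thesis by (rule wpt_mono) (use s in \<open>simp_all add: P_def base_def\<close>)
qed

text \<open>The log is only extended, and the new part is a trace inside \<open>K\<close>; this
  allows the traces of successive rounds to be concatenated.\<close>

definition moved :: "state \<Rightarrow> state \<Rightarrow> bool" where
  "moved s s' \<longleftrightarrow> (\<exists>M. hist (arrs s' G) (arrs s' H) (regs s' c) =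
     hist (arrs s G) (arrs s H) (regs s c) @ M \<and> trace E K I M (tok n (arrs s' A)))"

lemma moved_slide:
  assumes m: "moved s s'" and st: "step E (regs s' rY) (regs s' rW) (tok n (arrs s' A)) Z"
    and K: "regs s' rY \<in> K" "regs s' rW \<in> K"
  shows "moved s (exec (slide_com A G H c) s')"
    and "tok n (arrs (exec (slide_com A G H c) s') A) = Z"
proof -
  let ?s = "exec (slide_com A G H c) s'"
  let ?y = "regs s' rY" and ?w = "regs s' rW"
  have a: "arrs ?s A = (arrs s' A)(?y := 0, ?w := 1)"
    "arrs ?s G = (arrs s' G)(regs s' c := ?y)" "arrs ?s H = (arrs s' H)(regs s' c := ?w)"
    "regs ?s c = Suc (regs s' c)"
    by (simp_all add: slide_com_def)
  show tok: "tok n (arrs ?s A) = Z" unfolding a by (rule tok_step[OF st K_less[OF K(2)]])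
  show "moved s ?s"
    using m trace_snoc[OF _ st K] unfolding moved_def tok unfolding a hist_Suc by fastforce
qed

end

locale fetch_run_token = fetch_run A G H c E C K r par rk I n q t +
  fetch_token E C K r par rk I "\<lambda>x. opt (ch x)" two blk w z k "{x \<in> K. need x \<noteq> 0}"
  for A G H c :: nat and E :: "nat set set" and C K r par rk I n q t ch two blk w z k
    and need :: "nat \<Rightarrow> nat"
begin

lemma wpt_clear:
  assumes s: "base s" "regs s rI = t" "arrs s aCh = ch" "arrs s aNeed = need" and m: "moved s0 s"
    and tok: "tok n (arrs s A) = I" and T: "1 + t * 14 \<le> T"
  shows "wpt (clear_loop A G H c) s T
    (\<lambda>s'. moved s0 s' \<and> tok n (arrs s' A) = J {x \<in> K. need x \<noteq> 0})"
proof -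
  let ?N = "{x \<in> K. need x \<noteq> 0}"
  \<comment> \<open>With counter \<open>i\<close>, the positions from \<open>i\<close> upwards have
    been cleared; the strict inequality fits \<open>descends_above\<close>. The loop may stop at 1,
    because the root does not belong to \<open>N\<close>.\<close>
  define P where "P i s' \<longleftrightarrow> moved s0 s' \<and> tok n (arrs s' A) = J {x \<in> ?N. i - 1 < rk x}"
    for i and s' :: state
  have "wpt (clear_loop A G H c) s T (P 1)"
    unfolding clear_loop_def
  proof (rule wpt_countdown)
    have "{x \<in> ?N. t - 1 < rk x} = {}" using rk_t by fastforce
    moreover have "J {} = I" by (simp add: J_def)
    ultimately have "J {x \<in> ?N. t - 1 < rk x} = I" by metis
    then show "P (regs s rI) s" "1 \<le> regs s rI" using s m tok t_pos by (simp_all add: P_def)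
    fix s' i assume ag: "agree (clear_body A G H c) s s'" and r: "regs s' rI = Suc i"
      and "1 \<le> i" and "i < regs s rI" and P: "P (Suc i) s'"
    then have i: "0 < i" "i < t" using s by auto
    define y where "y = q i"
    have s': "arrs s' aQ = q" "arrs s' aCh = ch" "arrs s' aNeed = need"
      using ag s by (simp_all add: agree_def clear_body_def slide_com_def base_def)
    have y: "y \<in> K" "rk y = i" using q_K rk_q i by (auto simp: y_def)
    let ?B = "{x \<in> ?N. i < rk x}"
    have tok': "tok n (arrs s' A) = J ?B" and m': "moved s0 s'" using P by (simp_all add: P_def)
    have B: "{x \<in> ?N. i - 1 < rk x} = (if need y = 0 then ?B else insert y ?B)"
    proof -
      have "i - 1 < rk x \<longleftrightarrow> i < rk x \<or> x = y" if "x \<in> K" for x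
        using rk_le_iff[OF that i(2)] i(1) by (auto simp: y_def)
      then show ?thesis using y by auto
    qed
    show "regs (exec (clear_body A G H c) s') rI = i \<and> P i (exec (clear_body A G H c) s')"
    proof (cases "need y = 0")
      case True
      then show ?thesis using s' i r m' tok' B unfolding P_def moved_def
        by (simp add: clear_body_def y_def[symmetric])
    next
      case False
      then have yN: "y \<in> ?N" using y by simp
      obtain x where x: "ch y = Suc x" using N_ch[OF yN] by auto
      let ?s1 = "exec (dec rI ;; Assign rY (Cell aQ (Reg rI)) ;;
        Assign rW (Pred (Cell aCh (Reg rY)))) s'"
      have s1: "regs ?s1 rY = y" "regs ?s1 rW = x" "arrs ?s1 A = arrs s' A"
        using s' r x by (simp_all add: y_def[symmetric])
      have e: "exec (clear_body A G H c) s' = exec (slide_com A G H c) ?s1"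
        using False s' r by (simp add: clear_body_def y_def[symmetric])
      have d: "descends ?B" "descends (insert y ?B)"
        using descends_above[of i] descends_above[of "i - 1"] B False by simp_all
      have ynB: "y \<notin> ?B" using y by simp
      have st: "step E y x (J ?B) (J (insert y ?B))" and xK: "x \<in> K"
        using clear_step[OF d yN ynB, of x] x by simp_all
      have m1: "moved s0 ?s1" using m' unfolding moved_def by simp
      note sl = moved_slide[OF m1, of "J (insert y ?B)", unfolded s1 tok', OF st y(1) xK]
      have "regs (exec (slide_com A G H c) ?s1) rI = i"
        using r by (simp add: slide_com_def)
      then show ?thesis
        using sl B False unfolding P_def e by simp
    qed
  qed (use s T in \<open>simp_all add: clear_body_def slide_com_def\<close>)
  moreover have "{x \<in> ?N. 0 < rk x} = ?N" using N_D rk_0 by blast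
  ultimately show ?thesis by (elim wpt_mono) (simp_all add: P_def)
qed

lemma wpt_up:
  assumes s: "base s" "regs s rY = k" and m: "moved s0 s"
    and tok: "tok n (arrs s A) = J {x \<in> K. need x \<noteq> 0}" and T: "1 + t * 10 \<le> T"
  shows "wpt (up_loop A G H c) s T (\<lambda>s'. moved s0 s' \<and> r \<in> tok n (arrs s' A))"
proof -
  let ?N = "{x \<in> K. need x \<noteq> 0}"
  \<comment> \<open>\<open>a\<close> is the place of the climbing token, and its rank bounds the
    remaining slides.\<close>
  define P where "P j s' \<longleftrightarrow> (let a = regs s' rY in j = rk a \<and> (a = k \<or> a \<in> path) \<and> moved s0 s' \<and>
    tok n (arrs s' A) = insert a (J ?N - {k}))" for j and s' :: state
  show ?thesis
    unfolding up_loop_def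
  proof (rule wpt_While[where P = P])
    have "insert k (J ?N - {k}) = J ?N" using k_J by blast
    then show "P (rk k) s" using s m tok by (simp add: P_def Let_def)
  next
    fix j s' assume ag: "agree (up_body A G H c) s s'" and P: "P j s'"
      and b: "eval_test (Neg (Equal (Reg rY) (Reg rS))) s'"
    define a where "a = regs s' rY"
    have s': "arrs s' aPar = par" "regs s' rS = r"
      using ag s by (simp_all add: agree_def up_body_def slide_com_def base_def)
    have ar: "a \<noteq> r" using b s' by (simp add: a_def)
    have a: "a = k \<or> a \<in> path" "j = rk a" "moved s0 s'"
      "tok n (arrs s' A) = insert a (J ?N - {k})" using P by (auto simp: P_def Let_def a_def)
    note st = up_step[OF a(1) ar]
    let ?s1 = "exec (Assign rW (Cell aPar (Reg rY))) s'"
    have s1: "regs ?s1 rY = a" "regs ?s1 rW = par a" "arrs ?s1 A = arrs s' A"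
      using s' by (simp_all add: a_def)
    have e: "exec (up_body A G H c) s' =
      exec (Assign rY (Reg rW)) (exec (slide_com A G H c) ?s1)" by (simp add: up_body_def)
    have m1: "moved s0 ?s1" using a(3) unfolding moved_def by simp
    have pK: "par a \<in> K" "rk (par a) < rk a" using par[OF st(2) ar] by auto
    note sl = moved_slide[OF m1, of "insert (par a) (J ?N - {k})", unfolded s1 a(4),
        OF st(1,2) pK(1)]
    have "regs (exec (slide_com A G H c) ?s1) rW = par a"
      using s1 by (simp add: slide_com_def)
    then have "P (rk (par a)) (exec (up_body A G H c) s')"
      using sl st(3) unfolding P_def Let_def e moved_def by simp
    then show "wpt (up_body A G H c) s' 9 (\<lambda>s''. \<exists>k'<j. P k' s'')"
      using pK a(2) by (intro wpt_straight) (auto simp: up_body_def slide_com_def)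
  next
    fix j s' assume "agree (up_body A G H c) s s'" and P: "P j s'"
      and b: "\<not> eval_test (Neg (Equal (Reg rY) (Reg rS))) s'"
    then have "regs s' rY = r"
      using s by (simp add: agree_def up_body_def slide_com_def base_def)
    then show "moved s0 s' \<and> r \<in> tok n (arrs s' A)" using P by (simp add: P_def Let_def)
  next
    have "rk k * 10 \<le> t * 10" using rk_t[OF childD(1)[OF k_child]] by simp
    then show "1 + rk k * (1 + 9) \<le> T" using T by simp
  qed
qed

end

lemma trace_reach: "trace E C X M Y \<Longrightarrow> reach E C X Y"
  by (induction rule: trace.induct)
    (auto simp: step_in_def intro: rtranclp.rtrancl_into_rtrancl)

lemma trace_append: "trace E D Y N Z \<Longrightarrow> trace E C X M Y \<Longrightarrow> D \<subseteq> C \<Longrightarrow> trace E C X (M @ N) Z"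
proof (induction rule: trace.induct)
  case (trace_snoc N Y' a b Z)
  then show ?case using trace.trace_snoc[of E C X "M @ N" Y' a b Z] by auto
qed simp

section \<open>Assembling the passes into one fetch\<close>

context fetch_run
begin

lemma t_le: "t \<le> n"
proof -
  have "inj_on q {..<t}" using rk_q by (metis inj_onI lessThan_iff)
  moreover have "q ` {..<t} \<subseteq> {..<n}" using q_K K_n by auto
  ultimately show ?thesis using card_inj_on_le[of q "{..<t}" "{..<n}"] by simp
qed

text \<open>Per vertex, 7 steps pay for the reset, 12 for the bottom-up pass and 10 for finding the
  token.\<close>

lemma wpt_scan:
  assumes s: "base s" "tok n (arrs s A) = I"
  shows "wpt (scan A) s (10 + 30 * n) (\<lambda>s'. down_inv 1 (arrs s' aCh) (arrs s' aBad) (arrs s' aTwo) \<and>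
    blk_inv t (arrs s' aTwo) (arrs s' aBlk) (regs s' rF) \<and> (\<forall>x<n. arrs s' aNeed x = 0))"
    (is "wpt _ _ _ ?Q")
  unfolding scan_def
proof (rule wpt_Seq_straight, simp, simp)
  let ?s = "exec (Assign rI (Const 0)) s"
  show "wpt (reset_loop ;; Assign rI (Reg rT) ;; down_loop A ;;
     Assign rF (Const 0) ;; Assign rI (Const 0) ;; find_loop A) ?s
     (10 + 30 * n - cost (Assign rI (Const 0))) ?Q"
  proof (rule wpt_Seq_agree[OF wpt_reset[where n = n, OF _ _ order_refl], where U = "8 + 23 * n"])
    fix s1 assume ag: "agree reset_loop ?s s1"
      and z: "\<forall>i<n. zero_at s1 i"
    have b1: "base s1" "tok n (arrs s1 A) = I"
      using s ag by (simp_all add: base_def agree_def reset_loop_def reset_body_def)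
    show "wpt (Assign rI (Reg rT) ;; down_loop A ;;
     Assign rF (Const 0) ;; Assign rI (Const 0) ;; find_loop A) s1 (8 + 23 * n) ?Q"
    proof (rule wpt_Seq_straight, simp, simp)
      let ?s1 = "exec (Assign rI (Reg rT)) s1"
      show "wpt (down_loop A ;; Assign rF (Const 0) ;; Assign rI (Const 0) ;; find_loop A) ?s1
        (8 + 23 * n - cost (Assign rI (Reg rT))) ?Q"
      proof (rule wpt_Seq_agree[OF wpt_down[OF _ _ _ _ order_refl], where U = "5 + 10 * n"])
        fix s2 assume ag2: "agree (down_loop A) ?s1 s2"
          and d: "down_inv 1 (arrs s2 aCh) (arrs s2 aBad) (arrs s2 aTwo)"
        have b2: "base s2" "tok n (arrs s2 A) = I" "arrs s2 aBlk = arrs s1 aBlk"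
          "arrs s2 aNeed = arrs s1 aNeed"
          using b1 ag2 by (simp_all add: base_def agree_def down_loop_def down_body_def)
        let ?s2 = "exec (Assign rI (Const 0)) (exec (Assign rF (Const 0)) s2)"
        have "wpt (find_loop A) ?s2 (1 + t * 10)
            (\<lambda>s'. blk_inv t (arrs ?s2 aTwo) (arrs s' aBlk) (regs s' rF))"
          by (rule wpt_find) (use b2 z in \<open>simp_all add: base_def zero_at_def\<close>)
        then have "wpt (find_loop A) ?s2 (3 + 10 * n) ?Q"
        proof (rule wpt_mono)
          fix s3 assume "blk_inv t (arrs ?s2 aTwo) (arrs s3 aBlk) (regs s3 rF)"
            "agree (find_loop A) ?s2 s3"
          then show "?Q s3"
            using d z b2 by (simp add: zero_at_def agree_def find_loop_def find_body_def)
        qed (use t_le in simp)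
        then show "wpt (Assign rF (Const 0) ;; Assign rI (Const 0) ;; find_loop A) s2
          (5 + 10 * n) ?Q"
          by (intro wpt_Seq_straight) simp_all
      next
        show "1 + t * 12 + (5 + 10 * n) \<le> 8 + 23 * n - cost (Assign rI (Reg rT))"
          using t_le by simp
      qed (use b1 z in \<open>simp_all add: base_def down_init zero_at_def\<close>)
    qed
  qed (use s in \<open>simp_all add: base_def\<close>)
qed

text \<open>Three outcomes of the scan: no unblocked token, and then the root is unreachable; the
  root itself is the token found, and nothing is to be done; or another token, for which
  \<open>move\<close> is run. The loops of \<open>move\<close> take 10, 14 and 10 steps per
  vertex.\<close>

lemma wpt_fetch:
  assumes s: "base s" "tok n (arrs s A) = I"
  shows "wpt (fetch_com A G H c) s (30 + 70 * n) (\<lambda>s'. moved s s' \<and>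
    (r \<in> tok n (arrs s' A) \<or> (\<forall>Z. reach E C (I \<inter> C) Z \<longrightarrow> r \<notin> Z)))" (is "wpt _ _ _ ?Q")
  unfolding fetch_com_def
proof (rule wpt_Seq_agree[OF wpt_scan[OF s], where U = "1 + (15 + 35 * n)"])
  fix s1 assume ag: "agree (scan A) s s1"
    and "down_inv 1 (arrs s1 aCh) (arrs s1 aBad) (arrs s1 aTwo) \<and>
    blk_inv t (arrs s1 aTwo) (arrs s1 aBlk) (regs s1 rF) \<and> (\<forall>x<n. arrs s1 aNeed x = 0)"
  then have down: "down_inv 1 (arrs s1 aCh) (arrs s1 aBad) (arrs s1 aTwo)"
    and blk: "blk_inv t (arrs s1 aTwo) (arrs s1 aBlk) (regs s1 rF)"
    and need0: "\<And>x. x < n \<Longrightarrow> arrs s1 aNeed x = 0" by auto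
  note defs = scan_def reset_loop_def reset_body_def down_loop_def down_body_def
    find_loop_def find_body_def
  have b1: "base s1" "arrs s1 A = arrs s A" "arrs s1 G = arrs s G" "arrs s1 H = arrs s H"
    "regs s1 c = regs s c"
    using s ag by (simp_all add: base_def agree_def defs)
  have m1: "moved s s1"
    using b1 s trace_Nil unfolding moved_def by auto
  have tok1: "tok n (arrs s1 A) = I" using s b1 by simp
  have S: "regs s1 rS = r" using b1 by (simp add: base_def)
  interpret f: fetch E C K r par rk I "\<lambda>x. opt (arrs s1 aCh x)" "\<lambda>x. arrs s1 aTwo x \<noteq> 0"
    "\<lambda>x. arrs s1 aBlk x \<noteq> 0"
    by (rule fetch_down[OF down blk])
  show "wpt (Cond found
       (move A G H c) Skip) s1 (1 + (15 + 35 * n)) ?Q"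
  proof (rule wpt_Cond)
    assume b: "\<not> eval_test found s1"
    show "wpt Skip s1 (15 + 35 * n) ?Q"
    proof (rule wpt_straight)
      have "r \<in> I \<or> (\<forall>Z. reach E C (I \<inter> C) Z \<longrightarrow> r \<notin> Z)"
      proof (cases "regs s1 rF = 0")
        case True
        then have "\<And>x. x \<in> K \<Longrightarrow> x \<in> I \<Longrightarrow> arrs s1 aBlk x \<noteq> 0"
          using blk rk_t unfolding blk_inv_def by blast
        then show ?thesis using f.root_unreachable by blast
      next
        case False
        then have "regs s1 rF = Suc r" using b S by simp
        then show ?thesis using blk unfolding blk_inv_def by blast
      qed
      then show "?Q (exec Skip s1)" using m1 tok1 by simp
    qed simp_all
  next
    assume b: "eval_test found s1"
    define w where "w = regs s1 rF - 1"
    have F: "regs s1 rF = Suc w" "w \<noteq> r" using b S by (auto simp: w_def)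
    define z where "z = par w"
    define k where "k = (if arrs s1 aBad z = 0 then w else arrs s1 aBad z - 1)"
    note tokn = fetch_token_need[OF down blk[unfolded F(1)] F(2) z_def k_def]
    let ?s1 = "exec (Assign rI (Const 1)) (exec pick s1)"
    have p1: "regs ?s1 rZ = z" "regs ?s1 rK = k" "arrs ?s1 = arrs s1" "regs ?s1 rI = 1"
      "base ?s1" "regs ?s1 c = regs s1 c"
      using b1 F by (simp_all add: pick_def z_def k_def base_def)
    have mv: "wpt (need_loop A ;; Assign rI (Reg rT) ;; clear_loop A G H c ;;
     Assign rY (Reg rK) ;; up_loop A G H c) ?s1 (6 + 34 * n) ?Q"
    proof (rule wpt_Seq_agree[OF wpt_need[OF _ _ _ _ order_refl], where U = "5 + 24 * n"])
      fix s2 assume ag2: "agree (need_loop A) ?s1 s2"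
        and "need_inv t (arrs ?s1 aCh) (regs ?s1 rZ) (regs ?s1 rK) (arrs s2 aNeed)"
      then have "need_inv t (arrs s1 aCh) z k (arrs s2 aNeed)" using p1 by simp
      then interpret ft: fetch_token E C K r par rk I "\<lambda>x. opt (arrs s1 aCh x)"
        "\<lambda>x. arrs s1 aTwo x \<noteq> 0" "\<lambda>x. arrs s1 aBlk x \<noteq> 0" w z k "{x \<in> K. arrs s2 aNeed x \<noteq> 0}"
        by (rule tokn)
      interpret fr: fetch_run_token A G H c E C K r par rk I n q t "arrs s1 aCh"
        "\<lambda>x. arrs s1 aTwo x \<noteq> 0" "\<lambda>x. arrs s1 aBlk x \<noteq> 0" w z k "arrs s2 aNeed" ..
      let ?s2 = "exec (Assign rI (Reg rT)) s2"
      have b2: "base ?s2" "regs ?s2 rI = t" "arrs ?s2 aCh = arrs s1 aCh"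
        "arrs ?s2 aNeed = arrs s2 aNeed" "arrs ?s2 A = arrs s1 A" "arrs ?s2 G = arrs s1 G"
        "arrs ?s2 H = arrs s1 H" "regs ?s2 c = regs s1 c" "regs ?s2 rK = k"
        using ag2 p1 by (simp_all add: base_def agree_def need_loop_def need_body_def)
      have m2: "moved s ?s2" "tok n (arrs ?s2 A) = I"
        using m1 tok1 b2 unfolding moved_def by simp_all
      have "wpt (clear_loop A G H c ;; Assign rY (Reg rK) ;; up_loop A G H c) ?s2 (4 + 24 * n) ?Q"
      proof (rule wpt_Seq_agree[OF fr.wpt_clear[OF b2(1-4) m2 order_refl], where U = "2 + 10 * n"])
        fix s3 assume ag3: "agree (clear_loop A G H c) ?s2 s3"
          and m3: "moved s s3 \<and> tok n (arrs s3 A) = ft.J {x \<in> K. arrs s2 aNeed x \<noteq> 0}"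
        have b3: "base s3" "regs s3 rK = k"
          using ag3 b2 by (simp_all add: base_def agree_def clear_loop_def clear_body_def slide_com_def)
        let ?s3 = "exec (Assign rY (Reg rK)) s3"
        have "moved s s3" using m3 by simp
        then have m4: "base ?s3" "regs ?s3 rY = k" "moved s ?s3"
          "tok n (arrs ?s3 A) = ft.J {x \<in> K. arrs s2 aNeed x \<noteq> 0}"
          using conjunct2[OF m3] b3 by (simp_all add: base_def moved_def)
        have "wpt (up_loop A G H c) ?s3 (1 + t * 10) (\<lambda>s'. moved s s' \<and> r \<in> tok n (arrs s' A))"
          by (rule fr.wpt_up[OF m4]) simp
        then have "wpt (up_loop A G H c) ?s3 (1 + 10 * n) ?Q"
          by (rule wpt_mono) (use t_le in auto)
        then show "wpt (Assign rY (Reg rK) ;; up_loop A G H c) s3 (2 + 10 * n) ?Q"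
          by (intro wpt_Seq_straight) simp_all
      qed (use t_le in simp)
      then show "wpt (Assign rI (Reg rT) ;; clear_loop A G H c ;; Assign rY (Reg rK) ;;
        up_loop A G H c) s2 (5 + 24 * n) ?Q"
        by - (rule wpt_Seq_straight, simp_all)
    qed (use t_le p1 tok1 need0 in \<open>simp_all\<close>)
    show "wpt (move A G H c) s1 (15 + 35 * n) ?Q"
      unfolding move_def
    proof (rule wpt_Seq_straight, simp add: pick_def, simp add: pick_def)
      show "wpt (Assign rI (Const 1) ;; need_loop A ;; Assign rI (Reg rT) ;;
        clear_loop A G H c ;; Assign rY (Reg rK) ;; up_loop A G H c) (exec pick s1)
        (15 + 35 * n - cost pick) ?Q"
      proof (rule wpt_Seq_straight, simp, simp add: pick_def)
        show "wpt (need_loop A ;; Assign rI (Reg rT) ;; clear_loop A G H c ;;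
          Assign rY (Reg rK) ;; up_loop A G H c) ?s1
          (15 + 35 * n - cost pick - cost (Assign rI (Const 1))) ?Q"
          by (rule wpt_mono[OF mv]) (simp_all add: pick_def)
      qed
    qed
  qed
qed simp

end


section \<open>The main loop\<close>

abbreviation (input) delete :: com where
  "delete \<equiv> Store aRem (Reg rV) (Const 1) ;; Store aRem (Reg rU) (Const 1)"

abbreviation (input) fetch_both :: com where
  "fetch_both \<equiv> fetch_com 2 16 17 15 ;; fetch_com 3 18 19 16 ;; delete"

abbreviation (input) select :: com where
  "select \<equiv> Assign rV (Cell aQ (Pred (Reg rT))) ;; Assign rU (Cell aPar (Reg rV)) ;;
     Assign rS (Reg rV) ;; bfs ;; fetch_both"

abbreviation (input) log2 :: "state \<Rightarrow> (nat \<times> nat) list" where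
  "log2 s \<equiv> hist (arrs s 16) (arrs s 17) (regs s 15)"

abbreviation (input) log3 :: "state \<Rightarrow> (nat \<times> nat) list" where
  "log3 s \<equiv> hist (arrs s 18) (arrs s 19) (regs s 16)"

definition phase :: com where
  "phase = Assign rS (Reg rX) ;; bfs ;; select"

definition main_loop :: com where
  "main_loop = While (Less (Reg rX) (Reg rN))
     (Cond (Equal (Cell aRem (Reg rX)) (Const 0)) phase (inc rX))"

definition rest :: "nat \<Rightarrow> state \<Rightarrow> nat set" where
  "rest n s = {i. i < n \<and> arrs s aRem i = 0}"

lemma side2: "side 2 16 17 15" and side3: "side 3 18 19 16"
  by unfold_locales auto

lemmas bfs_defs = bfs_def clear_vis_def bfs_start_def bfs_body_def

lemmas fetch_com_defs = fetch_com_def scan_def reset_loop_def reset_body_def down_loop_def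
    down_body_def find_loop_def find_body_def move_def pick_def need_loop_def need_body_def
    clear_loop_def clear_body_def up_loop_def up_body_def slide_com_def

lemma bfs_agree:
  "agree bfs s s' \<Longrightarrow> r \<notin> {3, 4, 5, 6, 7, 9} \<Longrightarrow> regs s' r = regs s r"
  "agree bfs s s' \<Longrightarrow> a \<notin> {8, 9, 10} \<Longrightarrow> arrs s' a = arrs s a"
  by (simp_all add: agree_def bfs_defs)

lemma fetch_com_agree:
  "agree (fetch_com A G H c) s s' \<Longrightarrow> r \<notin> {7, 8, 9, 12, 13, 14, c} \<Longrightarrow> regs s' r = regs s r"
  "agree (fetch_com A G H c) s s' \<Longrightarrow> a \<notin> {11, 12, 13, 14, 15, A, G, H} \<Longrightarrow> arrs s' a = arrs s a"
  by (simp_all add: agree_def fetch_com_defs)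

lemma fetch_run_intro:
  assumes "side A G H c" and "rooted E C K r par rk" and "listed K rk q t" and "C \<subseteq> {..<n}"
    and "indep E I" and "\<And>x y. x \<in> C \<Longrightarrow> y \<in> I - C \<Longrightarrow> {x, y} \<notin> E"
  shows "fetch_run A G H c E C K r par rk I n q t"
proof -
  interpret side A G H c by fact
  interpret rooted E C K r par rk by fact
  show ?thesis
  proof
    show "y \<in> K" if "x \<in> K" "y \<in> I" "{x, y} \<in> E" for x y
      using assms(6)[of x y] closed[of x y] KC that by blast
  qed (use assms KC in auto)
qed

definition wf_graph :: "nat set set \<Rightarrow> nat \<Rightarrow> nat \<Rightarrow> state \<Rightarrow> bool" where
  "wf_graph E n m s \<longleftrightarrow> regs s rN = n \<and>
     (\<exists>p. arcs (arrs s aFst) (arrs s aNxt) (arrs s aTo) p {(x, y). {x, y} \<in> E} n m)"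

text \<open>The last clause keeps tokens on deleted vertices away from \<open>C\<close>, so slides
  inside \<open>C\<close> need not take them into account.\<close>

definition linked :: "nat set set \<Rightarrow> nat set \<Rightarrow> nat set \<Rightarrow> nat set \<Rightarrow> bool" where
  "linked E C I J \<longleftrightarrow> indep E I \<and> indep E J \<and> reach E C (I \<inter> C) (J \<inter> C) \<and> I - C = J - C \<and>
     (\<forall>x\<in>C. \<forall>y\<in>I - C. {x, y} \<notin> E)"

text \<open>Of the newly deleted vertices, \<open>u\<close> is empty unless \<open>u = v\<close>,
  and the only neighbour of \<open>v\<close> in \<open>C\<close> is \<open>u\<close>, which is
  deleted too. So no remaining vertex neighbours a token left behind; everything else comes from
  \<open>reach_remove_safe_leaf\<close>.\<close>

lemma linked_step:
  assumes "finite C" and "forest E" and sl: "safe_leaf E C u v" and L: "linked E C I J"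
    and I': "reach E C I I'" and J': "reach E C J J'"
    and vI: "v \<in> I' \<or> (\<forall>Z. reach E C (I \<inter> C) Z \<longrightarrow> v \<notin> Z)"
    and vJ: "v \<in> J' \<or> (\<forall>Z. reach E C (J \<inter> C) Z \<longrightarrow> v \<notin> Z)"
  shows "linked E (C - {u, v}) I' J'"
proof -
  have uv: "u \<in> C" "v \<in> C" "\<And>y. y \<in> C \<Longrightarrow> {v, y} \<in> E \<Longrightarrow> y = u"
    using sl unfolding safe_leaf_def by auto
  have rI: "reach E C (I \<inter> C) (I' \<inter> C)" and rJ: "reach E C (J \<inter> C) (J' \<inter> C)"
    using reach_restrict[OF I', of C] reach_restrict[OF J', of C] by auto
  have iI: "indep E (I \<inter> C)" and iJ: "indep E (J \<inter> C)"
    using L unfolding linked_def by (auto intro: indep_subset)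
  have r: "reach E C (I \<inter> C) (J \<inter> C)" and out: "I - C = J - C"
    and no: "\<And>x y. x \<in> C \<Longrightarrow> y \<in> I - C \<Longrightarrow> {x, y} \<notin> E" using L unfolding linked_def by auto
  have vI': "v \<in> I' \<inter> C \<or> (\<forall>Z. reach E C (I \<inter> C) Z \<longrightarrow> v \<notin> Z)"
    and vJ': "v \<in> J' \<inter> C \<or> (\<forall>Z. reach E C (J \<inter> C) Z \<longrightarrow> v \<notin> Z)" using vI vJ uv by auto
  note * = reach_remove_safe_leaf[OF assms(1,2) sl _ _ iI iJ r rI rJ vI' vJ', OF Int_lower2 Int_lower2]
  have oI: "I' - C = I - C" and oJ: "J' - C = J - C" using reach_outside I' J' by blast+
  have eq: "I' \<inter> {u, v} = J' \<inter> {u, v}" using *(1) uv by blast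
  have uI: "u \<in> I' \<Longrightarrow> u = v" using *(2) uv by blast
  have "I' \<inter> (C - {u, v}) = I' \<inter> C - {u, v}" "J' \<inter> (C - {u, v}) = J' \<inter> C - {u, v}" by auto
  then have "reach E (C - {u, v}) (I' \<inter> (C - {u, v})) (J' \<inter> (C - {u, v}))" using *(3) by simp
  moreover have "I' - (C - {u, v}) = (I' - C) \<union> I' \<inter> {u, v}"
    "J' - (C - {u, v}) = (J' - C) \<union> J' \<inter> {u, v}" using uv by auto
  then have "I' - (C - {u, v}) = J' - (C - {u, v})" using eq oI oJ out by simp
  moreover have "{x, y} \<notin> E" if "x \<in> C - {u, v}" "y \<in> I' - (C - {u, v})" for x y
  proof (cases "y \<in> C")
    case True
    then have "y = v" using that uI by blast
    then show ?thesis using uv(3)[of x] that by (auto simp: insert_commute)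
  next
    case False
    then show ?thesis using that oI no by blast
  qed
  moreover have "indep E I'" "indep E J'"
    using reach_indep I' J' L unfolding linked_def by blast+
  ultimately show ?thesis unfolding linked_def by blast
qed

abbreviation synced :: "nat set set \<Rightarrow> nat \<Rightarrow> nat set \<Rightarrow> nat set \<Rightarrow> state \<Rightarrow> bool" where
  "synced E n I0 J0 s \<equiv>
     linked E (rest n s) (tok n (arrs s 2)) (tok n (arrs s 3)) \<and>
     trace E {..<n} I0 (log2 s) (tok n (arrs s 2)) \<and>
     trace E {..<n} J0 (log3 s) (tok n (arrs s 3))"

abbreviation phase_post :: "nat set set \<Rightarrow> nat \<Rightarrow> nat \<Rightarrow> nat set \<Rightarrow> nat set \<Rightarrow> state \<Rightarrow> state \<Rightarrow> bool"
  where "phase_post E n m I0 J0 s s' \<equiv> wf_graph E n m s' \<and> regs s' rX = regs s rX \<and>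
    rest n s' \<subset> rest n s \<and> synced E n I0 J0 s'"

text \<open>The factor 200 collects two searches at 30 and two fetches at 70 each.\<close>

lemma wpt_phase:
  assumes E: "forest E" "\<And>x y. {x, y} \<in> E \<Longrightarrow> y < n" and s: "wf_graph E n m s"
    and x: "regs s rX \<in> rest n s"
    and L: "linked E (rest n s) (tok n (arrs s 2)) (tok n (arrs s 3))"
    and I: "trace E {..<n} I0 (log2 s) (tok n (arrs s 2))"
    and J: "trace E {..<n} J0 (log3 s) (tok n (arrs s 3))"
  shows "wpt phase s (150 + 200 * (n + m)) (phase_post E n m I0 J0 s)"
    (is "wpt _ _ _ ?Q")
proof -
  define C where "C = rest n s"
  have Cn: "C \<subseteq> {..<n}" and finC: "finite C" by (auto simp: C_def rest_def)
  obtain p where N: "regs s rN = n"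
    and arcs: "arcs (arrs s aFst) (arrs s aNxt) (arrs s aTo) p {(x, y). {x, y} \<in> E} n m"
    using s unfolding wf_graph_def by blast
  let ?s0 = "exec (Assign rS (Reg rX)) s"
  have w0: "wpt bfs ?s0 (30 + 30 * (n + m)) (bfs_post E C (regs s rX))"
    by (rule wpt_bfs[OF E, where p = p]) (use N arcs x in \<open>simp_all add: C_def rest_def\<close>)
  have k0: "wpt (select) s1 (110 + 170 * (n + m)) ?Q"
    if ag1: "agree bfs ?s0 s1" and ex: "bfs_post E C (regs s rX) s1" for s1
  proof -
    obtain K1 rk1 where R1: "rooted E C K1 (regs s rX) (arrs s1 aPar) rk1"
      and L1: "listed K1 rk1 (arrs s1 aQ) (regs s1 rT)" using ex unfolding bfs_post_def by blast
    define v u where "v = arrs s1 aQ (regs s1 rT - 1)" and "u = arrs s1 aPar v"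
    have vK: "v \<in> K1" and last: "\<And>x. x \<in> K1 \<Longrightarrow> rk1 x \<le> rk1 v"
      using L1 unfolding listed_def v_def by fastforce+
    have sl: "safe_leaf E C u v" unfolding u_def by (rule rooted.safe_leaf_last[OF R1 vK last])
    then have uv: "u \<in> C" "v \<in> C" unfolding safe_leaf_def by auto
    let ?s1 = "exec (Assign rS (Reg rV)) (exec (Assign rU (Cell aPar (Reg rV)))
      (exec (Assign rV (Cell aQ (Pred (Reg rT)))) s1))"
    have s1: "regs ?s1 rS = v" "regs ?s1 rV = v" "regs ?s1 rU = u" "regs ?s1 rN = n"
      "regs ?s1 rX = regs s rX" "regs ?s1 15 = regs s 15" "regs ?s1 16 = regs s 16"
      "\<And>a. a \<notin> {8, 9, 10} \<Longrightarrow> arrs ?s1 a = arrs s a"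
      using bfs_agree[OF ag1] N by (simp_all add: v_def u_def)
    have w1: "wpt bfs ?s1 (30 + 30 * (n + m)) (bfs_post E C v)"
      by (rule wpt_bfs[OF E, where p = p])
        (use arcs s1 uv in \<open>simp_all add: C_def rest_def del: exec.simps\<close>)
    have k1: "wpt (fetch_both) s2 (70 + 140 * (n + m)) ?Q"
      if ag2: "agree bfs ?s1 s2" and ex2: "bfs_post E C v s2" for s2
    proof -
      obtain K rk where R: "rooted E C K v (arrs s2 aPar) rk"
        and Li: "listed K rk (arrs s2 aQ) (regs s2 rT)" using ex2 unfolding bfs_post_def by blast
      have KC: "K \<subseteq> C" using R unfolding rooted_def by blast
      have s2: "regs s2 rS = v" "regs s2 rV = v" "regs s2 rU = u" "regs s2 rN = n"
        "regs s2 rX = regs s rX" "regs s2 15 = regs s 15" "regs s2 16 = regs s 16"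
        "\<And>a. a \<notin> {8, 9, 10} \<Longrightarrow> arrs s2 a = arrs s a"
        using bfs_agree[OF ag2] s1 by (simp_all del: exec.simps)
      define X Y where "X = tok n (arrs s 2)" and "Y = tok n (arrs s 3)"
      have LXY: "linked E C X Y" using L by (simp add: C_def X_def Y_def)
      interpret f2: fetch_run 2 16 17 15 E C K v "arrs s2 aPar" rk X n "arrs s2 aQ" "regs s2 rT"
        by (rule fetch_run_intro[OF side2 R Li Cn]) (use LXY in \<open>auto simp: linked_def\<close>)
      interpret f3: fetch_run 3 18 19 16 E C K v "arrs s2 aPar" rk Y n "arrs s2 aQ" "regs s2 rT"
        by (rule fetch_run_intro[OF side3 R Li Cn]) (use LXY in \<open>auto simp: linked_def\<close>)
      have "f2.base s2" "tok n (arrs s2 2) = X" using s2 by (simp_all add: f2.base_def X_def)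
      note w2 = f2.wpt_fetch[OF this]
      have k2: "wpt (fetch_com 3 18 19 16 ;; delete) s3 (40 + 70 * n) ?Q"
        if ag3: "agree (fetch_com 2 16 17 15) s2 s3" and F2: "f2.moved s2 s3 \<and>
          (v \<in> tok n (arrs s3 2) \<or> (\<forall>Z. reach E C (X \<inter> C) Z \<longrightarrow> v \<notin> Z))" for s3
      proof -
        have s3: "regs s3 rS = v" "regs s3 rV = v" "regs s3 rU = u" "regs s3 rN = n"
          "regs s3 rX = regs s rX" "regs s3 16 = regs s 16" "regs s3 rT = regs s2 rT"
          "arrs s3 aQ = arrs s2 aQ" "arrs s3 aPar = arrs s2 aPar"
          "\<And>a. a \<notin> {2, 8, 9, 10, 11, 12, 13, 14, 15, 16, 17} \<Longrightarrow> arrs s3 a = arrs s a"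
          using fetch_com_agree[OF ag3] s2 by simp_all
        have "f3.base s3" "tok n (arrs s3 3) = Y" using s3 by (simp_all add: f3.base_def Y_def)
        note w3 = f3.wpt_fetch[OF this]
        have k3: "wpt (delete) s4 2 ?Q"
          if ag4: "agree (fetch_com 3 18 19 16) s3 s4" and F3: "f3.moved s3 s4 \<and>
            (v \<in> tok n (arrs s4 3) \<or> (\<forall>Z. reach E C (Y \<inter> C) Z \<longrightarrow> v \<notin> Z))" for s4
        proof -
          have s4: "regs s4 rV = v" "regs s4 rU = u" "regs s4 rN = n"
            "regs s4 rX = regs s rX" "regs s4 15 = regs s3 15"
            "arrs s4 2 = arrs s3 2" "arrs s4 16 = arrs s3 16" "arrs s4 17 = arrs s3 17"
            "\<And>a. a \<notin> {2, 3, 8, 9, 10, 11, 12, 13, 14, 15, 16, 17, 18, 19} \<Longrightarrow> arrs s4 a = arrs s a"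
            using fetch_com_agree[OF ag4] s3 by simp_all
          let ?s5 = "exec (delete) s4"
          obtain M2 where M2: "log2 s4 =
              log2 s @ M2" "trace E K X M2 (tok n (arrs s4 2))"
            using F2 s2 s4 unfolding f2.moved_def by auto
          obtain M3 where M3: "log3 s4 =
              log3 s @ M3" "trace E K Y M3 (tok n (arrs s4 3))"
            using F3 s3 unfolding f3.moved_def by auto
          have rest: "rest n ?s5 = C - {u, v}"
            using s4 uv Cn unfolding C_def rest_def by auto
          have lk: "linked E (C - {u, v}) (tok n (arrs s4 2)) (tok n (arrs s4 3))"
            by (rule linked_step[OF finC E(1) sl LXY])
              (use reach_mono[OF trace_reach[OF M2(2)] KC] reach_mono[OF trace_reach[OF M3(2)] KC]
                F2 F3 s4 in auto)
          have wf: "wf_graph E n m ?s5" using arcs s4 unfolding wf_graph_def by auto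
          have Kn: "K \<subseteq> {..<n}" using KC Cn by blast
          have "C - {u, v} \<subset> C" using uv by blast
          moreover have "regs ?s5 = regs s4" "\<And>a. a \<noteq> aRem \<Longrightarrow> arrs ?s5 a = arrs s4 a"
            by simp_all
          ultimately have "?Q ?s5"
            using wf s4 rest lk trace_append[OF M2(2) I[folded X_def] Kn]
              trace_append[OF M3(2) J[folded Y_def] Kn] M2(1) M3(1) C_def
            by (simp del: exec.simps)
          then show ?thesis by (rule wpt_straight) simp_all
        qed
        show ?thesis by (rule wpt_Seq_agree[OF w3 k3]) auto
      qed
      show ?thesis by (rule wpt_Seq_agree[OF w2 k2]) auto
    qed
    have "wpt (bfs ;; fetch_both) ?s1 (100 + 170 * (n + m)) ?Q"
      by (rule wpt_Seq_agree[OF w1 k1]) auto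
    then have "wpt (bfs ;; fetch_both) ?s1
      (110 + 170 * (n + m) - 1 - 1 - 1) ?Q" by (rule wpt_mono) auto
    then show ?thesis
      by - (rule wpt_Seq_straight, simp, simp, rule wpt_Seq_straight, simp, simp,
        rule wpt_Seq_straight, simp, simp, simp)
  qed
  have "wpt (bfs ;; select) ?s0
     (149 + 200 * (n + m)) ?Q"
    by (rule wpt_Seq_agree[OF w0 k0]) auto
  then show ?thesis
    unfolding phase_def by - (rule wpt_Seq_straight, simp, simp, simp)
qed

abbreviation joined :: "nat set set \<Rightarrow> nat \<Rightarrow> nat set \<Rightarrow> nat set \<Rightarrow> state \<Rightarrow> bool" where
  "joined E n I0 J0 s \<equiv>
     \<exists>Z. trace E {..<n} I0 (log2 s) Z \<and> trace E {..<n} J0 (log3 s) Z"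

lemma wpt_main_loop:
  assumes E: "forest E" "\<And>x y. {x, y} \<in> E \<Longrightarrow> y < n" and s: "wf_graph E n m s" "regs s rX = 0"
    "rest n s = {..<n}" "regs s 15 = 0" "regs s 16 = 0"
    and I: "tok n (arrs s 2) = I0" "indep E I0" and J: "tok n (arrs s 3) = J0"
    and reach: "reach E {..<n} I0 J0"
  shows "wpt main_loop s (1 + 2 * n * (152 + 200 * (n + m))) (joined E n I0 J0)"
proof -
  \<comment> \<open>Every iteration either deletes a vertex or advances \<open>rX\<close>, each of
    which can happen at most \<open>n\<close> times.\<close>
  define P where "P k s' \<longleftrightarrow> k = n - regs s' rX + card (rest n s') \<and> wf_graph E n m s' \<and>
    (\<forall>i < regs s' rX. i \<notin> rest n s') \<and>
    synced E n I0 J0 s'"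
    for k and s' :: state
  have fin: "finite (rest n s')" for s' by (simp add: rest_def)
  show ?thesis
    unfolding main_loop_def
  proof (rule wpt_While[where P = P])
    have n: "I0 \<subseteq> {..<n}" "J0 \<subseteq> {..<n}" using I J by (auto simp: tok_def)
    then have "I0 \<inter> {..<n} = I0" "J0 \<inter> {..<n} = J0" by auto
    moreover have "I0 - {..<n} = {}" "J0 - {..<n} = {}" using n by blast+
    ultimately have "linked E {..<n} I0 J0"
      using I(2) reach reach_indep[OF reach] unfolding linked_def
      by (metis empty_iff)
    then show "P (2 * n) s"
      using s I J unfolding P_def by (simp add: hist_def trace_Nil)
  next
    fix k s' assume P: "P k s'" and b: "eval_test (Less (Reg rX) (Reg rN)) s'"
    have Xn: "regs s' rX < n" using b P by (simp add: P_def wf_graph_def)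
    show "wpt (Cond (Equal (Cell aRem (Reg rX)) (Const 0)) phase (inc rX)) s'
      (1 + (150 + 200 * (n + m))) (\<lambda>s''. \<exists>k'<k. P k' s'')"
    proof (rule wpt_Cond)
      assume "eval_test (Equal (Cell aRem (Reg rX)) (Const 0)) s'"
      then have x: "regs s' rX \<in> rest n s'" using Xn by (simp add: rest_def)
      have "wpt phase s' (150 + 200 * (n + m)) (phase_post E n m I0 J0 s')"
        by (rule wpt_phase[OF E _ x]) (use P in \<open>simp_all add: P_def\<close>)
      then show "wpt phase s' (150 + 200 * (n + m)) (\<lambda>s''. \<exists>k'<k. P k' s'')"
      proof (rule wpt_mono)
        fix s'' assume *: "phase_post E n m I0 J0 s' s''"
        then have "card (rest n s'') < card (rest n s')" using fin by (intro psubset_card_mono) auto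
        then have "n - regs s'' rX + card (rest n s'') < k" using * P by (simp add: P_def)
        moreover have "P (n - regs s'' rX + card (rest n s'')) s''"
          using * P unfolding P_def by (simp, blast)
        ultimately show "\<exists>k'<k. P k' s''" by blast
      qed simp
    next
      assume "\<not> eval_test (Equal (Cell aRem (Reg rX)) (Const 0)) s'"
      then have "regs s' rX \<notin> rest n s'" by (simp add: rest_def)
      then have "P (k - 1) (exec (inc rX) s')" "k - 1 < k"
        using P Xn unfolding P_def by (auto simp: wf_graph_def rest_def less_Suc_eq)
      then show "wpt (inc rX) s' (150 + 200 * (n + m)) (\<lambda>s''. \<exists>k'<k. P k' s'')"
        by (intro wpt_straight) auto
    qed
  next
    fix k s' assume P: "P k s'" and "\<not> eval_test (Less (Reg rX) (Reg rN)) s'"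
    then have "n \<le> regs s' rX" by (simp add: P_def wf_graph_def)
    then have "rest n s' = {}" using P by (auto simp: P_def rest_def)
    then have "tok n (arrs s' 2) = tok n (arrs s' 3)" using P by (simp add: P_def linked_def)
    then show "joined E n I0 J0 s'"
      using P by (auto simp: P_def)
  qed simp
qed


section \<open>Trees and their encodings\<close>

text \<open>When the walk returns to a vertex of the path, the path is cut back to that
  vertex.\<close>

lemma path_exists:
  assumes "(q, q') \<in> conn E D" and "q \<in> D"
  shows "\<exists>xs. xs \<noteq> [] \<and> hd xs = q \<and> last xs = q' \<and> distinct xs \<and> set xs \<subseteq> D \<and>
    successively (\<lambda>x y. {x, y} \<in> E) xs"
  using assms(1) unfolding conn_def
proof (induction rule: rtrancl_induct)
  case base
  then show ?case using assms(2) by (intro exI[of _ "[q]"]) simp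
next
  case (step y z)
  then obtain xs where xs: "xs \<noteq> []" "hd xs = q" "last xs = y" "distinct xs" "set xs \<subseteq> D"
    "successively (\<lambda>x y. {x, y} \<in> E) xs" by blast
  show ?case
  proof (cases "z \<in> set xs")
    case True
    then obtain us ws where us: "xs = us @ z # ws" by (meson split_list)
    then have "hd (us @ [z]) = q" using xs(2) by (cases us) auto
    then show ?thesis
      using xs us by (intro exI[of _ "us @ [z]"]) (auto simp: successively_append_iff)
  next
    case False
    then show ?thesis
      using xs step.hyps by (intro exI[of _ "xs @ [z]"]) (auto simp: successively_append_iff)
  qed
qed

text \<open>A path between two neighbours of \<open>p\<close> that avoids \<open>p\<close> closes to
  a cycle through \<open>p\<close>.\<close>

lemma forest_if_no_cycle:
  assumes "\<nexists>c. cycle E c" and "\<And>x. {x} \<notin> E"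
  shows "forest E"
  unfolding forest_def
proof (intro conjI allI impI notI)
  fix p q q' assume e: "{p, q} \<in> E" "{p, q'} \<in> E" and ne: "q \<noteq> q'"
    and c: "(q, q') \<in> conn E (- {p})"
  have "q \<in> - {p}" using assms(2) e by auto
  then obtain xs where xs: "xs \<noteq> []" "hd xs = q" "last xs = q'" "distinct xs" "set xs \<subseteq> - {p}"
    "successively (\<lambda>x y. {x, y} \<in> E) xs" using path_exists[OF c] by blast
  obtain x ys where ys: "xs = x # ys" using xs(1) by (cases xs) auto
  then have "ys \<noteq> []" using xs(2,3) ne by auto
  then have "3 \<le> length (p # xs)" using ys by (cases ys) auto
  then have "cycle E (p # xs)"
    using xs e ys unfolding cycle_def by (auto simp: insert_commute)
  then show False using assms(1) by blast
qed (use assms(2) in blast)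

lemma forest_tree: "tree V E \<Longrightarrow> forest E"
  unfolding tree_def simple_graph_def by (intro forest_if_no_cycle) fastforce+

text \<open>With the distance \<open>d\<close> from a root as rank, \<open>edge_parent\<close> shows
  that every edge joins some vertex to its parent, so the vertices enumerate the edges. The surplus
  of one does not affect the quadratic bound.\<close>

lemma card_edges_tree:
  assumes "tree V E"
  shows "card E \<le> card V"
proof -
  let ?R = "{(x, y). {x, y} \<in> E}"
  have fin: "finite V" and EV: "\<And>e. e \<in> E \<Longrightarrow> e \<subseteq> V \<and> card e = 2"
    using assms unfolding tree_def simple_graph_def by auto
  obtain r where r: "r \<in> V" and con: "\<And>x. x \<in> V \<Longrightarrow> (r, x) \<in> ?R\<^sup>*"
    using assms unfolding tree_def connected_graph_def by blast
  define d where "d x = (LEAST k. (r, x) \<in> ?R ^^ k)" for x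
  have ex: "\<exists>y. y \<in> V \<and> {y, x} \<in> E \<and> d y < d x" if x: "x \<in> V" "x \<noteq> r" for x
  proof -
    have "\<exists>k. (r, x) \<in> ?R ^^ k" using con[OF x(1)] by (simp add: rtrancl_power)
    then have dx: "(r, x) \<in> ?R ^^ d x" unfolding d_def by (rule LeastI_ex)
    obtain k where k: "d x = Suc k" using dx x(2) by (cases "d x") auto
    then obtain y where y: "(r, y) \<in> ?R ^^ k" "{y, x} \<in> E" using dx by auto
    have "d y \<le> k" unfolding d_def using y(1) by (rule Least_le)
    then show ?thesis using y k EV[OF y(2)] by auto
  qed
  define par where "par x = (SOME y. y \<in> V \<and> {y, x} \<in> E \<and> d y < d x)" for x
  have par: "par x \<in> V \<and> {par x, x} \<in> E \<and> d (par x) < d x" if "x \<in> V" "x \<noteq> r" for x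
    unfolding par_def using someI_ex[OF ex[OF that]] .
  have "E \<subseteq> (\<lambda>x. {par x, x}) ` V"
  proof
    fix e assume e: "e \<in> E"
    then obtain a b where ab: "e = {a, b}" using EV by (meson card_2_iff)
    have V: "a \<in> V" "b \<in> V" using EV[OF e] ab by auto
    have e': "{a, b} \<in> E" "{b, a} \<in> E" using e ab by (simp_all add: insert_commute)
    note ep = edge_parent[OF forest_tree[OF assms] r, of par d, OF par]
    show "e \<in> (\<lambda>x. {par x, x}) ` V"
    proof (cases "d a \<le> d b")
      case True
      then have "par b = a" using ep[OF _ _ V e'(1)] by blast
      then show ?thesis using ab V by auto
    next
      case False
      then have "par a = b" using ep[OF _ _ V(2,1) e'(2)] by simp
      then show ?thesis using ab V by auto
    qed
  qed
  then have "card E \<le> card ((\<lambda>x. {par x, x}) ` V)" using fin by (intro card_mono) auto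
  also have "\<dots> \<le> card V" using fin by (rule card_image_le)
  finally show ?thesis .
qed

section \<open>Writing the output\<close>

definition flat :: "(nat \<times> nat) list \<Rightarrow> nat list" where
  "flat M = concat (map (\<lambda>(a, b). [a, b]) M)"

lemma flat_simps [simp]: "flat [] = []" "flat (M @ N) = flat M @ flat N"
  "flat ((a, b) # M) = a # b # flat M"
  by (simp_all add: flat_def)

lemma length_flat: "length (flat M) = 2 * length M"
  by (induction M) auto

definition write_forward :: com where
  "write_forward = While (Less (Reg rI) (Reg 15))
     (Write (Cell 16 (Reg rI)) ;; Write (Cell 17 (Reg rI)) ;; inc rI)"

text \<open>Array 19 holds the targets of the recorded slides, which become the sources when a slide
  is undone; hence it is written before array 18.\<close>

definition write_backward :: com where
  "write_backward = While (Less (Const 0) (Reg rI))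
     (dec rI ;; Write (Cell 19 (Reg rI)) ;; Write (Cell 18 (Reg rI)))"

lemma wpt_write_forward:
  assumes "regs s rI = 0" and "1 + regs s 15 * 4 \<le> T"
  shows "wpt write_forward s T (\<lambda>s'. outp s' = outp s @ flat (log2 s))"
  unfolding write_forward_def
  by (rule wpt_for[where P = "\<lambda>i s'. outp s' = outp s @ flat (hist (arrs s 16) (arrs s 17) i)"])
    (use assms in \<open>auto simp: hist_def agree_def\<close>)

lemma wpt_write_backward:
  assumes "regs s rI = k" and T: "1 + k * 4 \<le> T"
  shows "wpt write_backward s T
    (\<lambda>s'. outp s' = outp s @ flat (rev (map prod.swap (hist (arrs s 18) (arrs s 19) k))))"
proof -
  define P where "P i s' \<longleftrightarrow>
    outp s' = outp s @ flat (map (\<lambda>j. (arrs s 19 j, arrs s 18 j)) (rev [i..<k]))"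
    for i and s' :: state
  have "wpt write_backward s T (P 0)"
    unfolding write_backward_def
    by (rule wpt_countdown) (use assms in \<open>auto simp: P_def agree_def upt_conv_Cons\<close>)
  then show ?thesis by (rule wpt_mono) (simp_all add: P_def hist_def rev_map comp_def)
qed

lemma trace_rev: "trace E C X M Y \<Longrightarrow> trace E C Y (rev (map prod.swap M)) X"
proof (induction rule: trace.induct)
  case (trace_snoc M Y a b Z)
  have "trace E C Z ([] @ [(b, a)]) Y"
    using trace_snoc.hyps step_swap by (intro trace.trace_snoc[OF trace_Nil])
  then show ?case using trace_append[OF trace_snoc.IH, of C Z "[(b, a)]"] by simp
qed (simp add: trace_Nil)

abbreviation (input) write_both :: com where
  "write_both \<equiv> write_forward ;; Assign rI (Reg 16) ;; write_backward"

definition program :: com where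
  "program = build ;; main_loop ;; Assign rI (Const 0) ;; write_both"

text \<open>This is the bound of \<open>wpt_main_loop\<close> for at most \<open>2 * n\<close> arcs,
  every edge being stored in both directions.\<close>

definition main_time :: "nat \<Rightarrow> nat" where
  "main_time n = 1 + 2 * n * (152 + 600 * n)"

text \<open>Besides \<open>20 + 20 * n\<close> for building the lists, the main loop is paid once,
  and each of the two logs, no longer than \<open>main_time n\<close>, costs 4 steps per entry to
  write; this gives the factor 9.\<close>

definition run_time :: "nat \<Rightarrow> nat" where
  "run_time n = 30 + 20 * n + 9 * main_time n"

lemma counts_main: "counts 15 main_loop" "counts 16 main_loop"
  by (simp_all add: main_loop_def phase_def bfs_defs fetch_com_defs)

definition edge_set :: "(nat \<times> nat) list \<Rightarrow> nat set set" where
  "edge_set es = (\<lambda>(i, j). {i, j}) ` set es"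

lemma wpt_program:
  fixes es :: "(nat \<times> nat) list"
  defines "E \<equiv> edge_set es"
  assumes es: "\<And>x y. (x, y) \<in> set es \<Longrightarrow> x < n \<and> y < n" and len: "length es \<le> n"
    and E: "forest E"
    and s: "regs s = (\<lambda>_. 0)(0 := n, 1 := length es)" "arrs s aFst = (\<lambda>_. 0)"
      "arrs s aRem = (\<lambda>_. 0)" "outp s = []"
    and arr: "\<And>i. i < length es \<Longrightarrow> es ! i = (arrs s 0 i, arrs s 1 i)"
    and I: "tok n (arrs s 2) = I" "indep E I" and J: "tok n (arrs s 3) = J"
    and reach: "reach E {..<n} I J"
  shows "wpt program s (run_time n) (\<lambda>s'. \<exists>M. trace E {..<n} I M J \<and> outp s' = flat M)"
    (is "wpt _ _ _ ?Q")
proof -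
  have arcs: "{(x, y). {x, y} \<in> E} = both_arcs es"
    by (auto simp: E_def edge_set_def both_arcs_def doubleton_eq_iff image_iff)
  have En: "y < n" if "{x, y} \<in> E" for x y
    using that es arcs unfolding both_arcs_def by blast
  have w1: "wpt build s (20 + 20 * n) (\<lambda>s'. \<exists>p.
    arcs (arrs s' aFst) (arrs s' aNxt) (arrs s' aTo) p (both_arcs es) n (2 * length es))"
    by (rule wpt_mono[OF wpt_build[OF _ s(2) es arr]]) (use s len in auto)
  have k1: "wpt (main_loop ;; Assign rI (Const 0) ;; write_both) s1 (10 + 9 * main_time n) ?Q"
    if ex: "\<exists>p. arcs (arrs s1 aFst) (arrs s1 aNxt) (arrs s1 aTo) p (both_arcs es) n (2 * length es)"
      and ag: "agree build s s1" for s1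
  proof -
    have s1: "regs s1 rN = n" "regs s1 rX = 0" "regs s1 15 = 0" "regs s1 16 = 0"
      "arrs s1 aRem = (\<lambda>_. 0)" "arrs s1 2 = arrs s 2" "arrs s1 3 = arrs s 3" "outp s1 = []"
      using ag s by (simp_all add: agree_def build_def build_body_def add_arc_def)
    have wf: "wf_graph E n (2 * length es) s1" using ex s1 arcs by (simp add: wf_graph_def)
    have "wpt main_loop s1 (1 + 2 * n * (152 + 200 * (n + 2 * length es))) (joined E n I J)"
      by (rule wpt_main_loop[OF E En wf]) (use s1 I J reach in \<open>simp_all add: rest_def lessThan_def\<close>)
    then have "wpt main_loop s1 (main_time n) (joined E n I J)"
    proof (rule wpt_mono)
      have "n * (152 + 200 * (n + 2 * length es)) \<le> n * (152 + 600 * n)"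
        using len by (intro mult_le_mono2) simp
      then show "1 + 2 * n * (152 + 200 * (n + 2 * length es)) \<le> main_time n"
        unfolding main_time_def mult.assoc by simp
    qed
    note w2 = wpt_counts[OF wpt_counts[OF this counts_main(1)] counts_main(2), unfolded s1, simplified]
    have k2: "wpt (Assign rI (Const 0) ;; write_both)
      s2 (10 + 8 * main_time n) ?Q"
      if s2: "(joined E n I J s2 \<and>
          regs s2 15 \<le> main_time n) \<and> regs s2 16 \<le> main_time n"
        and ag2: "agree main_loop s1 s2" for s2
    proof -
      obtain Z where Z: "trace E {..<n} I (log2 s2) Z"
        "trace E {..<n} J (log3 s2) Z"
        using s2 by blast
      have o: "outp s2 = []"
        using ag2 s1 by (simp add: agree_def main_loop_def phase_def bfs_defs fetch_com_defs)
      let ?s2 = "exec (Assign rI (Const 0)) s2"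
      have w3: "wpt write_forward ?s2 (1 + regs ?s2 15 * 4)
        (\<lambda>s'. outp s' = outp ?s2 @ flat (hist (arrs ?s2 16) (arrs ?s2 17) (regs ?s2 15)))"
        by (rule wpt_write_forward) simp_all
      have k3: "wpt (Assign rI (Reg 16) ;; write_backward) s3 (2 + 4 * main_time n) ?Q"
        if o3: "outp s3 = outp ?s2 @ flat (hist (arrs ?s2 16) (arrs ?s2 17) (regs ?s2 15))"
          and ag3: "agree write_forward ?s2 s3" for s3
      proof (rule wpt_Seq_straight, simp, simp)
        let ?s3 = "exec (Assign rI (Reg 16)) s3"
        have s3: "arrs ?s3 = arrs s2" "regs ?s3 rI = regs s2 16"
          "outp ?s3 = flat (log2 s2)"
          using ag3 o3 o by (auto simp: agree_def write_forward_def)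
        show "wpt write_backward ?s3 (2 + 4 * main_time n - cost (Assign rI (Reg 16))) ?Q"
        proof (rule wpt_mono[OF wpt_write_backward[OF s3(2) order_refl]])
          fix s' :: state assume "outp s' = outp ?s3 @
            flat (rev (map prod.swap (hist (arrs ?s3 18) (arrs ?s3 19) (regs s2 16))))"
          then show "?Q s'"
            unfolding s3 using trace_append[OF trace_rev[OF Z(2)] Z(1)] by auto
        qed (use s2 in simp)
      qed
      have "wpt (write_both) ?s2
        (9 + 8 * main_time n) ?Q"
        by (rule wpt_Seq_agree[OF w3 k3]) (use s2 in auto)
      then show ?thesis by - (rule wpt_Seq_straight, simp, simp, simp)
    qed
    show ?thesis by (rule wpt_Seq_agree[OF w2 k2]) auto
  qed
  show ?thesis
    unfolding program_def by (rule wpt_Seq_agree[OF w1 k1]) (auto simp: run_time_def)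
qed

section \<open>Translation between vertices and their numbers\<close>

definition index :: "'a list \<Rightarrow> 'a set \<Rightarrow> nat set" where
  "index vs X = {i. i < length vs \<and> vs ! i \<in> X}"

context
  fixes V :: "'a set" and E :: "'a set set" and vs :: "'a list" and es :: "(nat \<times> nat) list"
  assumes enc: "graph_encoding V E vs es"
begin

abbreviation "F \<equiv> edge_set es"

lemma F_E: "{x, y} \<in> F \<longleftrightarrow> (x, y) \<in> set es \<or> (y, x) \<in> set es"
  by (auto simp: edge_set_def doubleton_eq_iff image_iff)

lemma dist_vs: "distinct vs" and set_vs: "set vs = V"
  and es_less: "\<And>x y. (x, y) \<in> set es \<Longrightarrow> x < length vs \<and> y < length vs"
  and E_eq: "E = (\<lambda>(i, j). {vs ! i, vs ! j}) ` set es"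
  using enc unfolding graph_encoding_def by auto

lemma nth_V: "i < length vs \<Longrightarrow> vs ! i \<in> V"
  using set_vs nth_mem by blast

lemma F_less: "{x, y} \<in> F \<Longrightarrow> x < length vs \<and> y < length vs"
  using es_less unfolding F_E by blast

lemma F_iff:
  assumes "i < length vs" and "j < length vs"
  shows "{i, j} \<in> F \<longleftrightarrow> {vs ! i, vs ! j} \<in> E"
proof
  assume "{vs ! i, vs ! j} \<in> E"
  then obtain a b where ab: "(a, b) \<in> set es" "{vs ! i, vs ! j} = {vs ! a, vs ! b}"
    unfolding E_eq by auto
  note l = es_less[OF ab(1)]
  have eq: "vs ! x = vs ! y \<longleftrightarrow> x = y" if "x < length vs" "y < length vs" for x y
    using that dist_vs nth_eq_iff_index_eq by blast
  have "i = a \<and> j = b \<or> i = b \<and> j = a"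
    using ab(2) eq assms l unfolding doubleton_eq_iff by blast
  then show "{i, j} \<in> F" using ab(1) F_E by blast
next
  assume "{i, j} \<in> F"
  then have "(i, j) \<in> set es \<or> (j, i) \<in> set es" unfolding F_E .
  then show "{vs ! i, vs ! j} \<in> E" unfolding E_eq by (force simp: insert_commute)
qed

lemma forest_F:
  assumes "forest E"
  shows "forest F"
  unfolding forest_def
proof (intro conjI allI impI notI)
  fix x assume "{x} \<in> F"
  then have "{x, x} \<in> F" by simp
  then have "{vs ! x, vs ! x} \<in> E" using F_less F_iff by blast
  then show False using assms unfolding forest_def by simp
next
  fix p q q' assume e: "{p, q} \<in> F" "{p, q'} \<in> F" and ne: "q \<noteq> q'"
    and c: "(q, q') \<in> conn F (- {p})"
  have less: "p < length vs" "q < length vs" "q' < length vs" using F_less e by blast+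
  have "(vs ! q, vs ! q') \<in> conn E (- {vs ! p})"
    using c unfolding conn_def[of F]
  proof (induction rule: rtrancl_induct)
    case (step y z)
    then have yz: "{y, z} \<in> F" "y \<noteq> p" "z \<noteq> p" by auto
    then have l: "y < length vs" "z < length vs" using F_less by blast+
    then have "(vs ! y, vs ! z) \<in> conn E (- {vs ! p})"
      using yz less dist_vs F_iff by (intro conn_edge) (auto simp: nth_eq_iff_index_eq)
    then show ?case using step.IH conn_trans by metis
  qed (rule conn_refl)
  moreover have "{vs ! p, vs ! q} \<in> E" "{vs ! p, vs ! q'} \<in> E" using e F_iff less by blast+
  moreover have "vs ! q \<noteq> vs ! q'" using ne less dist_vs by (simp add: nth_eq_iff_index_eq)
  ultimately show False using assms unfolding forest_def by blast
qed

lemma indep_index: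
  assumes "indep_set V E X"
  shows "indep F (index vs X)"
  unfolding indep_def
proof (intro ballI notI)
  fix u v assume "u \<in> index vs X" "v \<in> index vs X" "{u, v} \<in> F"
  then show False
    using assms F_iff[of u v] unfolding indep_set_def index_def by blast
qed

lemma slide_index:
  assumes "indep_set V E X" and "indep_set V E Y" and "slide E X Y"
  shows "step_in F {..<length vs} (index vs X) (index vs Y)"
proof -
  obtain a b where ab: "{a, b} \<in> E" "X - Y = {a}" "Y - X = {b}"
    using assms(3) unfolding slide_def by blast
  have "a \<in> V" "b \<in> V" using assms(1,2) ab unfolding indep_set_def by blast+
  then obtain i j where ij: "i < length vs" "vs ! i = a" "j < length vs" "vs ! j = b"
    using set_vs by (metis in_set_conv_nth)
  have Y: "Y = insert b (X - {a})" using ab by blast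
  have eq: "vs ! k = a \<longleftrightarrow> k = i" "vs ! k = b \<longleftrightarrow> k = j" if "k < length vs" for k
    using that ij dist_vs nth_eq_iff_index_eq by metis+
  have "index vs Y = insert j (index vs X - {i})"
    unfolding index_def Y using eq ij by auto
  moreover have "i \<in> index vs X" "j \<notin> index vs X" using ab ij unfolding index_def by auto
  moreover have "{i, j} \<in> F" using F_iff ij ab by simp
  ultimately have "step F i j (index vs X) (index vs Y)"
    using indep_index assms(1,2) unfolding step_def by blast
  then show ?thesis using ij unfolding step_in_def by blast
qed

lemma reconfigurable_index:
  assumes "reconf_seq V E X Y S"
  shows "reach F {..<length vs} (index vs X) (index vs Y)"
  using assms
proof (induction S arbitrary: X)
  case (Cons Z S)
  show ?case
  proof (cases S)
    case Nil
    then have "X = Y" using Cons.prems unfolding reconf_seq_def by auto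
    then show ?thesis by simp
  next
    case (Cons Z' S')
    then have "reconf_seq V E Z' Y S" "slide E X Z'" "indep_set V E X" "indep_set V E Z'"
      using Cons.prems unfolding reconf_seq_def by auto
    then show ?thesis using Cons.IH slide_index by (meson converse_rtranclp_into_rtranclp)
  qed
qed (simp add: reconf_seq_def)

lemma indep_set_image:
  assumes "indep F X" and "X \<subseteq> {..<length vs}"
  shows "indep_set V E ((!) vs ` X)"
  unfolding indep_set_def
proof (intro conjI ballI)
  show "(!) vs ` X \<subseteq> V" using assms(2) nth_V by auto
  fix u v assume "u \<in> (!) vs ` X" "v \<in> (!) vs ` X"
  then obtain i j where ij: "i \<in> X" "u = vs ! i" "j \<in> X" "v = vs ! j" by blast
  then have "i < length vs" "j < length vs" using assms(2) by auto
  then show "{u, v} \<notin> E" using assms(1) ij F_iff unfolding indep_def by blast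
qed

lemma trace_reconf_seq:
  assumes "trace F {..<length vs} X M Y" and "indep F X" and "X \<subseteq> {..<length vs}"
  shows "Y \<subseteq> {..<length vs} \<and> (\<exists>S. reconf_seq V E ((!) vs ` X) ((!) vs ` Y) S \<and>
    length S = Suc (length M) \<and> output_of vs S (flat M))"
  using assms
proof (induction rule: trace.induct)
  case trace_Nil
  then show ?case
    by (intro conjI exI[of _ "[(!) vs ` X]"])
      (auto simp: reconf_seq_def output_of_def indep_set_image)
next
  case (trace_snoc M Y a b Z)
  let ?f = "(!) vs"
  obtain S where Y: "Y \<subseteq> {..<length vs}" and S: "reconf_seq V E (?f ` X) (?f ` Y) S"
    "length S = Suc (length M)" "output_of vs S (flat M)"
    using trace_snoc.IH trace_snoc.prems by blast
  have st: "a \<in> Y" "b \<notin> Y" "{a, b} \<in> F" "Z = insert b (Y - {a})" "indep F Z"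
    using trace_snoc.hyps unfolding step_def by auto
  have ab: "a < length vs" "b < length vs" using trace_snoc.hyps by auto
  have ZV: "Z \<subseteq> {..<length vs}" using Y st ab by auto
  have inj: "?f i = ?f j \<longleftrightarrow> i = j" if "i < length vs" "j < length vs" for i j
    using that dist_vs nth_eq_iff_index_eq by blast
  have abne: "a \<noteq> b" using st by blast
  have d1: "?f ` Y - ?f ` Z = {?f a}" and d2: "?f ` Z - ?f ` Y = {?f b}"
    using st Y ab inj abne by (auto simp: subset_iff)
  have sl: "slide E (?f ` Y) (?f ` Z)"
    using d1 d2 F_iff[OF ab] st(3) unfolding slide_def by blast
  have last: "S \<noteq> []" "last S = ?f ` Y" "hd S = ?f ` X" using S unfolding reconf_seq_def by auto
  have "reconf_seq V E (?f ` X) (?f ` Z) (S @ [?f ` Z])"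
    using S(1) sl last indep_set_image[OF st(5) ZV]
    unfolding reconf_seq_def by (auto simp: successively_append_iff)
  moreover have "output_of vs (S @ [?f ` Z]) (flat (M @ [(a, b)]))"
  proof -
    have lf: "length (flat M) = 2 * length M" by (rule length_flat)
    have "S ! length M = ?f ` Y" using last S(2) by (metis diff_Suc_1 last_conv_nth)
    then have "(S @ [?f ` Z]) ! k - (S @ [?f ` Z]) ! (k + 1) = {vs ! ((flat M @ [a, b]) ! (2 * k))} \<and>
      (S @ [?f ` Z]) ! (k + 1) - (S @ [?f ` Z]) ! k = {vs ! ((flat M @ [a, b]) ! (2 * k + 1))}"
      if "k < Suc (length M)" for k
      using that S(2,3) lf d1 d2 unfolding output_of_def
      \<comment> \<open>The last pair of the output is the new slide; all earlier positions are
        covered by the induction hypothesis.\<close>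
      by (cases "k = length M") (simp_all add: nth_append)
    then show ?thesis using S(2,3) lf ab unfolding output_of_def by auto
  qed
  ultimately show ?case using ZV S(2) by (intro conjI exI[of _ "S @ [?f ` Z]"]) auto
qed

lemma image_index: "X \<subseteq> V \<Longrightarrow> (!) vs ` index vs X = X"
  using set_vs unfolding index_def by (force simp: in_set_conv_nth)

lemma program_correct:
  assumes tree: "tree V E" and I: "indep_set V E I" and J: "indep_set V E J"
    and rec: "reconfigurable V E I J"
  shows "\<exists>S t s. reconf_seq V E I J S \<and> length S \<le> run_time (card V) + 1 \<and>
    runs program (input_state vs es I J) t s \<and> t \<le> run_time (card V) \<and> output_of vs S (outp s)"
proof -
  let ?n = "length vs" and ?s = "input_state vs es I J"
  have n: "card V = ?n" using dist_vs set_vs distinct_card by metis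
  have "length es = card E"
    using enc unfolding graph_encoding_def by (metis distinct_card length_map)
  then have len: "length es \<le> ?n" using card_edges_tree[OF tree] n by simp
  obtain S0 where "reconf_seq V E I J S0" using rec unfolding reconfigurable_def by blast
  then have reach: "reach F {..<?n} (index vs I) (index vs J)" by (rule reconfigurable_index)
  have "wpt program ?s (run_time ?n)
    (\<lambda>s'. \<exists>M. trace F {..<?n} (index vs I) M (index vs J) \<and> outp s' = flat M)"
    by (rule wpt_program[OF _ len forest_F[OF forest_tree[OF tree]] _ _ _ _ _ _
          indep_index[OF I] _ reach])
      (use es_less in \<open>auto simp: input_state_def tok_def index_def\<close>)
  then obtain t s' M where t: "runs program ?s t s'" "t \<le> run_time ?n"
    and M: "trace F {..<?n} (index vs I) M (index vs J)" "outp s' = flat M"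
    unfolding wpt_def by blast
  have IV: "I \<subseteq> V" "J \<subseteq> V" using I J unfolding indep_set_def by auto
  have "index vs I \<subseteq> {..<?n}" by (auto simp: index_def)
  then obtain S where S: "reconf_seq V E I J S" "length S = Suc (length M)" "output_of vs S (flat M)"
    using trace_reconf_seq[OF M(1) indep_index[OF I]] IV by (auto simp: image_index)
  have "length (outp s') \<le> t"
    using runs_outp_length[OF t(1)] by (simp add: input_state_def)
  then have "length S \<le> run_time ?n + 1" using S(2) M(2) t(2) length_flat[of M] by simp
  then show ?thesis using S t unfolding n M(2)[symmetric] by blast
qed

end

text \<open>The bare existence of a short sequence is also read off a run of the program, and this
  needs at least one encoding to run on.\<close>

lemma encoding_exists:
  assumes "simple_graph V E"
  shows "\<exists>vs es. graph_encoding V E vs es"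
proof -
  have fin: "finite V" and E: "\<And>e. e \<in> E \<Longrightarrow> e \<subseteq> V \<and> card e = 2"
    using assms unfolding simple_graph_def by auto
  have "finite E" using finite_subset[of E "Pow V"] fin E by auto
  then obtain el where el: "set el = E" "distinct el" using finite_distinct_list by blast
  obtain vs where vs: "set vs = V" "distinct vs" using finite_distinct_list fin by blast
  let ?P = "\<lambda>e (i, j). i < length vs \<and> j < length vs \<and> {vs ! i, vs ! j} = e"
  have "\<exists>p. ?P e p" if e: "e \<in> E" for e
  proof -
    obtain a b where ab: "e = {a, b}" "a \<in> V" "b \<in> V"
      using E[OF e] by (metis card_2_iff insert_subset)
    then obtain i j where "i < length vs" "vs ! i = a" "j < length vs" "vs ! j = b"
      using vs by (metis in_set_conv_nth)
    then show ?thesis using ab by (intro exI[of _ "(i, j)"]) simp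
  qed
  then have "\<forall>e\<in>E. \<exists>p. ?P e p" by blast
  then obtain g where g': "\<forall>e\<in>E. ?P e (g e)" by (rule bchoice[THEN exE])
  have g: "?P e (g e)" if "e \<in> E" for e using g' that by (rule bspec)
  have "(\<lambda>(i, j). {vs ! i, vs ! j}) (g e) = e" if "e \<in> E" for e
    using g[OF that] by (cases "g e") simp
  then have m: "map (\<lambda>(i, j). {vs ! i, vs ! j}) (map g el) = el"
    unfolding map_map using el(1) by (intro map_idI) (simp add: comp_def)
  have "\<forall>(i, j)\<in>set (map g el). i < length vs \<and> j < length vs"
  proof clarify
    fix i j assume "(i, j) \<in> set (map g el)"
    then obtain e where "e \<in> E" "g e = (i, j)" using el(1) by auto
    then show "i < length vs \<and> j < length vs" using g[of e] by simp
  qed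
  then have "graph_encoding V E vs (map g el)"
    unfolding graph_encoding_def m using vs el by blast
  then show ?thesis by blast
qed

lemma run_time_bigo: "(\<lambda>n. real (run_time n)) \<in> O(\<lambda>n. (real n)\<^sup>2)"
\<comment> \<open>For \<open>n\<close> at least 1 the coefficients of the expanded polynomial below
  add up to 13595; 15000 is a round number above it.\<close>
proof (rule bigoI[where c = 15000], rule eventually_mono[OF eventually_ge_at_top[of 1]])
  fix n :: nat assume "1 \<le> n"
  then have "n \<le> n * n" "1 \<le> n * n" by simp_all
  moreover have "run_time n = 39 + 2756 * n + 10800 * (n * n)"
    by (simp add: run_time_def main_time_def algebra_simps)
  ultimately have "run_time n \<le> 15000 * (n * n)" by linarith
  then have "real (run_time n) \<le> 15000 * (real n * real n)"
    by (metis of_nat_le_iff of_nat_mult of_nat_numeral)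
  then show "norm (real (run_time n)) \<le> 15000 * norm ((real n)\<^sup>2)"
    by (simp add: power2_eq_square)
qed

theorem theorem2:
  shows "\<exists>(len :: nat \<Rightarrow> nat) (time :: nat \<Rightarrow> nat) (p :: com).
    (\<lambda>n. real (len n)) \<in> O(\<lambda>n. (real n)\<^sup>2) \<and>
    (\<lambda>n. real (time n)) \<in> O(\<lambda>n. (real n)\<^sup>2) \<and>
    (\<forall>(V :: 'a set) E I\<^sub>b I\<^sub>r n.
       tree V E \<longrightarrow> card V = n \<longrightarrow> indep_set V E I\<^sub>b \<longrightarrow> indep_set V E I\<^sub>r \<longrightarrow>
       reconfigurable V E I\<^sub>b I\<^sub>r \<longrightarrow>
         (\<exists>S. reconf_seq V E I\<^sub>b I\<^sub>r S \<and> length S \<le> len n) \<and>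
         (\<forall>vs es. graph_encoding V E vs es \<longrightarrow>
            (\<exists>S t s. reconf_seq V E I\<^sub>b I\<^sub>r S \<and> length S \<le> len n \<and>
               runs p (input_state vs es I\<^sub>b I\<^sub>r) t s \<and> t \<le> time n \<and>
               output_of vs S (outp s))))"
proof -
  have "(\<lambda>n. real (run_time n + 1)) \<in> O(\<lambda>n. (real n)\<^sup>2)"
  proof -
    have "(\<lambda>n. 1 :: real) \<in> O(\<lambda>n. (real n)\<^sup>2)"
      by (rule bigoI[where c = 1], rule eventually_mono[OF eventually_ge_at_top[of 1]]) simp
    then show ?thesis using sum_in_bigo(1)[OF run_time_bigo] by (simp add: add.commute)
  qed
  moreover have "(\<exists>S. reconf_seq V E I\<^sub>b I\<^sub>r S \<and> length S \<le> run_time (card V) + 1) \<and>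
    (\<forall>vs es. graph_encoding V E vs es \<longrightarrow>
      (\<exists>S t s. reconf_seq V E I\<^sub>b I\<^sub>r S \<and> length S \<le> run_time (card V) + 1 \<and>
        runs program (input_state vs es I\<^sub>b I\<^sub>r) t s \<and> t \<le> run_time (card V) \<and>
        output_of vs S (outp s)))"
    if "tree V E" "indep_set V E I\<^sub>b" "indep_set V E I\<^sub>r" "reconfigurable V E I\<^sub>b I\<^sub>r"
    for V :: "'a set" and E I\<^sub>b I\<^sub>r
    using program_correct[OF _ that] encoding_exists[of V E] that(1) unfolding tree_def by metis
  ultimately show ?thesis
    using run_time_bigo
    by (intro exI[of _ "\<lambda>n. run_time n + 1"] exI[of _ run_time] exI[of _ program]) blast
qed

end
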